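(* Let $(x_n)$ be a solution of the Somos-5 recurrence $x_nx_{n+5}=\alpha^{(0)}x_{n+1}x_{n+4}+\beta^{(0)}x_{n+2}x_{n+3}$ over $\mathbb{C}$, and let $y_n^{(i)},y_n^{(ii)},y_n^{(iii)},y_n^{(iv)}$ be the four associated shadow sequences and $C_n^{(4)},F_n$ the quantities defined in the context. A general solution of the linear inhomogeneous recurrence $$x_ny_{n+5}+y_nx_{n+5}-\alpha^{(0)}\left(x_{n+1}y_{n+4}+y_{n+1}x_{n+4}\right)-\beta^{(0)}\left(x_{n+2}y_{n+3}+y_{n+2}x_{n+3}\right)=\alpha^{(1)}x_{n+1}x_{n+4}+\beta^{(1)}x_{n+2}x_{n+3}$$ can be given in the form $$y_n=\sum_j f_n^{(j)}y_n^{(j)},$$ where the sum runs over $j=i,ii,iii,iv$. The coefficients $f_n^{(j)}$ are given by $$f_n^{(j)}=f_0^{(j)}+\sum_{k=0}^{n-1}\delta_k^{(j)}$$ for arbitrary constants $f_0^{(j)}$, and $$\begin{pmatrix}\delta^{(i)}_n\\ \delta^{(ii)}_n\\ \delta^{(iii)}_n\\ \delta^{(iv)}_n\end{pmatrix}=\frac{x_{n+4}F_n}{C_n^{(4)}}\begin{vmatrix} y^{(i)}_{n+1} & y^{(ii)}_{n+1} & y^{(iii)}_{n+1} & y^{(iv)}_{n+1} \\ y^{(i)}_{n+2} & y^{(ii)}_{n+2} & y^{(iii)}_{n+2} & y^{(iv)}_{n+2} \\ y^{(i)}_{n+3} & y^{(ii)}_{n+3} & y^{(iii)}_{n+3} &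 y^{(iv)}_{n+3} \\ y^{(i)}_{n+4} & y^{(ii)}_{n+4} & y^{(iii)}_{n+4} & y^{(iv)}_{n+4} \end{vmatrix}^{-1}\begin{pmatrix}d(ii,iii,iv)\\ d(i,iii,iv)\\ d(i,ii,iv)\\ d(i,ii,iii)\end{pmatrix},$$ where $$d(a,b,c)=\begin{vmatrix}y_{n+1}^{(a)}&y_{n+1}^{(b)}&y_{n+1}^{(c)}\\ y_{n+2}^{(a)}&y_{n+2}^{(b)}&y_{n+2}^{(c)}\\ y_{n+3}^{(a)}&y_{n+3}^{(b)}&y_{n+3}^{(c)}\end{vmatrix}.$$
   Context: Here $\alpha^{(0)},\beta^{(0)},\alpha^{(1)},\beta^{(1)}\in\mathbb{C}$. The two recurrences are the even and odd parts of the Somos-5 recurrence $X_nX_{n+5}=\alpha X_{n+1}X_{n+4}+\beta X_{n+2}X_{n+3}$ over the dual numbers, with $X_n=x_n+y_n\varepsilon$, $\alpha=\alpha^{(0)}+\alpha^{(1)}\varepsilon$, $\beta=\beta^{(0)}+\beta^{(1)}\varepsilon$, $\varepsilon^2=0$. Coefficients: $$C_n^{(4)}=\alpha^{(0)}x_nx_{n+2}^2x_{n+3}^2+\beta^{(0)}x_{n+1}x_{n+2}^3x_{n+3}-x_nx_{n+1}^2x_{n+4}^2,$$ $$D_n=\alpha^{(1)}\left(x_{n+1}^2x_{n+2}^2x_{n+4}+x_nx_{n+2}^2x_{n+3}^2\right)+\beta^{(1)}x_{n+1}x_{n+2}^3x_{n+3},$$ $$F_n=D_n-J^{(1)}x_nx_{n+1}x_{n+2}x_{n+3}x_{n+4}.$$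 The constant $J^{(1)}\in\mathbb{C}$ is an arbitrary parameter; it is the value, on the solution, of the odd part of the first integral $J=J^{(0)}+J^{(1)}\varepsilon$ (independent of $n$) of the dual recurrence, determined by $$X_nX_{n+1}X_{n+2}X_{n+3}X_{n+4}\,J=X_n^2X_{n+3}^2X_{n+4}+X_nX_{n+1}^2X_{n+4}^2+\alpha\left(X_{n+1}^2X_{n+2}^2X_{n+4}+X_nX_{n+2}^2X_{n+3}^2\right)+\beta X_{n+1}X_{n+2}^3X_{n+3}.$$ Analytic form of $x_n$. The general solution of the Somos-5 recurrence over $\mathbb{C}$ is $$x_n=A_{\pm}B_{\pm}^{\lfloor n/2\rfloor}\mu^{\lfloor n/2\rfloor^2}\sigma(n\kappa+z_0)$$ (subscript $+$ for $n$ even, $-$ for $n$ odd), where $\sigma$ is the Weierstrass sigma function of the curve $\mathrm{y}^2=4\mathrm{x}^3-g_2\mathrm{x}-g_3$ with $$\tilde\mu=(\beta^{(0)}+\alpha^{(0)}J^{(0)})^{1/4},\quad \tilde\lambda=\frac{1}{3\tilde\mu^2}\left(\frac{(J^{(0)})^2}{4}+\alpha^{(0)}\right),\quad g_2=12\tilde\lambda^2-2J^{(0)},\quad g_3=4\tilde\lambda^3-g_2\tilde\lambda-\tilde\mu^2,$$ $(\wp(\kappa),\wp'(\kappa))=(\tilde\lambda,\tilde\mu)$, $\mu=-\sigma(\kappa)^{-4}$, and $A_\pm$, $B_\pm$, $z_0$ are constants determined by the initial data, subject to $B_+=\sigma(\kappa)^4B_-$. The four shadow sequences (solutions of the linear recurrence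 with $\alpha^{(1)}=\beta^{(1)}=0$ having $J^{(1)}=0$) are: $y_n^{(i)}=x_n$ for $n$ even and $0$ for $n$ odd; $y_n^{(ii)}=x_n$ for $n$ odd and $0$ for $n$ even; $y_n^{(iii)}=n\,x_n$; $y_n^{(iv)}=\zeta(z_0+n\kappa)\,x_n$, where $\zeta=\sigma'/\sigma$ is the Weierstrass zeta function of the same curve.
   Formalization: The printed vector of 3x3 determinants has wrong signs (the printed formula fails for generic initial data); the formal version uses the cofactors (-d(ii,iii,iv), d(i,iii,iv), -d(i,ii,iv), d(i,ii,iii)), and assumes that all denominators are nonzero. *)

theory Defs
  imports "HOL-Complex_Analysis.Complex_Analysis"
begin

section \<open>Dual numbers over the complex field\<close>

datatype dual = Dual (re_dual: complex) (eps_dual: complex)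

instantiation dual :: comm_ring_1
begin

definition "0 = Dual 0 0"
definition "1 = Dual 1 0"
definition "a + b = Dual (re_dual a + re_dual b) (eps_dual a + eps_dual b)"
definition "a - b = Dual (re_dual a - re_dual b) (eps_dual a - eps_dual b)"
definition "- a = Dual (- re_dual a) (- eps_dual a)"
definition "a * b = Dual (re_dual a * re_dual b)
                         (re_dual a * eps_dual b + eps_dual a * re_dual b)"

instance
  by standard
     (auto simp: zero_dual_def one_dual_def plus_dual_def minus_dual_def uminus_dual_def
                 times_dual_def algebra_simps)

end


section \<open>The Somos-5 recurrence and its first integral\<close>

definition somos5 :: "'a::comm_ring_1 \<Rightarrow> 'a \<Rightarrow> (nat \<Rightarrow> 'a) \<Rightarrow> bool" where
  "somos5 \<alpha> \<beta> x \<longleftrightarrow>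
     (\<forall>n. x n * x (n+5) = \<alpha> * x (n+1) * x (n+4) + \<beta> * x (n+2) * x (n+3))"

text \<open>\<open>J\<close> is the value at \<open>n\<close> of the first integral, in denominator-free form.\<close>

definition somos5_integral_at ::
    "'a::comm_ring_1 \<Rightarrow> 'a \<Rightarrow> (nat \<Rightarrow> 'a) \<Rightarrow> 'a \<Rightarrow> nat \<Rightarrow> bool" where
  "somos5_integral_at \<alpha> \<beta> X J n \<longleftrightarrow>
     X n * X (n+1) * X (n+2) * X (n+3) * X (n+4) * J =
       X n ^ 2 * X (n+3) ^ 2 * X (n+4) + X n * X (n+1) ^ 2 * X (n+4) ^ 2
       + \<alpha> * (X (n+1) ^ 2 * X (n+2) ^ 2 * X (n+4) + X n * X (n+2) ^ 2 * X (n+3) ^ 2)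
       + \<beta> * X (n+1) * X (n+2) ^ 3 * X (n+3)"

definition linear_somos5 ::
    "complex \<Rightarrow> complex \<Rightarrow> complex \<Rightarrow> complex \<Rightarrow> (nat \<Rightarrow> complex) \<Rightarrow> (nat \<Rightarrow> complex) \<Rightarrow> bool" where
  "linear_somos5 \<alpha>0 \<beta>0 \<alpha>1 \<beta>1 x y \<longleftrightarrow>
     (\<forall>n. x n * y (n+5) + y n * x (n+5)
          - \<alpha>0 * (x (n+1) * y (n+4) + y (n+1) * x (n+4))
          - \<beta>0 * (x (n+2) * y (n+3) + y (n+2) * x (n+3))
          = \<alpha>1 * x (n+1) * x (n+4) + \<beta>1 * x (n+2) * x (n+3))"

definition C4 :: "complex \<Rightarrow> complex \<Rightarrow> (nat \<Rightarrow> complex) \<Rightarrow> nat \<Rightarrow> complex" where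
  "C4 \<alpha>0 \<beta>0 x n =
     \<alpha>0 * x n * x (n+2) ^ 2 * x (n+3) ^ 2 + \<beta>0 * x (n+1) * x (n+2) ^ 3 * x (n+3)
     - x n * x (n+1) ^ 2 * x (n+4) ^ 2"

definition D :: "complex \<Rightarrow> complex \<Rightarrow> (nat \<Rightarrow> complex) \<Rightarrow> nat \<Rightarrow> complex" where
  "D \<alpha>1 \<beta>1 x n =
     \<alpha>1 * (x (n+1) ^ 2 * x (n+2) ^ 2 * x (n+4) + x n * x (n+2) ^ 2 * x (n+3) ^ 2)
     + \<beta>1 * x (n+1) * x (n+2) ^ 3 * x (n+3)"

definition F :: "complex \<Rightarrow> complex \<Rightarrow> complex \<Rightarrow> (nat \<Rightarrow> complex) \<Rightarrow> nat \<Rightarrow> complex" where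
  "F \<alpha>1 \<beta>1 J1 x n = D \<alpha>1 \<beta>1 x n - J1 * x n * x (n+1) * x (n+2) * x (n+3) * x (n+4)"


section \<open>Weierstrass functions of a lattice\<close>

definition period_lattice :: "complex \<Rightarrow> complex \<Rightarrow> complex set" where
  "period_lattice \<omega>1 \<omega>2 = {of_int m * \<omega>1 + of_int n * \<omega>2 | m n. True}"

definition invariant_g2 :: "complex set \<Rightarrow> complex" where
  "invariant_g2 \<Lambda> = 60 * (\<Sum>\<^sub>\<infinity>w\<in>\<Lambda> - {0}. 1 / w ^ 4)"

definition invariant_g3 :: "complex set \<Rightarrow> complex" where
  "invariant_g3 \<Lambda> = 140 * (\<Sum>\<^sub>\<infinity>w\<in>\<Lambda> - {0}. 1 / w ^ 6)"

definition weierstrass_wp :: "complex set \<Rightarrow> complex \<Rightarrow> complex" where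
  "weierstrass_wp \<Lambda> z = 1 / z ^ 2 + (\<Sum>\<^sub>\<infinity>w\<in>\<Lambda> - {0}. 1 / (z - w) ^ 2 - 1 / w ^ 2)"

text \<open>
  The product of the factors \<open>(1 - z/w) * exp (z/w + (z/w)^2 / 2)\<close> is taken
  unconditionally, as the limit of the products over finite subsets of \<open>\<Lambda> - {0}\<close>.
\<close>

definition weierstrass_sigma :: "complex set \<Rightarrow> complex \<Rightarrow> complex" where
  "weierstrass_sigma \<Lambda> z =
     z * Lim (finite_subsets_at_top (\<Lambda> - {0})) (\<lambda>S. \<Prod>w\<in>S. weierstrass_factor 2 (z / w))"

definition weierstrass_zeta :: "complex set \<Rightarrow> complex \<Rightarrow> complex" where
  "weierstrass_zeta \<Lambda> z = deriv (weierstrass_sigma \<Lambda>) z / weierstrass_sigma \<Lambda> z"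


section \<open>Shadow sequences and variation of parameters\<close>

datatype shadow_index = S1 | S2 | S3 | S4

text \<open>The parameters \<open>\<Lambda>\<close>, \<open>\<kappa>\<close>, \<open>z0\<close> are those of the sigma function form of \<open>x\<close>.\<close>

fun shadow :: "complex set \<Rightarrow> complex \<Rightarrow> complex \<Rightarrow> (nat \<Rightarrow> complex) \<Rightarrow>
               shadow_index \<Rightarrow> nat \<Rightarrow> complex" where
  "shadow \<Lambda> \<kappa> z0 x S1 n = (if even n then x n else 0)"
| "shadow \<Lambda> \<kappa> z0 x S2 n = (if odd n then x n else 0)"
| "shadow \<Lambda> \<kappa> z0 x S3 n = of_nat n * x n"
| "shadow \<Lambda> \<kappa> z0 x S4 n = weierstrass_zeta \<Lambda> (z0 + of_nat n * \<kappa>) * x n"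

definition det4 :: "(shadow_index \<Rightarrow> nat \<Rightarrow> complex) \<Rightarrow> nat \<Rightarrow> complex" where
  "det4 Y n = det (vector
     [vector [Y S1 (n+1), Y S2 (n+1), Y S3 (n+1), Y S4 (n+1)],
      vector [Y S1 (n+2), Y S2 (n+2), Y S3 (n+2), Y S4 (n+2)],
      vector [Y S1 (n+3), Y S2 (n+3), Y S3 (n+3), Y S4 (n+3)],
      vector [Y S1 (n+4), Y S2 (n+4), Y S3 (n+4), Y S4 (n+4)]] :: complex ^ 4 ^ 4)"

definition det3 :: "(shadow_index \<Rightarrow> nat \<Rightarrow> complex) \<Rightarrow> nat \<Rightarrow>
                    shadow_index \<Rightarrow> shadow_index \<Rightarrow> shadow_index \<Rightarrow> complex" where
  "det3 Y n a b c = det (vector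
     [vector [Y a (n+1), Y b (n+1), Y c (n+1)],
      vector [Y a (n+2), Y b (n+2), Y c (n+2)],
      vector [Y a (n+3), Y b (n+3), Y c (n+3)]] :: complex ^ 3 ^ 3)"

text \<open>
  The increments \<open>\<delta> j n\<close> solve the linear system
  \<open>(\<Sum>j. \<delta> j n * Y j (n+k)) = 0\<close> for \<open>k = 1, 2, 3\<close> and
  \<open>(\<Sum>j. \<delta> j n * Y j (n+4)) = x (n+4) * F n / C4 n\<close>. By Cramer's rule they are
  the cofactors of the last row of the matrix in \<open>det4\<close>, up to the common factor; the
  alternating signs below are those of the cofactors.
\<close>

fun signed_minor :: "(shadow_index \<Rightarrow> nat \<Rightarrow> complex) \<Rightarrow> nat \<Rightarrow> shadow_index \<Rightarrow> complex" where
  "signed_minor Y n S1 = - det3 Y n S2 S3 S4"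
| "signed_minor Y n S2 =   det3 Y n S1 S3 S4"
| "signed_minor Y n S3 = - det3 Y n S1 S2 S4"
| "signed_minor Y n S4 =   det3 Y n S1 S2 S3"

definition delta ::
    "complex \<Rightarrow> complex \<Rightarrow> complex \<Rightarrow> complex \<Rightarrow> complex \<Rightarrow> (nat \<Rightarrow> complex) \<Rightarrow>
     (shadow_index \<Rightarrow> nat \<Rightarrow> complex) \<Rightarrow> shadow_index \<Rightarrow> nat \<Rightarrow> complex" where
  "delta \<alpha>0 \<beta>0 \<alpha>1 \<beta>1 J1 x Y j n =
     x (n+4) * F \<alpha>1 \<beta>1 J1 x n / C4 \<alpha>0 \<beta>0 x n * inverse (det4 Y n) * signed_minor Y n j"

definition coefficient ::
    "complex \<Rightarrow> complex \<Rightarrow> complex \<Rightarrow> complex \<Rightarrow> complex \<Rightarrow> (nat \<Rightarrow> complex) \<Rightarrow>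
     (shadow_index \<Rightarrow> nat \<Rightarrow> complex) \<Rightarrow> (shadow_index \<Rightarrow> complex) \<Rightarrow>
     shadow_index \<Rightarrow> nat \<Rightarrow> complex" where
  "coefficient \<alpha>0 \<beta>0 \<alpha>1 \<beta>1 J1 x Y f0 j n =
     f0 j + (\<Sum>k<n. delta \<alpha>0 \<beta>0 \<alpha>1 \<beta>1 J1 x Y j k)"

definition solution_formula ::
    "complex \<Rightarrow> complex \<Rightarrow> complex \<Rightarrow> complex \<Rightarrow> complex \<Rightarrow> (nat \<Rightarrow> complex) \<Rightarrow>
     (shadow_index \<Rightarrow> nat \<Rightarrow> complex) \<Rightarrow> (shadow_index \<Rightarrow> complex) \<Rightarrow> nat \<Rightarrow> complex" where
  "solution_formula \<alpha>0 \<beta>0 \<alpha>1 \<beta>1 J1 x Y f0 n =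
     (\<Sum>j\<in>{S1, S2, S3, S4}. coefficient \<alpha>0 \<beta>0 \<alpha>1 \<beta>1 J1 x Y f0 j n * Y j n)"

end

(*
  Write v(a) = wp(a) - wp(kappa), m = wp'(kappa), J = wp''(kappa). The addition formula for sigma
  gives x_n x_{n+3} / (x_{n+1} x_{n+2}) = v(a) v(a + kappa) with a = z0 + (n+1) kappa, so that the
  first integral can be studied through the two identities
    v(a)^2 (v(a+kappa) + v(a-kappa)) - J v(a) = m^2,
    v(a)^2 v(a+kappa) v(a-kappa) + m^2 v(a) = const.
  Both left-hand sides are elliptic functions of a without poles, hence constant by Liouville's
  theorem. Differentiating them in a shows that the infinitesimal shift of z0, which is the fourth
  shadow sequence, annihilates the linearised first integral; the other three come from scaling
  symmetries. Variation of constants is applied to this fourth-order linearised first integral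
  rather than to the fifth-order recurrence: its leading coefficient is -C4 / x_{n+4}. The two
  are linked by X_n Phi_{n+1} - X_{n+5} Phi_n = G R over the dual numbers, where Phi is the defect of
  the first integral, R that of the recurrence, and G is proportional to C4 at n+1.
*)

theory Submission
  imports Defs
begin

section \<open>Series of holomorphic functions and lattice sums\<close>

text \<open>Divided by its \<beta>-monomial, the first integral reads s + (\<alpha> s + \<beta>) / t
  = J with s = v(a) (v(a - \<kappa>) + v(a + \<kappa>)) and t = v(a - \<kappa>) v(a)^2 v(a +
  \<kappa>). The two identities say s = J + m^2 / v(a) and t = c - m^2 v(a); inserting them into the
  integral of the given solution forces c = - \<alpha>, and then the integral is J for every a, not
  only at the sampled points. That is why differentiation in a is legitimate. The product defining
  \<sigma> is unconditional, so holomorphy, zeros, \<zeta> and \<wp> are all taken from one local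
  splitting: a finite product times the exponential of a uniformly convergent sum. Over the dual
  numbers \<epsilon> is a zero divisor. Passing from the recurrence to the integral cancels X_n,
  passing back cancels G, so both need a nonzero complex part; this is one role of the nonvanishing
  of x and C4. The parameters are J1 and four constants f0, five in all, the order of the
  recurrence. For a given solution y, J1 is read off from the linearised integral at n = 0.\<close>

lemma summable_on_int_powr:
  assumes "s > 1"
  shows "(\<lambda>m::int. (1 + real_of_int \<bar>m\<bar>) powr - s) summable_on UNIV"
proof -
  have "summable (\<lambda>n. real (Suc n) powr - s)"
    using assms by (subst summable_Suc_iff) (simp add: summable_real_powr_iff)
  then have nat: "(\<lambda>n. real (Suc n) powr - s) summable_on UNIV"
    by (subst summable_on_UNIV_nonneg_real_iff) auto
  have "(\<lambda>m::int. (1 + real_of_int \<bar>m\<bar>) powr - s) summable_on range int"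
    by (subst summable_on_reindex) (use nat in \<open>auto simp: o_def add_ac\<close>)
  moreover have "(\<lambda>m::int. (1 + real_of_int \<bar>m\<bar>) powr - s) summable_on range (\<lambda>n. - int n)"
    by (subst summable_on_reindex) (use nat in \<open>auto simp: o_def add_ac inj_def\<close>)
  ultimately have "(\<lambda>m::int. (1 + real_of_int \<bar>m\<bar>) powr - s) summable_on
      (range int \<union> range (\<lambda>n. - int n))"
    by (rule summable_on_union)
  also have "range int \<union> range (\<lambda>n. - int n) = UNIV"
    by (auto simp: image_iff) (metis int_cases2)
  finally show ?thesis .
qed

text \<open>The M-test over unordered index sets, with termwise differentiation of every order.
  Locally uniform limits of holomorphic functions commute with derivatives, so a single estimate on
  \<open>log_factor\<close> later covers \<sigma>, \<zeta>, \<wp> and two derivatives of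
  \<wp>.\<close>

lemma holomorphic_infsum:
  fixes f :: "'i \<Rightarrow> complex \<Rightarrow> complex"
  assumes U: "open U" and holo: "\<And>i. i \<in> I \<Longrightarrow> f i holomorphic_on U"
    and bound: "\<And>i z. i \<in> I \<Longrightarrow> z \<in> U \<Longrightarrow> norm (f i z) \<le> M i"
    and M: "M summable_on I"
  shows "(\<lambda>z. \<Sum>\<^sub>\<infinity>i\<in>I. f i z) holomorphic_on U"
    and "z \<in> U \<Longrightarrow> ((\<lambda>i. (deriv ^^ m) (f i) z) has_sum (deriv ^^ m) (\<lambda>z. \<Sum>\<^sub>\<infinity>i\<in>I. f i z) z) I"
proof -
  define F where "F = (\<lambda>z. \<Sum>\<^sub>\<infinity>i\<in>I. f i z)"
  have ul: "uniform_limit U (\<lambda>X z. \<Sum>i\<in>X. f i z) F (finite_subsets_at_top I)"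
    unfolding F_def using bound M by (rule Weierstrass_m_test_general)
  have ev: "eventually (\<lambda>X. finite X \<and> X \<subseteq> I) (finite_subsets_at_top I)"
    by (rule eventually_finite_subsets_at_top_weakI) auto
  have ev_holo: "eventually (\<lambda>X. (\<lambda>z. \<Sum>i\<in>X. f i z) holomorphic_on U) (finite_subsets_at_top I)"
    using ev by eventually_elim (use holo in \<open>auto intro!: holomorphic_intros\<close>)
  have "F holomorphic_on U"
  proof (rule holomorphic_on_open[THEN iffD2, OF U, rule_format])
    fix z assume "z \<in> U"
    then obtain r where r: "r > 0" "cball z r \<subseteq> U"
      using U by (meson open_contains_cball)
    have "F holomorphic_on ball z r"
    proof (rule holomorphic_uniform_limit[THEN conjunct2, OF _ uniform_limit_on_subset[OF ul r(2)]])
      show "\<forall>\<^sub>F X in finite_subsets_at_top I. continuous_on (cball z r) (\<lambda>z. \<Sum>i\<in>X. f i z) \<and>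
              (\<lambda>z. \<Sum>i\<in>X. f i z) holomorphic_on ball z r"
        using ev_holo
        by eventually_elim (meson ball_subset_cball holomorphic_on_imp_continuous_on
            holomorphic_on_subset r(2))
    qed auto
    then show "\<exists>f'. (F has_field_derivative f') (at z)"
      using r(1) by (meson centre_in_ball holomorphic_derivI open_ball)
  qed
  then show "(\<lambda>z. \<Sum>\<^sub>\<infinity>i\<in>I. f i z) holomorphic_on U"
    by (simp add: F_def)
  assume z: "z \<in> U"
  have sum: "(deriv ^^ m) (\<lambda>z. \<Sum>i\<in>X. f i z) z = (\<Sum>i\<in>X. (deriv ^^ m) (f i) z)"
    if "finite X" "X \<subseteq> I" for X
    using that
  proof (induction X rule: finite_induct)
    case (insert i X)
    have "(deriv ^^ m) (\<lambda>z. f i z + (\<Sum>i\<in>X. f i z)) z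
        = (deriv ^^ m) (f i) z + (deriv ^^ m) (\<lambda>z. \<Sum>i\<in>X. f i z) z"
      by (rule higher_deriv_add[OF _ _ U z]) (use insert holo in \<open>auto intro!: holomorphic_intros\<close>)
    then show ?case using insert by simp
  qed auto
  have "((\<lambda>X. (deriv ^^ m) (\<lambda>z. \<Sum>i\<in>X. f i z) z) \<longlongrightarrow> (deriv ^^ m) F z) (finite_subsets_at_top I)"
    by (rule higher_deriv_complex_uniform_limit[OF ul ev_holo _ U z]) simp
  also have "?this \<longleftrightarrow> ((\<lambda>X. \<Sum>i\<in>X. (deriv ^^ m) (f i) z) \<longlongrightarrow> (deriv ^^ m) F z) (finite_subsets_at_top I)"
    by (rule tendsto_cong) (use ev in eventually_elim, use sum in auto)
  finally show "((\<lambda>i. (deriv ^^ m) (f i) z) has_sum (deriv ^^ m) (\<lambda>z. \<Sum>\<^sub>\<infinity>i\<in>I. f i z) z) I"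
    by (simp add: has_sum_def F_def)
qed

section \<open>Period lattices: growth, discreteness, reduction to a bounded region\<close>

locale complex_lattice =
  fixes \<omega>1 \<omega>2 :: complex and \<Lambda> :: "complex set"
  assumes lattice_def: "\<Lambda> = period_lattice \<omega>1 \<omega>2"
    and nondegenerate: "Im (\<omega>2 / \<omega>1) \<noteq> 0"
begin

lemma omega1_nonzero: "\<omega>1 \<noteq> 0"
  using nondegenerate by auto

lemma zero_in_lattice [simp]: "0 \<in> \<Lambda>"
  unfolding lattice_def period_lattice_def by (rule CollectI) (rule exI[of _ 0], rule exI[of _ 0], simp)

lemma lattice_add: "w \<in> \<Lambda> \<Longrightarrow> w' \<in> \<Lambda> \<Longrightarrow> w + w' \<in> \<Lambda>"
  unfolding lattice_def period_lattice_def
proof clarsimp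
  fix m n m' n' :: int
  show "\<exists>k l. of_int m * \<omega>1 + of_int n * \<omega>2 + (of_int m' * \<omega>1 + of_int n' * \<omega>2)
          = of_int k * \<omega>1 + of_int l * \<omega>2"
    by (rule exI[of _ "m + m'"], rule exI[of _ "n + n'"]) (simp add: algebra_simps)
qed

lemma lattice_uminus: "w \<in> \<Lambda> \<Longrightarrow> - w \<in> \<Lambda>"
  unfolding lattice_def period_lattice_def
proof clarsimp
  fix m n :: int
  show "\<exists>k l. - (of_int m * \<omega>1) - of_int n * \<omega>2 = of_int k * \<omega>1 + of_int l * \<omega>2"
    by (rule exI[of _ "-m"], rule exI[of _ "-n"]) (simp add: algebra_simps)
qed

lemma lattice_uminus_iff [simp]: "- w \<in> \<Lambda> \<longleftrightarrow> w \<in> \<Lambda>"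
  using lattice_uminus[of w] lattice_uminus[of "-w"] by auto

lemma lattice_add_iff [simp]: "w \<in> \<Lambda> \<Longrightarrow> z + w \<in> \<Lambda> \<longleftrightarrow> z \<in> \<Lambda>"
  using lattice_add[of z w] lattice_add[of "z + w" "- w"] by auto

lemma lattice_diff_iff [simp]: "w \<in> \<Lambda> \<Longrightarrow> z - w \<in> \<Lambda> \<longleftrightarrow> z \<in> \<Lambda>"
  using lattice_add_iff[of "-w" z] by simp

lemma lattice_diff_iff' [simp]: "w \<in> \<Lambda> \<Longrightarrow> w - z \<in> \<Lambda> \<longleftrightarrow> z \<in> \<Lambda>"
  using lattice_diff_iff[of w z] lattice_uminus_iff[of "z - w"] by simp

text \<open>The imaginary part of z / \<omega>1 sees only n, which bounds |n|; then m \<omega>1 = z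
  - n \<omega>2 bounds |m|. Summability, injectivity of the parametrisation and local finiteness all
  rest on this linear bound.\<close>

lemma lattice_bound:
  obtains c where "c > 0"
    "\<And>m n. \<bar>real_of_int m\<bar> + \<bar>real_of_int n\<bar> \<le> c * norm (of_int m * \<omega>1 + of_int n * \<omega>2)"
proof -
  define a where "a = norm \<omega>1 * \<bar>Im (\<omega>2 / \<omega>1)\<bar>"
  have a: "a > 0" using omega1_nonzero nondegenerate by (simp add: a_def)
  define c where "c = 1 / a + (1 + norm \<omega>2 / a) / norm \<omega>1"
  have "c > 0" using a omega1_nonzero by (auto simp: c_def intro!: add_pos_nonneg)
  moreover have "\<bar>real_of_int m\<bar> + \<bar>real_of_int n\<bar> \<le> c * norm (of_int m * \<omega>1 + of_int n * \<omega>2)" for m n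
  proof -
    define z where "z = of_int m * \<omega>1 + of_int n * \<omega>2"
    have "z / \<omega>1 = of_int m + of_int n * (\<omega>2 / \<omega>1)"
      using omega1_nonzero by (simp add: z_def field_simps)
    then have "Im (z / \<omega>1) = real_of_int n * Im (\<omega>2 / \<omega>1)"
      by (simp del: times_divide_eq_right)
    then have "\<bar>real_of_int n\<bar> * \<bar>Im (\<omega>2 / \<omega>1)\<bar> \<le> norm z / norm \<omega>1"
      by (metis abs_Im_le_cmod abs_mult norm_divide)
    then have n: "\<bar>real_of_int n\<bar> \<le> norm z / a"
      using a omega1_nonzero nondegenerate by (simp add: a_def field_simps)
    have "norm (of_int m * \<omega>1) = norm (z - of_int n * \<omega>2)" by (simp add: z_def)
    also have "\<dots> \<le> norm z + norm (of_int n * \<omega>2)" by (rule norm_triangle_ineq4)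
    also have "\<dots> \<le> norm z + norm z / a * norm \<omega>2"
      using n by (simp add: norm_mult mult_right_mono del: times_divide_eq_left)
    finally have "\<bar>real_of_int m\<bar> \<le> (norm z + norm z / a * norm \<omega>2) / norm \<omega>1"
      using omega1_nonzero by (simp add: norm_mult field_simps)
    with n have "\<bar>real_of_int m\<bar> + \<bar>real_of_int n\<bar> \<le> c * norm z"
      by (simp add: c_def algebra_simps add_divide_distrib)
    then show ?thesis by (simp add: z_def)
  qed
  ultimately show thesis by (rule that)
qed

text \<open>Since 1 + |m| and 1 + |n| are both at most a constant times |w|, the power |w|^3
  dominates ((1 + |m|) (1 + |n|)) powr (3/2) up to a constant. The double series is therefore
  bounded by a product of two single series of exponent 3/2 > 1.\<close>

lemma summable_lattice: "(\<lambda>w. 1 / norm w ^ 3) summable_on (\<Lambda> - {0})"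
proof -
  obtain c where c: "c > 0"
    "\<And>m n. \<bar>real_of_int m\<bar> + \<bar>real_of_int n\<bar> \<le> c * norm (of_int m * \<omega>1 + of_int n * \<omega>2)"
    by (rule lattice_bound) blast
  define g where "g = (\<lambda>(m, n). of_int m * \<omega>1 + of_int n * \<omega>2)"
  have g0: "p = (0, 0)" if "g p = 0" for p
    using c(2)[of "fst p" "snd p"] that by (cases p) (auto simp: g_def)
  have inj: "inj g"
  proof (rule injI)
    fix p q assume "g p = g q"
    then have "g (fst p - fst q, snd p - snd q) = 0"
      by (simp add: g_def case_prod_unfold algebra_simps)
    then show "p = q" using g0 by (metis diff_eq_diff_eq diff_self prod.collapse prod.inject)
  qed
  have range: "\<Lambda> - {0} = g ` (UNIV - {(0, 0)})"
    using g0 by (auto simp: lattice_def period_lattice_def g_def image_iff)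
  define h where "h = (\<lambda>m::int. (1 + real_of_int \<bar>m\<bar>) powr - (3/2))"
  have h: "h summable_on UNIV" unfolding h_def by (rule summable_on_int_powr) simp
  have "(\<lambda>(m, n). h m * h n) summable_on UNIV \<times> UNIV"
  proof (rule summable_on_SigmaI)
    show "((\<lambda>n. case (m, n) of (m, n) \<Rightarrow> h m * h n) has_sum h m * infsum h UNIV) UNIV" for m
      using h by (auto intro!: has_sum_cmult_right has_sum_infsum)
    show "(\<lambda>m. h m * infsum h UNIV) summable_on UNIV"
      using h by (intro summable_on_cmult_left)
  qed (auto simp: h_def)
  then have "(\<lambda>p. (2 * c) ^ 3 * (h (fst p) * h (snd p))) summable_on UNIV - {(0, 0)}"
    by (intro summable_on_cmult_right) (auto simp: case_prod_unfold intro: summable_on_subset_banach)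
  then have "(\<lambda>p. 1 / norm (g p) ^ 3) summable_on UNIV - {(0, 0)}"
  proof (rule summable_on_comparison_test)
    fix p :: "int \<times> int" assume p: "p \<in> UNIV - {(0, 0)}"
    obtain m n where [simp]: "p = (m, n)" by (cases p)
    define A B N where "A = 1 + \<bar>real_of_int m\<bar>" and "B = 1 + \<bar>real_of_int n\<bar>" and "N = norm (g p)"
    \<comment> \<open>A nonzero lattice point has |m| + |n| at least 1, which absorbs the summand 1
      in \<open>A\<close> and \<open>B\<close> at the cost of the factor 2.\<close>
    have "1 \<le> \<bar>real_of_int m\<bar> + \<bar>real_of_int n\<bar>" using p by (cases "m = 0"; simp)
    then have N: "A \<le> 2 * c * N" "B \<le> 2 * c * N"
      using c(2)[of m n] by (auto simp: A_def B_def N_def g_def)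
    have AB: "A > 0" "B > 0" by (auto simp: A_def B_def)
    with N have cN: "2 * c * N > 0" by linarith
    have "(A * B) powr (3/2) \<le> ((2 * c * N) * (2 * c * N)) powr (3/2)"
      using N AB cN by (intro powr_mono2 mult_mono) auto
    also have "(2 * c * N) * (2 * c * N) = (2 * c * N) powr 2"
      using cN by (simp add: power2_eq_square)
    also have "\<dots> powr (3/2) = (2 * c * N) powr 3"
      by (simp add: powr_powr del: powr_numeral)
    also have "\<dots> = (2 * c * N) ^ 3"
      using cN by simp
    finally have le: "(A * B) powr (3/2) \<le> (2 * c) ^ 3 * N ^ 3" by (simp add: power_mult_distrib)
    have "N > 0" using cN c(1) by (simp add: zero_less_mult_iff)
    then have "1 / N ^ 3 \<le> (2 * c) ^ 3 / (A * B) powr (3/2)"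
      using le AB by (simp add: field_simps)
    also have "\<dots> = (2 * c) ^ 3 * (h m * h n)"
      using AB by (simp add: h_def A_def B_def powr_mult powr_minus divide_simps)
    finally show "1 / norm (g p) ^ 3 \<le> (2 * c) ^ 3 * (h (fst p) * h (snd p))" by (simp add: N_def)
  qed simp
  then show ?thesis unfolding range
    by (subst summable_on_reindex) (auto simp: o_def intro: inj_on_subset[OF inj])
qed

lemma finite_lattice_cball: "finite (\<Lambda> \<inter> cball 0 R)"
proof -
  obtain c where c: "c > 0"
    "\<And>m n. \<bar>real_of_int m\<bar> + \<bar>real_of_int n\<bar> \<le> c * norm (of_int m * \<omega>1 + of_int n * \<omega>2)"
    by (rule lattice_bound) blast
  define K where "K = \<lceil>c * R\<rceil>"
  have "\<bar>m\<bar> \<le> K \<and> \<bar>n\<bar> \<le> K" if "norm (of_int m * \<omega>1 + of_int n * \<omega>2) \<le> R" for m n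
  proof -
    have "\<bar>real_of_int m\<bar> + \<bar>real_of_int n\<bar> \<le> c * R"
      using c(2)[of m n] mult_left_mono[OF that, of c] c(1) by linarith
    then show ?thesis unfolding K_def by linarith
  qed
  then have "\<Lambda> \<inter> cball 0 R \<subseteq> (\<lambda>(m, n). of_int m * \<omega>1 + of_int n * \<omega>2) ` ({-K..K} \<times> {-K..K})"
    by (force simp: lattice_def period_lattice_def image_iff)
  then show ?thesis by (rule finite_subset) auto
qed

text \<open>The coordinates of z in the real basis \<omega>1, \<omega>2, minus their floors, lie
  between 0 and 1. Every value of a periodic function is thus taken on one fixed ball, as
  Liouville's theorem will require.\<close>

lemma lattice_reduction:
  obtains w where "w \<in> \<Lambda>" "norm (z - w) \<le> norm \<omega>1 + norm \<omega>2"
proof -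
  define t where "t = Im (z / \<omega>1) / Im (\<omega>2 / \<omega>1)"
  define s where "s = Re (z / \<omega>1) - t * Re (\<omega>2 / \<omega>1)"
  have "z / \<omega>1 = of_real s + of_real t * (\<omega>2 / \<omega>1)"
    using nondegenerate by (simp add: complex_eq_iff s_def t_def del: times_divide_eq_right)
  then have z: "z = of_real s * \<omega>1 + of_real t * \<omega>2"
    using omega1_nonzero by (simp add: field_simps)
  define w where "w = of_int \<lfloor>s\<rfloor> * \<omega>1 + of_int \<lfloor>t\<rfloor> * \<omega>2"
  have "z - w = of_real (s - \<lfloor>s\<rfloor>) * \<omega>1 + of_real (t - \<lfloor>t\<rfloor>) * \<omega>2"
    by (simp add: z w_def algebra_simps)
  also have "norm \<dots> \<le> norm (of_real (s - \<lfloor>s\<rfloor>) * \<omega>1) + norm (of_real (t - \<lfloor>t\<rfloor>) * \<omega>2)"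
    by (rule norm_triangle_ineq)
  also have "\<dots> \<le> 1 * norm \<omega>1 + 1 * norm \<omega>2"
    unfolding norm_mult norm_of_real by (intro add_mono mult_right_mono norm_ge_zero) linarith+
  finally show thesis using that[of w] by (auto simp: w_def lattice_def period_lattice_def)
qed

end

section \<open>Local form of the Weierstrass functions\<close>

context complex_lattice
begin

text \<open>The cut at 2 R gives |z / w| < 1/2 for z in \<open>ball 0 R\<close> and w in
  \<open>far R\<close>: there 1 - z / w stays in the right half-plane, where \<open>Ln\<close> is
  holomorphic, and |z - w| is at least |w| / 2.\<close>

definition near :: "real \<Rightarrow> complex set" where
  "near R = {w \<in> \<Lambda> - {0}. norm w \<le> 2 * R}"

definition far :: "real \<Rightarrow> complex set" where
  "far R = {w \<in> \<Lambda> - {0}. norm w > 2 * R}"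

definition log_factor :: "complex \<Rightarrow> complex \<Rightarrow> complex" where
  "log_factor w z = Ln (1 - z / w) + z / w + (z / w) ^ 2 / 2"

definition log_sum :: "real \<Rightarrow> complex \<Rightarrow> complex" where
  "log_sum R z = (\<Sum>\<^sub>\<infinity>w\<in>far R. log_factor w z)"

lemma finite_near [simp]: "finite (near R)"
  by (rule finite_subset[OF _ finite_lattice_cball[of "2 * R"]]) (auto simp: near_def)

lemma near_Un_far: "near R \<union> far R = \<Lambda> - {0}" and near_Int_far: "near R \<inter> far R = {}"
  by (auto simp: near_def far_def)

lemma far_facts:
  assumes "w \<in> far R" "z \<in> ball 0 R"
  shows "w \<noteq> 0" "z \<noteq> w" "norm (z / w) < 1 / 2" "norm w / 2 \<le> norm (z - w)"
proof -
  from assms have *: "norm w > 2 * R" "norm z < R" "w \<noteq> 0" by (auto simp: far_def)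
  then show "w \<noteq> 0" "norm (z / w) < 1 / 2" by (auto simp: norm_divide field_simps)
  have "norm z < norm w" using * norm_ge_zero[of z] by linarith
  then show "z \<noteq> w" by auto
  show "norm w / 2 \<le> norm (z - w)"
    using * norm_triangle_ineq2[of w z] by (simp add: norm_minus_commute)
qed

lemma exp_log_factor:
  assumes "w \<in> far R" "z \<in> ball 0 R"
  shows "exp (log_factor w z) = weierstrass_factor 2 (z / w)"
proof -
  have "1 - z / w \<noteq> 0" using far_facts(2)[OF assms] by (auto simp: field_simps)
  then show ?thesis
    by (simp add: log_factor_def weierstrass_factor_def exp_add numeral_2_eq_2)
qed

lemma log_factor_deriv:
  assumes "w \<in> far R" "z \<in> ball 0 R"
  shows "(log_factor w has_field_derivative z ^ 2 / (w ^ 2 * (z - w))) (at z)"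
proof -
  note facts = far_facts[OF assms]
  have "Re (z / w) \<le> norm (z / w)" by (rule complex_Re_le_cmod)
  with facts(3) have "Re (1 - z / w) > 0" by simp
  then have "1 - z / w \<notin> \<real>\<^sub>\<le>\<^sub>0" using complex_nonpos_Reals_iff by force
  then have "((\<lambda>z. Ln (1 - z / w)) has_field_derivative inverse (1 - z / w) * (- (1 / w))) (at z)"
    using facts(1)
    by (intro DERIV_chain2[OF has_field_derivative_Ln]) (auto intro!: derivative_eq_intros)
  moreover have "((\<lambda>z. z / w) has_field_derivative 1 / w) (at z)"
    using facts(1) by (auto intro!: derivative_eq_intros)
  moreover have "((\<lambda>z. (z / w) ^ 2 / 2) has_field_derivative z / w ^ 2) (at z)"
    using facts(1) by (auto intro!: derivative_eq_intros simp: power2_eq_square)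
  ultimately have "(log_factor w has_field_derivative
      inverse (1 - z / w) * (- (1 / w)) + 1 / w + z / w ^ 2) (at z)"
    unfolding log_factor_def[abs_def] by (intro DERIV_add)
  also have "inverse (1 - z / w) * (- (1 / w)) = 1 / (z - w)"
    using facts(1,2) by (simp add: field_simps)
  also have "1 / (z - w) + 1 / w + z / w ^ 2 = z ^ 2 / (w ^ 2 * (z - w))"
    using facts(1,2) by (simp add: divide_simps) (simp add: algebra_simps power2_eq_square)
  finally show ?thesis .
qed

lemma log_factor_holomorphic: "w \<in> far R \<Longrightarrow> log_factor w holomorphic_on ball 0 R"
  using log_factor_deriv by (subst holomorphic_on_open) blast+

text \<open>\<open>log_factor w\<close> vanishes at 0, and its two correction terms reduce the
  derivative to z^2 / (w^2 (z - w)). Bounding this on the ball gives decay of order |w|^-3, the rate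
  summed in \<open>summable_lattice\<close>.\<close>

lemma log_factor_bound:
  assumes w: "w \<in> far R" and z: "z \<in> ball 0 R"
  shows "norm (log_factor w z) \<le> 2 * R ^ 3 * (1 / norm w ^ 3)"
proof -
  have R: "R > 0" using z by (metis ball_eq_empty empty_iff not_le)
  have "norm (log_factor w z - log_factor w 0) \<le> (2 * R ^ 2 / norm w ^ 3) * norm (z - 0)"
  proof (rule field_differentiable_bound[of "ball 0 R"])
    fix u :: complex assume u: "u \<in> ball 0 R"
    show "(log_factor w has_field_derivative u ^ 2 / (w ^ 2 * (u - w))) (at u within ball 0 R)"
      using log_factor_deriv[OF w u] by (rule has_field_derivative_at_within)
    note facts = far_facts[OF w u]
    have "norm (u ^ 2 / (w ^ 2 * (u - w))) = norm u ^ 2 / (norm w ^ 2 * norm (u - w))"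
      by (simp add: norm_divide norm_mult norm_power)
    also have "\<dots> \<le> R ^ 2 / (norm w ^ 2 * (norm w / 2))"
      using u facts R by (intro frac_le power_mono mult_left_mono) auto
    finally show "norm (u ^ 2 / (w ^ 2 * (u - w))) \<le> 2 * R ^ 2 / norm w ^ 3"
      by (simp add: power2_eq_square power3_eq_cube mult_ac)
  qed (use z R in auto)
  also have "\<dots> \<le> (2 * R ^ 2 / norm w ^ 3) * R"
    using z by (intro mult_left_mono) auto
  finally show ?thesis by (simp add: log_factor_def power2_eq_square power3_eq_cube mult_ac)
qed

lemma summable_log_bound: "(\<lambda>w. 2 * R ^ 3 * (1 / norm w ^ 3)) summable_on far R"
  by (intro summable_on_cmult_right summable_on_subset_banach[OF summable_lattice])
     (auto simp: far_def)

lemma log_sum_holomorphic: "log_sum R holomorphic_on ball 0 R"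
  unfolding log_sum_def[abs_def]
  by (rule holomorphic_infsum(1)[OF open_ball log_factor_holomorphic log_factor_bound summable_log_bound])

lemma log_sum_has_sum:
  assumes "z \<in> ball 0 R"
  shows "((\<lambda>w. (deriv ^^ m) (log_factor w) z) has_sum (deriv ^^ m) (log_sum R) z) (far R)"
  unfolding log_sum_def[abs_def]
  by (rule holomorphic_infsum(2)[OF open_ball log_factor_holomorphic log_factor_bound summable_log_bound assms])

text \<open>Once a finite set contains \<open>near R\<close>, its product is the fixed product over
  \<open>near R\<close> times the exponential of a partial sum of \<open>log_sum\<close>, so the
  unordered limit passes through \<open>exp\<close>. Holomorphy and zeros of \<sigma> can be read
  off the resulting form.\<close>

lemma weierstrass_sigma_local:
  assumes z: "z \<in> ball 0 R"
  shows "weierstrass_sigma \<Lambda> z = z * (\<Prod>w\<in>near R. weierstrass_factor 2 (z / w)) * exp (log_sum R z)"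
proof -
  let ?E = "\<lambda>w. weierstrass_factor 2 (z / w)"
  \<comment> \<open>Extension by 0 across \<open>near R\<close> turns the sum over
    \<open>far R\<close> into a limit along finite subsets of all of \<Lambda> - {0}, the filter
    used in the definition of \<sigma>.\<close>
  define g where "g w = (if w \<in> far R then log_factor w z else 0)" for w
  have "(g has_sum log_sum R z) (\<Lambda> - {0})"
    using log_sum_has_sum[OF z, of 0]
    by (subst has_sum_cong_neutral[where T = "far R" and g = "\<lambda>w. log_factor w z"])
      (auto simp: g_def far_def)
  then have "(sum g \<longlongrightarrow> log_sum R z) (finite_subsets_at_top (\<Lambda> - {0}))"
    by (simp add: has_sum_def)
  then have "((\<lambda>S. (\<Prod>w\<in>near R. ?E w) * exp (sum g S)) \<longlongrightarrow> (\<Prod>w\<in>near R. ?E w) * exp (log_sum R z))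
      (finite_subsets_at_top (\<Lambda> - {0}))"
    by (intro tendsto_intros)
  moreover have "eventually (\<lambda>S. (\<Prod>w\<in>near R. ?E w) * exp (sum g S) = (\<Prod>w\<in>S. ?E w))
      (finite_subsets_at_top (\<Lambda> - {0}))"
    unfolding eventually_finite_subsets_at_top
  proof (intro exI[of _ "near R"] conjI allI impI)
    show "near R \<subseteq> \<Lambda> - {0}" by (auto simp: near_def)
    fix S assume S: "finite S \<and> near R \<subseteq> S \<and> S \<subseteq> \<Lambda> - {0}"
    then have sub: "S - near R \<subseteq> far R" using near_Un_far by blast
    have "sum g S = sum g (S - near R) + sum g (near R)"
      using S by (intro sum.subset_diff) auto
    also have "sum g (near R) = 0" using near_Int_far by (intro sum.neutral) (auto simp: g_def)
    finally have "exp (sum g S) = (\<Prod>w\<in>S - near R. exp (g w))" using S by (simp add: exp_sum)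
    also have "\<dots> = (\<Prod>w\<in>S - near R. ?E w)"
      using sub z by (intro prod.cong) (auto simp: g_def exp_log_factor)
    finally show "(\<Prod>w\<in>near R. ?E w) * exp (sum g S) = (\<Prod>w\<in>S. ?E w)"
      using S prod.subset_diff[of "near R" S ?E] by (simp add: mult_ac)
  qed simp
  ultimately have "((\<lambda>S. \<Prod>w\<in>S. ?E w) \<longlongrightarrow> (\<Prod>w\<in>near R. ?E w) * exp (log_sum R z))
      (finite_subsets_at_top (\<Lambda> - {0}))"
    by (rule Lim_transform_eventually)
  then have "Lim (finite_subsets_at_top (\<Lambda> - {0})) (\<lambda>S. \<Prod>w\<in>S. ?E w)
      = (\<Prod>w\<in>near R. ?E w) * exp (log_sum R z)"
    by (rule tendsto_Lim[rotated]) simp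
  then show ?thesis by (simp add: weierstrass_sigma_def mult_ac)
qed

abbreviation \<sigma> where "\<sigma> \<equiv> weierstrass_sigma \<Lambda>"

abbreviation wp ("\<wp>") where "wp \<equiv> weierstrass_wp \<Lambda>"

abbreviation \<zeta> where "\<zeta> \<equiv> weierstrass_zeta \<Lambda>"

lemma in_ball_norm_plus_1: "z \<in> ball 0 (norm z + 1)" for z :: complex
  by simp

lemma sigma_holomorphic: "\<sigma> holomorphic_on A"
proof -
  have "\<sigma> holomorphic_on ball 0 R" for R
  proof -
    have "(\<lambda>z. z * (\<Prod>w\<in>near R. weierstrass_factor 2 (z / w)) * exp (log_sum R z)) holomorphic_on ball 0 R"
      by (intro holomorphic_intros log_sum_holomorphic) (auto simp: near_def)
    then show ?thesis by (rule holomorphic_transform) (simp add: weierstrass_sigma_local)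
  qed
  then have "\<exists>f'. (\<sigma> has_field_derivative f') (at z)" for z
    by (meson holomorphic_derivI in_ball_norm_plus_1 open_ball)
  then have "\<sigma> holomorphic_on UNIV" by (subst holomorphic_on_open) auto
  then show ?thesis by (rule holomorphic_on_subset) simp
qed

lemma sigma_eq_0_iff: "\<sigma> z = 0 \<longleftrightarrow> z \<in> \<Lambda>"
proof -
  define R where "R = norm z + 1"
  have z: "z \<in> ball 0 R" by (simp add: R_def)
  have "\<sigma> z = 0 \<longleftrightarrow> z = 0 \<or> z \<in> near R"
    by (auto simp: weierstrass_sigma_local[OF z])
  also have "\<dots> \<longleftrightarrow> z \<in> \<Lambda>" by (auto simp: near_def R_def)
  finally show ?thesis .
qed

end

lemma locally_finite_not_islimpt:
  fixes A :: "complex set"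
  assumes "\<And>R. finite (A \<inter> cball 0 R)"
  shows "\<not> z islimpt A"
proof -
  have "\<not> z islimpt A \<inter> cball 0 (norm z + 1)" using assms islimpt_finite by blast
  then have "eventually (\<lambda>y. y \<notin> A \<inter> cball 0 (norm z + 1)) (at z)"
    by (simp add: islimpt_iff_eventually)
  moreover have "eventually (\<lambda>y. y \<in> ball 0 (norm z + 1)) (at z)"
    by (rule eventually_at_in_open') auto
  ultimately have "eventually (\<lambda>y. y \<notin> A) (at z)" by eventually_elim auto
  then show ?thesis by (simp add: islimpt_iff_eventually)
qed

context complex_lattice
begin

lemma deriv_on_open:
  assumes "open S" "z \<in> S" "\<And>u. u \<in> S \<Longrightarrow> deriv f u = g u" "(g has_field_derivative d) (at z)"
  shows "(deriv f has_field_derivative d) (at z)"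
  using has_field_derivative_transform_within_open[OF assms(4,1,2)] assms(3) by auto

lemma inverse_square_deriv:
  fixes w z :: complex
  assumes "z \<noteq> w"
  shows "((\<lambda>z. 1 / (z - w) ^ 2) has_field_derivative - 2 / (z - w) ^ 3) (at z)"
  using assms
  by (auto intro!: derivative_eq_intros simp: divide_simps) (simp add: algebra_simps eval_nat_numeral)

lemma inverse_cube_deriv:
  fixes w z :: complex
  assumes "z \<noteq> w"
  shows "((\<lambda>z. - 2 / (z - w) ^ 3) has_field_derivative 6 / (z - w) ^ 4) (at z)"
  using assms
  by (auto intro!: derivative_eq_intros simp: divide_simps eval_nat_numeral)

text \<open>From order two on these are, up to sign, the terms of the series for \<wp> and its
  derivatives, so convergence and differentiability of those series come from \<open>log_sum\<close>
  without a new estimate.\<close>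

lemma log_factor_higher_derivs:
  assumes w: "w \<in> far R" and z: "z \<in> ball 0 R"
  shows "(deriv ^^ 1) (log_factor w) z = z ^ 2 / (w ^ 2 * (z - w))"
    and "(deriv ^^ 2) (log_factor w) z = 1 / w ^ 2 - 1 / (z - w) ^ 2"
    and "(deriv ^^ 3) (log_factor w) z = 2 / (z - w) ^ 3"
    and "(deriv ^^ 4) (log_factor w) z = - 6 / (z - w) ^ 4"
proof -
  have d1: "deriv (log_factor w) u = u ^ 2 / (w ^ 2 * (u - w))" if "u \<in> ball 0 R" for u
    using log_factor_deriv[OF w that] by (rule DERIV_imp_deriv)
  have d2: "deriv (deriv (log_factor w)) u = 1 / w ^ 2 - 1 / (u - w) ^ 2" if u: "u \<in> ball 0 R" for u
  proof (rule DERIV_imp_deriv, rule deriv_on_open[OF open_ball u d1])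
    have "w \<noteq> 0" "u - w \<noteq> 0" using far_facts[OF w u] by auto
    then show "((\<lambda>u. u ^ 2 / (w ^ 2 * (u - w))) has_field_derivative 1 / w ^ 2 - 1 / (u - w) ^ 2) (at u)"
      by (auto intro!: derivative_eq_intros simp: divide_simps) (simp add: algebra_simps power2_eq_square)
  qed
  have d3: "deriv (deriv (deriv (log_factor w))) u = 2 / (u - w) ^ 3" if u: "u \<in> ball 0 R" for u
  proof (rule DERIV_imp_deriv, rule deriv_on_open[OF open_ball u d2])
    have "((\<lambda>u. 1 / w ^ 2 - 1 / (u - w) ^ 2) has_field_derivative 0 - - 2 / (u - w) ^ 3) (at u)"
      using far_facts[OF w u] by (intro DERIV_diff DERIV_const inverse_square_deriv)
    then show "((\<lambda>u. 1 / w ^ 2 - 1 / (u - w) ^ 2) has_field_derivative 2 / (u - w) ^ 3) (at u)"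
      by simp
  qed
  have d4: "deriv (deriv (deriv (deriv (log_factor w)))) u = - 6 / (u - w) ^ 4" if u: "u \<in> ball 0 R" for u
  proof (rule DERIV_imp_deriv, rule deriv_on_open[OF open_ball u d3])
    have "((\<lambda>u. - (- 2 / (u - w) ^ 3)) has_field_derivative - (6 / (u - w) ^ 4)) (at u)"
      using far_facts[OF w u] by (intro DERIV_minus inverse_cube_deriv)
    then show "((\<lambda>u. 2 / (u - w) ^ 3) has_field_derivative - 6 / (u - w) ^ 4) (at u)" by simp
  qed
  show "(deriv ^^ 1) (log_factor w) z = z ^ 2 / (w ^ 2 * (z - w))"
    "(deriv ^^ 2) (log_factor w) z = 1 / w ^ 2 - 1 / (z - w) ^ 2"
    "(deriv ^^ 3) (log_factor w) z = 2 / (z - w) ^ 3"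
    "(deriv ^^ 4) (log_factor w) z = - 6 / (z - w) ^ 4"
    using d1[OF z] d2[OF z] d3[OF z] d4[OF z] by (simp_all add: eval_nat_numeral)
qed

lemma log_sum_deriv:
  "z \<in> ball 0 R \<Longrightarrow> ((deriv ^^ m) (log_sum R) has_field_derivative (deriv ^^ Suc m) (log_sum R) z) (at z)"
  by (rule has_field_derivative_higher_deriv[OF log_sum_holomorphic open_ball])

section \<open>\<wp> with its pole at the origin split off\<close>

definition wp_regular :: "complex \<Rightarrow> complex" where
  "wp_regular z = (\<Sum>\<^sub>\<infinity>w\<in>\<Lambda> - {0}. 1 / (z - w) ^ 2 - 1 / w ^ 2)"

lemma wp_eq: "\<wp> z = 1 / z ^ 2 + wp_regular z"
  by (simp add: weierstrass_wp_def wp_regular_def)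

lemma has_sum_near_far:
  fixes f :: "complex \<Rightarrow> complex"
  assumes "(f has_sum s) (far R)"
  shows "(f has_sum (\<Sum>w\<in>near R. f w) + s) (\<Lambda> - {0})"
  unfolding near_Un_far[of R, symmetric]
  by (intro has_sum_Un_disjoint has_sum_finite assms finite_near near_Int_far)

lemma wp_regular_local:
  assumes "z \<in> ball 0 R"
  shows "wp_regular z = (\<Sum>w\<in>near R. 1 / (z - w) ^ 2 - 1 / w ^ 2) - (deriv ^^ 2) (log_sum R) z"
proof -
  have "((\<lambda>w. (deriv ^^ 2) (log_factor w) z) has_sum (deriv ^^ 2) (log_sum R) z) (far R)"
    by (rule log_sum_has_sum[OF assms])
  also have "?this \<longleftrightarrow> ((\<lambda>w. 1 / w ^ 2 - 1 / (z - w) ^ 2) has_sum (deriv ^^ 2) (log_sum R) z) (far R)"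
    by (rule has_sum_cong) (simp add: log_factor_higher_derivs[OF _ assms])
  finally have "((\<lambda>w. 1 / (z - w) ^ 2 - 1 / w ^ 2) has_sum - (deriv ^^ 2) (log_sum R) z) (far R)"
    using has_sum_cmult_right[of _ _ _ "-1"] by fastforce
  from has_sum_near_far[OF this] show ?thesis
    unfolding wp_regular_def by (simp add: infsumI)
qed

lemma open_ball_minus_near: "open (ball 0 R - near R)"
  by (intro open_Diff open_ball finite_imp_closed finite_near)

lemma in_ball_minus_near:
  assumes "z \<notin> \<Lambda> - {0}" "norm z < R"
  shows "z \<in> ball 0 R - near R"
  using assms by (auto simp: near_def)

lemma wp_regular_deriv_local:
  assumes "z \<in> ball 0 R - near R"
  shows "(wp_regular has_field_derivative
           (\<Sum>w\<in>near R. - 2 / (z - w) ^ 3) - (deriv ^^ 3) (log_sum R) z) (at z)"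
proof (rule has_field_derivative_transform_within_open[OF _ open_ball_minus_near assms])
  have nz: "z - w \<noteq> 0" if "w \<in> near R" for w using that assms by auto
  show "((\<lambda>z. (\<Sum>w\<in>near R. 1 / (z - w) ^ 2 - 1 / w ^ 2) - (deriv ^^ 2) (log_sum R) z)
      has_field_derivative (\<Sum>w\<in>near R. - 2 / (z - w) ^ 3) - (deriv ^^ 3) (log_sum R) z) (at z)"
  proof (intro DERIV_diff DERIV_sum)
    show "((\<lambda>z. 1 / (z - w) ^ 2 - 1 / w ^ 2) has_field_derivative - 2 / (z - w) ^ 3) (at z)"
      if "w \<in> near R" for w
      using DERIV_diff[OF inverse_square_deriv[of z w] DERIV_const[of "1 / w ^ 2"]] nz[OF that] by simp
    show "((deriv ^^ 2) (log_sum R) has_field_derivative (deriv ^^ 3) (log_sum R) z) (at z)"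
      using log_sum_deriv[of z R 2] assms by (simp add: numeral_3_eq_3 numeral_2_eq_2)
  qed
qed (simp add: wp_regular_local[where R = R])

lemma wp_regular_deriv2_local:
  assumes z: "z \<in> ball 0 R - near R"
  shows "(deriv wp_regular has_field_derivative
           (\<Sum>w\<in>near R. 6 / (z - w) ^ 4) - (deriv ^^ 4) (log_sum R) z) (at z)"
proof (rule deriv_on_open[OF open_ball_minus_near z])
  show "deriv wp_regular u = (\<Sum>w\<in>near R. - 2 / (u - w) ^ 3) - (deriv ^^ 3) (log_sum R) u"
    if "u \<in> ball 0 R - near R" for u
    using wp_regular_deriv_local[OF that] by (rule DERIV_imp_deriv)
  have nz: "z - w \<noteq> 0" if "w \<in> near R" for w using that assms by auto
  show "((\<lambda>z. (\<Sum>w\<in>near R. - 2 / (z - w) ^ 3) - (deriv ^^ 3) (log_sum R) z)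
      has_field_derivative (\<Sum>w\<in>near R. 6 / (z - w) ^ 4) - (deriv ^^ 4) (log_sum R) z) (at z)"
  proof (intro DERIV_diff DERIV_sum)
    show "((\<lambda>z. - 2 / (z - w) ^ 3) has_field_derivative 6 / (z - w) ^ 4) (at z)"
      if "w \<in> near R" for w
      using nz[OF that] by (intro inverse_cube_deriv) auto
    show "((deriv ^^ 3) (log_sum R) has_field_derivative (deriv ^^ 4) (log_sum R) z) (at z)"
      using log_sum_deriv[of z R 3] assms by (simp add: eval_nat_numeral)
  qed
qed

lemma wp_regular_deriv_has_sum:
  assumes z: "z \<notin> \<Lambda> - {0}"
  shows "((\<lambda>w. - 2 / (z - w) ^ 3) has_sum deriv wp_regular z) (\<Lambda> - {0})"
proof -
  define R where "R = norm z + 1"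
  have R: "z \<in> ball 0 R - near R" using z by (intro in_ball_minus_near) (auto simp: R_def)
  then have zR: "z \<in> ball 0 R" by simp
  have "((\<lambda>w. (deriv ^^ 3) (log_factor w) z) has_sum (deriv ^^ 3) (log_sum R) z) (far R)"
    by (rule log_sum_has_sum[OF zR])
  also have "?this \<longleftrightarrow> ((\<lambda>w. 2 / (z - w) ^ 3) has_sum (deriv ^^ 3) (log_sum R) z) (far R)"
    by (rule has_sum_cong) (simp add: log_factor_higher_derivs[OF _ zR])
  finally have "((\<lambda>w. - 2 / (z - w) ^ 3) has_sum - (deriv ^^ 3) (log_sum R) z) (far R)"
    using has_sum_cmult_right[of _ _ _ "-1"] by fastforce
  from has_sum_near_far[OF this] show ?thesis
    using wp_regular_deriv_local[OF R] by (simp add: DERIV_imp_deriv)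
qed

lemma wp_regular_deriv2_has_sum:
  assumes z: "z \<notin> \<Lambda> - {0}"
  shows "((\<lambda>w. 6 / (z - w) ^ 4) has_sum deriv (deriv wp_regular) z) (\<Lambda> - {0})"
proof -
  define R where "R = norm z + 1"
  have R: "z \<in> ball 0 R - near R" using z by (intro in_ball_minus_near) (auto simp: R_def)
  then have zR: "z \<in> ball 0 R" by simp
  have "((\<lambda>w. (deriv ^^ 4) (log_factor w) z) has_sum (deriv ^^ 4) (log_sum R) z) (far R)"
    by (rule log_sum_has_sum[OF zR])
  also have "?this \<longleftrightarrow> ((\<lambda>w. - 6 / (z - w) ^ 4) has_sum (deriv ^^ 4) (log_sum R) z) (far R)"
    by (rule has_sum_cong) (simp add: log_factor_higher_derivs[OF _ zR])
  finally have "((\<lambda>w. 6 / (z - w) ^ 4) has_sum - (deriv ^^ 4) (log_sum R) z) (far R)"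
    using has_sum_cmult_right[of _ _ _ "-1"] by fastforce
  from has_sum_near_far[OF this] show ?thesis
    using wp_regular_deriv2_local[OF R] by (simp add: DERIV_imp_deriv)
qed

text \<open>The termwise second derivative carries the factor 6, against the factor 60 in
  \<open>invariant_g2\<close>; hence 1/10.\<close>

lemma wp_regular_deriv2_0: "deriv (deriv wp_regular) 0 = invariant_g2 \<Lambda> / 10"
proof -
  have "((\<lambda>w. 6 * (1 / w ^ 4)) has_sum deriv (deriv wp_regular) 0) (\<Lambda> - {0})"
    using wp_regular_deriv2_has_sum[of 0] by simp
  then have "deriv (deriv wp_regular) 0 = (\<Sum>\<^sub>\<infinity>w\<in>\<Lambda> - {0}. 6 * (1 / w ^ 4))"
    by (simp add: infsumI)
  also have "\<dots> = 6 * (\<Sum>\<^sub>\<infinity>w\<in>\<Lambda> - {0}. 1 / w ^ 4)"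
    by (rule infsum_cmult_right') 
  finally show ?thesis by (simp add: invariant_g2_def)
qed

lemma islimpt_lattice: "\<not> z islimpt \<Lambda>"
  by (rule locally_finite_not_islimpt[OF finite_lattice_cball])

lemma closed_lattice: "A \<subseteq> \<Lambda> \<Longrightarrow> closed A"
  by (metis closed_limpt islimpt_lattice islimpt_subset)

lemma open_compl_lattice_minus_0: "open (- (\<Lambda> - {0}))"
  by (intro open_Compl closed_lattice) auto

lemma wp_regular_holomorphic: "wp_regular holomorphic_on - (\<Lambda> - {0})"
proof (subst holomorphic_on_open)
  show "open (- (\<Lambda> - {0}))" by (rule open_compl_lattice_minus_0)
  show "\<forall>z\<in>- (\<Lambda> - {0}). \<exists>f'. (wp_regular has_field_derivative f') (at z)"
    using wp_regular_deriv_local[OF in_ball_minus_near] by (metis ComplD less_add_one)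
qed

lemma open_compl_lattice: "open (- \<Lambda>)"
  by (intro open_Compl closed_lattice) auto

lemma wp_holomorphic: "\<wp> holomorphic_on - \<Lambda>"
  unfolding wp_eq[abs_def]
  by (intro holomorphic_intros holomorphic_on_subset[OF wp_regular_holomorphic]) auto

lemma wp_deriv: "z \<notin> \<Lambda> \<Longrightarrow> (\<wp> has_field_derivative deriv \<wp> z) (at z)"
  by (rule holomorphic_derivI[OF wp_holomorphic open_compl_lattice]) auto

lemma deriv_wp_deriv: "z \<notin> \<Lambda> \<Longrightarrow> (deriv \<wp> has_field_derivative deriv (deriv \<wp>) z) (at z)"
  by (rule holomorphic_derivI[OF holomorphic_deriv[OF wp_holomorphic open_compl_lattice] open_compl_lattice]) auto

lemma deriv_wp_eq:
  assumes z: "z \<notin> \<Lambda>"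
  shows "deriv \<wp> z = - 2 / z ^ 3 + deriv wp_regular z"
proof (rule DERIV_imp_deriv)
  have nz: "z \<noteq> 0" using z by auto
  have "(wp_regular has_field_derivative deriv wp_regular z) (at z)"
    by (rule holomorphic_derivI[OF wp_regular_holomorphic open_compl_lattice_minus_0]) (use z in auto)
  then show "(\<wp> has_field_derivative - 2 / z ^ 3 + deriv wp_regular z) (at z)"
    unfolding wp_eq[abs_def] using DERIV_add[OF inverse_square_deriv[of z 0]] nz by simp
qed

lemma deriv2_wp_eq:
  assumes z: "z \<notin> \<Lambda>"
  shows "deriv (deriv \<wp>) z = 6 / z ^ 4 + deriv (deriv wp_regular) z"
proof (rule DERIV_imp_deriv, rule deriv_on_open[OF open_compl_lattice])
  have nz: "z \<noteq> 0" using z by auto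
  have "(deriv wp_regular has_field_derivative deriv (deriv wp_regular) z) (at z)"
    by (rule holomorphic_derivI[OF holomorphic_deriv[OF wp_regular_holomorphic]])
      (use z open_compl_lattice_minus_0 in auto)
  then show "((\<lambda>z. - 2 / z ^ 3 + deriv wp_regular z) has_field_derivative
      6 / z ^ 4 + deriv (deriv wp_regular) z) (at z)"
    using DERIV_add[OF inverse_cube_deriv[of z 0]] nz by simp
qed (use z deriv_wp_eq in auto)

text \<open>The logarithmic derivative of \<open>weierstrass_sigma_local\<close>: each near factor
  contributes 1 / (z - w) + 1 / w + z / w^2 = z^2 / (w^2 (z - w)). Differentiating once more
  reproduces \<open>wp_regular_local\<close> with the sign reversed, which is
  \<open>zeta_deriv\<close>.\<close>

lemma sigma_zeta_local:
  assumes z: "z \<in> ball 0 R" "z \<notin> \<Lambda>"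
  shows "\<zeta> z = 1 / z + (\<Sum>w\<in>near R. z ^ 2 / (w ^ 2 * (z - w))) + deriv (log_sum R) z"
proof -
  let ?S = "\<Sum>w\<in>near R. z ^ 2 / (w ^ 2 * (z - w))"
  let ?P = "\<lambda>z. \<Prod>w\<in>near R. weierstrass_factor 2 (z / w)"
  have nz: "z \<noteq> 0" "\<And>w. w \<in> near R \<Longrightarrow> w \<noteq> 0 \<and> z \<noteq> w" using z by (auto simp: near_def)
  have P: "(?P has_field_derivative ?P z * ?S) (at z)"
  proof -
    have E: "((\<lambda>z. weierstrass_factor 2 (z / w)) has_field_derivative
        weierstrass_factor 2 (z / w) * (z ^ 2 / (w ^ 2 * (z - w)))) (at z)" if "w \<in> near R" for w
      using nz(2)[OF that]
      by (auto intro!: derivative_eq_intros simp: weierstrass_factor_def numeral_2_eq_2 divide_simps)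
        (simp add: algebra_simps power2_eq_square)
    have "(?P has_field_derivative (?P z * (\<Sum>w\<in>near R.
        (weierstrass_factor 2 (z / w) * (z ^ 2 / (w ^ 2 * (z - w)))) / weierstrass_factor 2 (z / w)))) (at z)"
      by (rule has_field_derivative_prod'[OF _ E]) (use nz in auto)
    also have "(\<Sum>w\<in>near R. (weierstrass_factor 2 (z / w) * (z ^ 2 / (w ^ 2 * (z - w)))) / weierstrass_factor 2 (z / w)) = ?S"
      using nz by (intro sum.cong) auto
    finally show ?thesis .
  qed
  have L: "(log_sum R has_field_derivative deriv (log_sum R) z) (at z)"
    using log_sum_deriv[of z R 0] z by simp
  have "(\<sigma> has_field_derivative \<sigma> z * (1 / z + ?S + deriv (log_sum R) z)) (at z)"
  proof (rule has_field_derivative_transform_within_open[OF _ open_ball z(1)])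
    show "((\<lambda>z. z * ?P z * exp (log_sum R z)) has_field_derivative
        \<sigma> z * (1 / z + ?S + deriv (log_sum R) z)) (at z)"
      using nz(1) z by (auto intro!: derivative_eq_intros P L simp: weierstrass_sigma_local field_simps)
  qed (simp add: weierstrass_sigma_local)
  then show ?thesis using z sigma_eq_0_iff by (simp add: weierstrass_zeta_def DERIV_imp_deriv)
qed

lemma zeta_deriv:
  assumes z: "z \<notin> \<Lambda>"
  shows "(\<zeta> has_field_derivative - \<wp> z) (at z)"
proof -
  define R where "R = norm z + 1"
  have zR: "z \<in> ball 0 R - \<Lambda>" using z by (simp add: R_def)
  have nz: "z \<noteq> 0" "\<And>w. w \<in> near R \<Longrightarrow> w \<noteq> 0 \<and> z \<noteq> w" using z by (auto simp: near_def)
  show ?thesis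
  proof (rule has_field_derivative_transform_within_open[OF _ _ zR])
    show "open (ball 0 R - \<Lambda>)" by (intro open_Diff open_ball closed_lattice) auto
    have "((\<lambda>z. 1 / z + (\<Sum>w\<in>near R. z ^ 2 / (w ^ 2 * (z - w))) + deriv (log_sum R) z)
        has_field_derivative - 1 / z ^ 2 + (\<Sum>w\<in>near R. - (1 / (z - w) ^ 2 - 1 / w ^ 2))
          + (deriv ^^ 2) (log_sum R) z) (at z)"
    proof (intro DERIV_add DERIV_sum)
      show "((\<lambda>z. 1 / z) has_field_derivative - 1 / z ^ 2) (at z)"
        using nz by (auto intro!: derivative_eq_intros simp: power2_eq_square)
      show "((\<lambda>z. z ^ 2 / (w ^ 2 * (z - w))) has_field_derivative - (1 / (z - w) ^ 2 - 1 / w ^ 2)) (at z)"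
        if "w \<in> near R" for w
        using nz(2)[OF that]
        by (auto intro!: derivative_eq_intros simp: divide_simps) (simp add: algebra_simps power2_eq_square)
      show "(deriv (log_sum R) has_field_derivative (deriv ^^ 2) (log_sum R) z) (at z)"
        using log_sum_deriv[of z R 1] zR by (simp add: numeral_2_eq_2)
    qed
    also have "- 1 / z ^ 2 + (\<Sum>w\<in>near R. - (1 / (z - w) ^ 2 - 1 / w ^ 2))
          + (deriv ^^ 2) (log_sum R) z = - \<wp> z"
      using zR by (simp add: wp_eq wp_regular_local[of z R] flip: sum_negf)
    finally show "((\<lambda>z. 1 / z + (\<Sum>w\<in>near R. z ^ 2 / (w ^ 2 * (z - w))) + deriv (log_sum R) z)
        has_field_derivative - \<wp> z) (at z)" .
  qed (simp add: sigma_zeta_local[where R = R])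
qed

end

section \<open>Parity and periodicity\<close>

lemma holomorphic_on_isCont:
  assumes "f holomorphic_on S" "open S" "z \<in> S"
  shows "isCont f z"
  using DERIV_isCont[OF holomorphic_derivI[OF assms]] .

text \<open>Dividing out one factor z leaves a holomorphic q with q(0) = 0; differentiating
  \<open>deriv \<phi> z = q z + z * deriv q z\<close> at 0 gives q'(0) = \<phi>''(0) / 2.\<close>

lemma tendsto_quotient_square:
  fixes \<phi> :: "complex \<Rightarrow> complex"
  assumes holo: "\<phi> holomorphic_on S" and S: "open S" "0 \<in> S" and 0: "\<phi> 0 = 0" "deriv \<phi> 0 = 0"
  shows "((\<lambda>z. \<phi> z / z ^ 2) \<longlongrightarrow> deriv (deriv \<phi>) 0 / 2) (at 0)"
proof -
  define q where "q z = (if z = 0 then deriv \<phi> 0 else (\<phi> z - \<phi> 0) / (z - 0))" for z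
  have q: "q holomorphic_on S"
    unfolding q_def[abs_def] by (rule pole_lemma_open[OF holo S(1)])
  have q0: "q 0 = 0" and \<phi>: "\<phi> z = z * q z" for z using 0 by (auto simp: q_def)
  have dq: "(q has_field_derivative deriv q z) (at z)" if "z \<in> S" for z
    using holomorphic_derivI[OF q S(1) that] .
  have d\<phi>: "deriv \<phi> z = q z + z * deriv q z" if "z \<in> S" for z
    unfolding \<phi>[abs_def] by (rule DERIV_imp_deriv) (auto intro!: derivative_eq_intros dq that)
  have "(deriv q has_field_derivative deriv (deriv q) 0) (at 0)"
    using holomorphic_derivI[OF holomorphic_deriv[OF q S(1)] S] .
  then have "((\<lambda>z. q z + z * deriv q z) has_field_derivative 2 * deriv q 0) (at 0)"
    by (auto intro!: derivative_eq_intros dq S)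
  then have "(deriv \<phi> has_field_derivative 2 * deriv q 0) (at 0)"
    by (rule has_field_derivative_transform_within_open[OF _ S]) (simp add: d\<phi>)
  then have "deriv q 0 = deriv (deriv \<phi>) 0 / 2" using DERIV_imp_deriv by fastforce
  moreover have "((\<lambda>z. q z / z) \<longlongrightarrow> deriv q 0) (at 0)"
    using dq[OF S(2)] by (simp add: has_field_derivative_iff q0)
  moreover have "(\<lambda>z. q z / z) = (\<lambda>z. \<phi> z / z ^ 2)" by (auto simp: \<phi> power2_eq_square)
  ultimately show ?thesis by metis
qed

text \<open>The limit condition makes z g(z) extend holomorphically to 0, and being odd this
  extension vanishes there. For an even function with at most a double pole it is therefore enough
  to check the leading coefficient.\<close>

lemma even_no_simple_pole:
  fixes g :: "complex \<Rightarrow> complex"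
  assumes holo: "g holomorphic_on S - {0}" and S: "open S" "0 \<in> S"
    and even: "\<And>z. g (- z) = g z"
    and lim: "((\<lambda>z. z ^ 2 * g z) \<longlongrightarrow> 0) (at 0)"
  shows "((\<lambda>z. z * g z) \<longlongrightarrow> 0) (at 0)"
proof -
  have "\<exists>h. h holomorphic_on S \<and> (\<forall>z\<in>S - {0}. h z = z * g z)"
  proof (subst holomorphic_on_extend_lim)
    show "((\<lambda>z. (z - 0) * (z * g z)) \<longlongrightarrow> 0) (at 0)"
      using lim by (simp add: power2_eq_square mult_ac)
  qed (use holo S in \<open>auto intro!: holomorphic_intros simp: interior_open\<close>)
  then obtain h where h: "h holomorphic_on S" "\<And>z. z \<in> S - {0} \<Longrightarrow> h z = z * g z" by blast
  have "isCont h 0"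
    using h(1) S by (rule holomorphic_on_isCont)
  then have "(h \<longlongrightarrow> h 0) (at 0)" by (simp add: isCont_def)
  then have 1: "((\<lambda>z. z * g z) \<longlongrightarrow> h 0) (at 0)"
    by (rule Lim_transform_within_open[OF _ S]) (use h in auto)
  have "filterlim uminus (at (0::complex)) (at 0)"
    using tendsto_minus[OF tendsto_ident_at[of 0 UNIV]] by (simp add: filterlim_at eventually_at_filter)
  from filterlim_compose[OF 1 this] have "((\<lambda>z. - (z * g z)) \<longlongrightarrow> h 0) (at 0)" by (simp add: even)
  with tendsto_minus[OF 1] have "h 0 = - h 0"
    using LIM_unique by blast
  with 1 show ?thesis by simp
qed

context complex_lattice
begin

lemma infsum_lattice_uminus:
  fixes f :: "complex \<Rightarrow> complex"
  assumes "\<And>w. w \<in> A \<Longrightarrow> - w \<in> A"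
  shows "(\<Sum>\<^sub>\<infinity>w\<in>A. f (- w)) = (\<Sum>\<^sub>\<infinity>w\<in>A. f w)"
proof -
  have "uminus ` A = A" using assms by force
  moreover have "(\<Sum>\<^sub>\<infinity>w\<in>uminus ` A. f w) = (\<Sum>\<^sub>\<infinity>w\<in>A. f (- w))"
    by (subst infsum_reindex) (simp_all add: o_def)
  ultimately show ?thesis by simp
qed

lemma wp_regular_minus: "wp_regular (- z) = wp_regular z"
proof -
  have "(- z - w) ^ 2 = (z - - w) ^ 2" for w
    by (simp add: power2_eq_square algebra_simps)
  then have "wp_regular (- z) = (\<Sum>\<^sub>\<infinity>w\<in>\<Lambda> - {0}. 1 / (z - - w) ^ 2 - 1 / (- w) ^ 2)"
    unfolding wp_regular_def by (simp only: power2_minus)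
  also have "\<dots> = wp_regular z"
    unfolding wp_regular_def by (rule infsum_lattice_uminus) auto
  finally show ?thesis .
qed

lemma wp_minus: "\<wp> (- z) = \<wp> z"
  by (simp add: wp_eq wp_regular_minus)

lemma log_sum_minus: "log_sum R (- z) = log_sum R z"
proof -
  have "log_sum R (- z) = (\<Sum>\<^sub>\<infinity>w\<in>far R. log_factor (- w) z)"
    unfolding log_sum_def by (intro infsum_cong) (simp add: log_factor_def)
  also have "\<dots> = log_sum R z"
    unfolding log_sum_def by (rule infsum_lattice_uminus) (auto simp: far_def)
  finally show ?thesis .
qed

lemma sigma_minus: "\<sigma> (- z) = - \<sigma> z"
proof -
  define R where "R = norm z + 1"
  have z: "z \<in> ball 0 R" "- z \<in> ball 0 R" by (auto simp: R_def)
  have "(\<Prod>w\<in>near R. weierstrass_factor 2 (- z / w)) = (\<Prod>w\<in>near R. weierstrass_factor 2 (z / w))"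
    by (rule prod.reindex_bij_witness[of _ uminus uminus]) (auto simp: near_def)
  then show ?thesis by (simp add: weierstrass_sigma_local[OF z(1)] weierstrass_sigma_local[OF z(2)] log_sum_minus)
qed

lemma sigma_quotient_tendsto: "((\<lambda>z. \<sigma> z / z) \<longlongrightarrow> 1) (at 0)"
proof -
  let ?h = "\<lambda>z. (\<Prod>w\<in>near 1. weierstrass_factor 2 (z / w)) * exp (log_sum 1 z)"
  have "?h holomorphic_on ball 0 1"
    by (intro holomorphic_intros log_sum_holomorphic) (auto simp: near_def)
  then have "isCont ?h 0"
    by (rule holomorphic_on_isCont) auto
  moreover have "?h 0 = 1"
    by (simp add: log_sum_def log_factor_def)
  ultimately have "(?h \<longlongrightarrow> 1) (at 0)" by (simp add: isCont_def)
  then show ?thesis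
    by (rule Lim_transform_within_open[OF _ open_ball[of 0 1]]) (auto simp: weierstrass_sigma_local[of _ 1])
qed

lemma wp_regular_0 [simp]: "wp_regular 0 = 0"
  by (simp add: wp_regular_def)

lemma wp_regular_deriv: "z \<notin> \<Lambda> - {0} \<Longrightarrow> (wp_regular has_field_derivative deriv wp_regular z) (at z)"
  by (rule holomorphic_derivI[OF wp_regular_holomorphic open_compl_lattice_minus_0]) auto

lemma deriv_wp_regular_0: "deriv wp_regular 0 = 0"
proof -
  have d: "(wp_regular has_field_derivative deriv wp_regular 0) (at 0)" by (rule wp_regular_deriv) auto
  then have "(wp_regular has_field_derivative deriv wp_regular 0) (at (- 0))" by simp
  moreover have "(uminus has_field_derivative - 1) (at (0::complex))"
    by (auto intro!: derivative_eq_intros)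
  ultimately have "((\<lambda>z. wp_regular (- z)) has_field_derivative deriv wp_regular 0 * - 1) (at 0)"
    by (rule DERIV_chain2)
  then have "(wp_regular has_field_derivative - deriv wp_regular 0) (at 0)"
    by (simp add: wp_regular_minus)
  then have "deriv wp_regular 0 = - deriv wp_regular 0" by (rule DERIV_imp_deriv)
  then show ?thesis by simp
qed

lemma wp_regular_tendsto: "(wp_regular \<longlongrightarrow> 0) (at 0)"
  using DERIV_isCont[OF wp_regular_deriv[of 0]] by (simp add: isCont_def)

lemma wp_tendsto: "((\<lambda>z. z ^ 2 * \<wp> z) \<longlongrightarrow> 1) (at 0)"
proof -
  have "((\<lambda>z. 1 + z ^ 2 * wp_regular z) \<longlongrightarrow> 1 + 0 ^ 2 * 0) (at 0)"
    by (intro tendsto_intros wp_regular_tendsto)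
  moreover have "eventually (\<lambda>z. 1 + z ^ 2 * wp_regular z = z ^ 2 * \<wp> z) (at 0)"
    unfolding eventually_at_filter by (simp add: wp_eq distrib_left)
  ultimately show ?thesis using Lim_transform_eventually by fastforce
qed

lemma countable_lattice: "countable \<Lambda>"
proof -
  have "\<Lambda> = (\<lambda>(m, n). of_int m * \<omega>1 + of_int n * \<omega>2) ` UNIV"
    by (auto simp: lattice_def period_lattice_def)
  then show ?thesis by simp
qed

lemma connected_compl_lattice: "connected (- \<Lambda>)"
  using path_connected_complement_countable[OF _ countable_lattice] by (simp add: path_connected_imp_connected)

lemma constant_off_lattice:
  assumes "\<And>z. z \<notin> \<Lambda> \<Longrightarrow> (f has_field_derivative 0) (at z)"
  shows "\<exists>c. \<forall>z. z \<notin> \<Lambda> \<longrightarrow> f z = c"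
proof -
  have "f constant_on - \<Lambda>"
    using has_field_derivative_0_imp_constant_on[of "- \<Lambda>" f] assms connected_compl_lattice open_compl_lattice by auto
  then show ?thesis by (auto simp: constant_on_def)
qed

lemma exists_off_lattice: "\<exists>z. z \<notin> \<Lambda>"
proof (rule ccontr)
  assume "\<not> ?thesis"
  then have "\<Lambda> = UNIV" by auto
  then show False using countable_lattice uncountable_UNIV_complex by simp
qed

lemma deriv_shift_lattice:
  assumes per: "\<And>z. z \<notin> \<Lambda> \<Longrightarrow> f (z + w) = f z" and w: "w \<in> \<Lambda>" and f: "f holomorphic_on - \<Lambda>"
    and z: "z \<notin> \<Lambda>"
  shows "deriv f (z + w) = deriv f z"
proof -
  have "(f has_field_derivative deriv f (z + w)) (at (z + w))"
    using holomorphic_derivI[OF f open_compl_lattice] z w by simp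
  then have "((\<lambda>z. f (z + w)) has_field_derivative deriv f (z + w)) (at z)"
    by (rule DERIV_shift[THEN iffD1])
  then have "(f has_field_derivative deriv f (z + w)) (at z)"
    by (rule has_field_derivative_transform_within_open[OF _ open_compl_lattice]) (simp_all add: per z)
  then show ?thesis by (simp only: DERIV_imp_deriv)
qed

lemma deriv_wp_has_sum:
  assumes z: "z \<notin> \<Lambda>"
  shows "((\<lambda>w. - 2 / (z - w) ^ 3) has_sum deriv \<wp> z) \<Lambda>"
proof -
  have "((\<lambda>w. - 2 / (z - w) ^ 3) has_sum - 2 / z ^ 3) {0}"
    by (rule has_sum_finiteI) simp_all
  moreover have "((\<lambda>w. - 2 / (z - w) ^ 3) has_sum deriv wp_regular z) (\<Lambda> - {0})"
    by (rule wp_regular_deriv_has_sum) (use z in simp)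
  ultimately have "((\<lambda>w. - 2 / (z - w) ^ 3) has_sum - 2 / z ^ 3 + deriv wp_regular z) ({0} \<union> (\<Lambda> - {0}))"
    by (rule has_sum_Un_disjoint) simp
  also have "{0} \<union> (\<Lambda> - {0}) = \<Lambda>" by auto
  finally show ?thesis unfolding deriv_wp_eq[OF z] .
qed

text \<open>The terms depend on z - w alone, so a period merely reindexes the sum. The convergence
  terms 1 / w^2 break this for \<wp> itself, which is why the derivative comes first and the
  periodicity of \<wp> is recovered by integration.\<close>

lemma deriv_wp_periodic:
  assumes u: "u \<in> \<Lambda>" and z: "z \<notin> \<Lambda>"
  shows "deriv \<wp> (z + u) = deriv \<wp> z"
proof -
  have "((\<lambda>w. - 2 / (z + u - w) ^ 3) has_sum deriv \<wp> (z + u)) \<Lambda>"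
    using deriv_wp_has_sum[of "z + u"] u z by simp
  also have "?this \<longleftrightarrow> ((\<lambda>w. - 2 / (z - w) ^ 3) has_sum deriv \<wp> (z + u)) \<Lambda>"
    by (rule has_sum_reindex_bij_witness[of _ "\<lambda>w. w + u" "\<lambda>w. w - u"]) (simp_all add: u diff_diff_eq2 lattice_add)
  finally show ?thesis using deriv_wp_has_sum[OF z] infsumI by metis
qed

lemma wp_periodic:
  assumes u: "u \<in> \<Lambda>" and z: "z \<notin> \<Lambda>"
  shows "\<wp> (z + u) = \<wp> z"
proof -
  have "((\<lambda>z. \<wp> (z + u) - \<wp> z) has_field_derivative deriv \<wp> (z + u) - deriv \<wp> z) (at z)" if "z \<notin> \<Lambda>" for z
    using wp_deriv[of "z + u"] wp_deriv[OF that] u that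
    by (intro DERIV_diff DERIV_shift[THEN iffD1]) simp_all
  then have "((\<lambda>z. \<wp> (z + u) - \<wp> z) has_field_derivative 0) (at z)" if "z \<notin> \<Lambda>" for z
    using that u by (simp add: deriv_wp_periodic)
  from constant_off_lattice[OF this] obtain c where c: "\<And>z. z \<notin> \<Lambda> \<Longrightarrow> \<wp> (z + u) - \<wp> z = c" by auto
  \<comment> \<open>Evaluating at - z - u and using that \<wp> is even swaps the two terms, so c = -
    c.\<close>
  have "\<wp> (- z - u + u) - \<wp> (- z - u) = c" using z u by (intro c) simp
  moreover have "- z - u + u = - z" "- z - u = - (z + u)" by simp_all
  ultimately have "\<wp> z - \<wp> (z + u) = c" by (simp only: wp_minus)
  with c[OF z] have "c = - c" by (metis minus_diff_eq)
  then show ?thesis using c[OF z] by simp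
qed

lemma deriv2_wp_periodic: "u \<in> \<Lambda> \<Longrightarrow> z \<notin> \<Lambda> \<Longrightarrow> deriv (deriv \<wp>) (z + u) = deriv (deriv \<wp>) z"
  by (rule deriv_shift_lattice[of "deriv \<wp>" u, OF deriv_wp_periodic _ holomorphic_deriv[OF wp_holomorphic open_compl_lattice]])

lemma sigma_deriv: "(\<sigma> has_field_derivative deriv \<sigma> z) (at z)"
  by (rule holomorphic_derivI[OF sigma_holomorphic open_UNIV]) simp

lemma deriv_sigma_eq: "z \<notin> \<Lambda> \<Longrightarrow> deriv \<sigma> z = \<zeta> z * \<sigma> z"
  by (simp add: weierstrass_zeta_def sigma_eq_0_iff)

lemma zeta_quasi_periodic:
  assumes u: "u \<in> \<Lambda>"
  obtains \<eta> where "\<And>z. z \<notin> \<Lambda> \<Longrightarrow> \<zeta> (z + u) = \<zeta> z + \<eta>"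
proof -
  have "((\<lambda>z. \<zeta> (z + u) - \<zeta> z) has_field_derivative - \<wp> (z + u) - - \<wp> z) (at z)" if "z \<notin> \<Lambda>" for z
    using zeta_deriv[of "z + u"] zeta_deriv[OF that] u that
    by (intro DERIV_diff DERIV_shift[THEN iffD1]) simp_all
  then have "((\<lambda>z. \<zeta> (z + u) - \<zeta> z) has_field_derivative 0) (at z)" if "z \<notin> \<Lambda>" for z
    using that u by (simp add: wp_periodic)
  from constant_off_lattice[OF this] obtain \<eta> where "\<And>z. z \<notin> \<Lambda> \<Longrightarrow> \<zeta> (z + u) - \<zeta> z = \<eta>" by auto
  then show thesis by (intro that[of \<eta>]) (simp add: algebra_simps)
qed

text \<open>\<open>?q\<close> has logarithmic derivative \<zeta>(z + u) - \<eta> - \<zeta>(z) = 0,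
  so it is constant off the lattice; at lattice points both sides vanish.\<close>

lemma sigma_quasi_periodic:
  assumes u: "u \<in> \<Lambda>"
  obtains \<eta> d where "d \<noteq> 0" "\<And>z. \<sigma> (z + u) = d * exp (\<eta> * z) * \<sigma> z"
proof -
  obtain \<eta> where \<eta>: "\<And>z. z \<notin> \<Lambda> \<Longrightarrow> \<zeta> (z + u) = \<zeta> z + \<eta>" using zeta_quasi_periodic[OF u] by blast
  let ?q = "\<lambda>z. \<sigma> (z + u) * exp (- \<eta> * z) / \<sigma> z"
  have "(?q has_field_derivative 0) (at z)" if z: "z \<notin> \<Lambda>" for z
  proof -
    have nz: "\<sigma> z \<noteq> 0" using z by (simp add: sigma_eq_0_iff)
    have 1: "(\<sigma> has_field_derivative \<zeta> z * \<sigma> z) (at z)"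
      using sigma_deriv[of z] z by (simp add: deriv_sigma_eq)
    have 2: "((\<lambda>z. \<sigma> (z + u)) has_field_derivative (\<zeta> z + \<eta>) * \<sigma> (z + u)) (at z)"
      using sigma_deriv[of "z + u"] z u
      by (intro DERIV_shift[THEN iffD1]) (simp add: deriv_sigma_eq \<eta>)
    have "((\<lambda>z. exp (- \<eta> * z)) has_field_derivative - \<eta> * exp (- \<eta> * z)) (at z)"
      by (auto intro!: derivative_eq_intros)
    from DERIV_divide[OF DERIV_mult[OF 2 this] 1 nz] show ?thesis
      by (rule DERIV_cong) (simp add: algebra_simps)
  qed
  from constant_off_lattice[OF this] obtain d where d: "\<And>z. z \<notin> \<Lambda> \<Longrightarrow> ?q z = d" by auto
  have "\<sigma> (z + u) = d * exp (\<eta> * z) * \<sigma> z" for z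
  proof (cases "z \<in> \<Lambda>")
    case True
    then have "\<sigma> z = 0" "\<sigma> (z + u) = 0" using u by (auto simp: sigma_eq_0_iff lattice_add)
    then show ?thesis by simp
  next
    case False
    then have "\<sigma> (z + u) * exp (- \<eta> * z) = d * \<sigma> z"
      using d[OF False] by (simp add: sigma_eq_0_iff divide_eq_eq)
    then have "\<sigma> (z + u) * (exp (- \<eta> * z) * exp (\<eta> * z)) = d * exp (\<eta> * z) * \<sigma> z"
      by (simp add: mult_ac)
    then show ?thesis by (simp add: exp_add[symmetric])
  qed
  moreover obtain z where "z \<notin> \<Lambda>" using exists_off_lattice by blast
  then have "d \<noteq> 0" using d[of z] u by (auto simp: sigma_eq_0_iff)
  ultimately show thesis using that by blast
qed

end

section \<open>Elliptic functions without poles\<close>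

lemma filterlim_shift_at:
  fixes a b c :: complex
  assumes "a + c = b"
  shows "filterlim (\<lambda>z. z + c) (at b) (at a)"
proof -
  have "((\<lambda>z. z + c) \<longlongrightarrow> a + c) (at a)" by (intro tendsto_intros)
  moreover have "eventually (\<lambda>z. z + c \<noteq> b) (at a)"
    unfolding eventually_at_filter using assms by auto
  ultimately show ?thesis using assms by (simp add: filterlim_at)
qed

lemma filterlim_uminus_at:
  fixes a :: complex
  shows "filterlim uminus (at (- a)) (at a)"
proof -
  have "(uminus \<longlongrightarrow> - a) (at a)" by (intro tendsto_intros)
  moreover have "eventually (\<lambda>z. - z \<noteq> - a) (at a)"
    unfolding eventually_at_filter by auto
  ultimately show ?thesis by (simp add: filterlim_at)
qed

context complex_lattice
begin

definition translates :: "complex set \<Rightarrow> complex set" where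
  "translates B = {z. \<exists>b\<in>B. z - b \<in> \<Lambda>}"

lemma translates_add_iff: "w \<in> \<Lambda> \<Longrightarrow> z + w \<in> translates B \<longleftrightarrow> z \<in> translates B"
proof -
  assume w: "w \<in> \<Lambda>"
  have "z + w - b \<in> \<Lambda> \<longleftrightarrow> z - b \<in> \<Lambda>" for b
    using lattice_add_iff[OF w, of "z - b"] by (simp add: algebra_simps)
  then show ?thesis by (simp add: translates_def)
qed

lemma not_islimpt_translates:
  assumes "finite B"
  shows "\<not> z islimpt translates B"
proof (rule locally_finite_not_islimpt)
  fix R
  have "translates B \<inter> cball 0 R \<subseteq> (\<Union>b\<in>B. (\<lambda>w. w + b) ` (\<Lambda> \<inter> cball 0 (R + norm b)))"
  proof
    fix z assume "z \<in> translates B \<inter> cball 0 R"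
    then obtain b where b: "b \<in> B" "z - b \<in> \<Lambda>" "norm z \<le> R" by (auto simp: translates_def)
    have "norm (z - b) \<le> R + norm b" using b(3) norm_triangle_ineq4[of z b] by linarith
    then have "z - b \<in> \<Lambda> \<inter> cball 0 (R + norm b)" using b(2) by simp
    then have "z \<in> (\<lambda>w. w + b) ` (\<Lambda> \<inter> cball 0 (R + norm b))" by (rule image_eqI[rotated]) simp
    then show "z \<in> (\<Union>b\<in>B. (\<lambda>w. w + b) ` (\<Lambda> \<inter> cball 0 (R + norm b)))" using b(1) by blast
  qed
  then show "finite (translates B \<inter> cball 0 R)"
    by (rule finite_subset) (intro finite_UN_I assms finite_imageI finite_lattice_cball)
qed

text \<open>Periodicity carries the limit condition from \<open>B\<close> to all its translates, so
  every singularity is removable. The extension is entire and, by \<open>lattice_reduction\<close>,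
  bounded by its maximum on one closed ball; Liouville's theorem applies.\<close>

lemma elliptic_constant:
  assumes B: "finite B" and holo: "g holomorphic_on - translates B"
    and per: "\<And>z w. z \<notin> translates B \<Longrightarrow> w \<in> \<Lambda> \<Longrightarrow> g (z + w) = g z"
    and lim: "\<And>b. b \<in> B \<Longrightarrow> ((\<lambda>z. (z - b) * g z) \<longlongrightarrow> 0) (at b)"
  shows "\<exists>c. \<forall>z. z \<notin> translates B \<longrightarrow> g z = c"
proof -
  let ?A = "translates B"
  have op: "open (- ?A)"
    using not_islimpt_translates[OF B] by (simp add: open_Compl closed_limpt)
  have ev: "eventually (\<lambda>z. z \<notin> ?A) (at a)" for a
    using not_islimpt_translates[OF B, of a] by (simp add: islimpt_iff_eventually)
  have lim': "((\<lambda>z. (z - a) * g z) \<longlongrightarrow> 0) (at a)" if a: "a \<in> ?A" for a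
  proof -
    obtain b where b: "b \<in> B" "a - b \<in> \<Lambda>" using a unfolding translates_def by blast
    have "((\<lambda>z. (z + (b - a) - b) * g (z + (b - a))) \<longlongrightarrow> 0) (at a)"
      by (rule filterlim_compose[OF lim[OF b(1)] filterlim_shift_at]) simp
    moreover have "eventually (\<lambda>z. (z + (b - a) - b) * g (z + (b - a)) = (z - a) * g z) (at a)"
      using ev[of a]
    proof eventually_elim
      case (elim z)
      have "b - a \<in> \<Lambda>" using b(2) lattice_uminus_iff[of "a - b"] by simp
      then show ?case using per[OF elim] by simp
    qed
    ultimately show ?thesis by (rule Lim_transform_eventually)
  qed
  \<comment> \<open>On the exceptional set g may carry meaningless values, such as those produced by
    division by zero; the limit is the value of the holomorphic extension.\<close>
  define G where "G z = (if z \<in> ?A then Lim (at z) g else g z)" for z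
  have G_deriv: "\<exists>d. (G has_field_derivative d) (at a)" for a
  proof (cases "a \<in> ?A")
    case False
    then have "(g has_field_derivative deriv g a) (at a)"
      by (intro holomorphic_derivI[OF holo op]) simp
    then have "(G has_field_derivative deriv g a) (at a)"
      by (rule has_field_derivative_transform_within_open[OF _ op]) (use False in \<open>simp_all add: G_def\<close>)
    then show ?thesis ..
  next
    case True
    obtain r where r: "r > 0" "\<And>z. z \<noteq> a \<Longrightarrow> dist z a < r \<Longrightarrow> z \<notin> ?A"
      using ev[of a] unfolding eventually_at by auto
    have holo': "g holomorphic_on ball a r - {a}"
      by (rule holomorphic_on_subset[OF holo]) (use r(2) in \<open>auto simp: dist_commute\<close>)
    have "\<exists>h. h holomorphic_on ball a r \<and> (\<forall>z\<in>ball a r - {a}. h z = g z)"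
      by (subst holomorphic_on_extend_lim[OF holo']) (use r(1) lim'[OF True] in \<open>simp_all add: interior_open\<close>)
    then obtain h where h: "h holomorphic_on ball a r" "\<And>z. z \<in> ball a r - {a} \<Longrightarrow> h z = g z" by blast
    have "isCont h a" by (rule holomorphic_on_isCont[OF h(1)]) (use r(1) in simp_all)
    then have "(h \<longlongrightarrow> h a) (at a)" by (simp add: isCont_def)
    then have "(g \<longlongrightarrow> h a) (at a)"
      by (rule Lim_transform_within_open[OF _ open_ball[of a r]]) (use r(1) h(2) in auto)
    then have "Lim (at a) g = h a" by (rule tendsto_Lim[rotated]) simp
    then have Gh: "h z = G z" if "z \<in> ball a r" for z
      using that True h(2)[of z] r(2)[of z] by (cases "z = a") (auto simp: G_def dist_commute)
    have "(h has_field_derivative deriv h a) (at a)"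
      by (rule holomorphic_derivI[OF h(1)]) (use r(1) in simp_all)
    then have "(G has_field_derivative deriv h a) (at a)"
      by (rule has_field_derivative_transform_within_open[OF _ open_ball[of a r]]) (use r(1) Gh in simp_all)
    then show ?thesis ..
  qed
  then have G: "G holomorphic_on UNIV" by (subst holomorphic_on_open) simp_all
  define \<rho> where "\<rho> = norm \<omega>1 + norm \<omega>2"
  have "compact (G ` cball 0 \<rho>)"
    by (intro compact_continuous_image continuous_on_subset[OF holomorphic_on_imp_continuous_on[OF G]]) simp_all
  then obtain M where M: "\<And>z. z \<in> cball 0 \<rho> \<Longrightarrow> norm (G z) \<le> M"
    using compact_imp_bounded bounded_iff by (metis imageI)
  have off: "norm (G z) \<le> M" if z: "z \<notin> ?A" for z
  proof -
    obtain w where w: "w \<in> \<Lambda>" "norm (z - w) \<le> \<rho>" using lattice_reduction[of z] \<rho>_def by blast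
    have "z - w \<notin> ?A" using z translates_add_iff[OF w(1), of "z - w"] by simp
    then have "G (z - w) = G z" using per[of "z - w" w] w(1) z by (simp add: G_def)
    then show ?thesis using M[of "z - w"] w(2) by simp
  qed
  \<comment> \<open>Periodicity is assumed off the exceptional set only; the points in it inherit
    the bound as limits.\<close>
  have "norm (G z) \<le> M" for z
  proof (rule Lim_norm_ubound)
    show "(G \<longlongrightarrow> G z) (at z)"
      using holomorphic_on_isCont[OF G] by (simp add: isCont_def)
    show "eventually (\<lambda>z. norm (G z) \<le> M) (at z)"
      using ev[of z] by eventually_elim (rule off)
  qed simp
  then have "bounded (range G)" by (auto simp: bounded_iff)
  with G have "G constant_on UNIV" by (rule Liouville_theorem)
  then obtain c where "\<And>z. G z = c" by (auto simp: constant_on_def)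
  then show ?thesis by (metis G_def)
qed

lemma translates_0 [simp]: "translates {0} = \<Lambda>"
  by (simp add: translates_def)

text \<open>As a function of a, g is even and elliptic, since the multipliers of \<sigma> cancel in
  the quotient. Its double-pole coefficient at 0 is \<sigma>(k) \<sigma>(-k) + \<sigma>(k)^2 = 0, so
  g is constant; the value is read at a = k, where \<sigma>(a - k) = 0.\<close>

theorem sigma_addition:
  assumes k: "k \<notin> \<Lambda>" and a: "a \<notin> \<Lambda>"
  shows "\<sigma> (a + k) * \<sigma> (a - k) = - (\<sigma> a ^ 2 * \<sigma> k ^ 2 * (\<wp> a - \<wp> k))"
proof -
  define g where "g a = \<sigma> (a + k) * \<sigma> (a - k) / \<sigma> a ^ 2 + \<sigma> k ^ 2 * \<wp> a" for a
  have shift: "(\<lambda>a. \<sigma> (a + c)) holomorphic_on S" for c S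
    using holomorphic_on_compose[OF _ sigma_holomorphic, of "\<lambda>a. a + c" S]
    by (simp add: o_def holomorphic_on_add)
  have holo: "g holomorphic_on - \<Lambda>"
    unfolding g_def[abs_def]
    by (intro holomorphic_intros shift[where c = "- k", simplified] shift sigma_holomorphic wp_holomorphic)
      (simp add: sigma_eq_0_iff)
  have per: "g (z + w) = g z" if z: "z \<notin> \<Lambda>" and w: "w \<in> \<Lambda>" for z w
  proof -
    obtain \<eta> d where d: "d \<noteq> 0" and q: "\<And>z. \<sigma> (z + w) = d * exp (\<eta> * z) * \<sigma> z"
      using sigma_quasi_periodic[OF w] by blast
    have "\<sigma> (z + w + k) = d * exp (\<eta> * (z + k)) * \<sigma> (z + k)"
      "\<sigma> (z + w - k) = d * exp (\<eta> * (z - k)) * \<sigma> (z - k)"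
      using q[of "z + k"] q[of "z - k"] by (simp_all add: algebra_simps)
    then have "\<sigma> (z + w + k) * \<sigma> (z + w - k)
        = d ^ 2 * (exp (\<eta> * (z + k)) * exp (\<eta> * (z - k))) * (\<sigma> (z + k) * \<sigma> (z - k))"
      by (simp add: power2_eq_square mult_ac)
    also have "exp (\<eta> * (z + k)) * exp (\<eta> * (z - k)) = exp (\<eta> * z) ^ 2"
      by (simp add: power2_eq_square exp_add[symmetric] algebra_simps)
    finally have "\<sigma> (z + w + k) * \<sigma> (z + w - k) / \<sigma> (z + w) ^ 2 = \<sigma> (z + k) * \<sigma> (z - k) / \<sigma> z ^ 2"
      using d by (simp add: q power_mult_distrib)
    then show ?thesis using wp_periodic[OF w z] by (simp add: g_def)
  qed
  have even: "g (- z) = g z" for z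
  proof -
    have "\<sigma> (- z + k) = - \<sigma> (z - k)" "\<sigma> (- z - k) = - \<sigma> (z + k)"
      using sigma_minus[of "z - k"] sigma_minus[of "z + k"] by simp_all
    then show ?thesis by (simp add: g_def sigma_minus wp_minus)
  qed
  have "((\<lambda>z. \<sigma> (z + k) * \<sigma> (z - k) / (\<sigma> z / z) ^ 2 + \<sigma> k ^ 2 * (z ^ 2 * \<wp> z))
      \<longlongrightarrow> \<sigma> (0 + k) * \<sigma> (0 - k) / 1 ^ 2 + \<sigma> k ^ 2 * 1) (at 0)"
  proof (intro tendsto_intros sigma_quotient_tendsto wp_tendsto)
    have c: "isCont \<sigma> z" for z by (rule holomorphic_on_isCont[OF sigma_holomorphic open_UNIV]) simp
    show "((\<lambda>z. \<sigma> (z + k)) \<longlongrightarrow> \<sigma> (0 + k)) (at 0)" "((\<lambda>z. \<sigma> (z - k)) \<longlongrightarrow> \<sigma> (0 - k)) (at 0)"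
      by (rule isCont_tendsto_compose[OF c], intro tendsto_intros)+
  qed simp
  moreover have "eventually (\<lambda>z. \<sigma> (z + k) * \<sigma> (z - k) / (\<sigma> z / z) ^ 2 + \<sigma> k ^ 2 * (z ^ 2 * \<wp> z) = z ^ 2 * g z) (at 0)"
    unfolding eventually_at_filter by (simp add: g_def power_divide distrib_left mult_ac)
  ultimately have "((\<lambda>z. z ^ 2 * g z) \<longlongrightarrow> \<sigma> (0 + k) * \<sigma> (0 - k) / 1 ^ 2 + \<sigma> k ^ 2 * 1) (at 0)"
    by (rule Lim_transform_eventually)
  then have lim: "((\<lambda>z. z ^ 2 * g z) \<longlongrightarrow> 0) (at 0)"
    by (simp add: sigma_minus power2_eq_square)
  have "((\<lambda>z. z * g z) \<longlongrightarrow> 0) (at 0)"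
    by (rule even_no_simple_pole[OF _ open_compl_lattice_minus_0 _ even lim])
      (auto intro!: holomorphic_on_subset[OF holo])
  then have "\<exists>c. \<forall>z. z \<notin> translates {0} \<longrightarrow> g z = c"
    by (intro elliptic_constant) (simp_all add: holo per)
  then obtain c where c: "\<And>z. z \<notin> \<Lambda> \<Longrightarrow> g z = c" by auto
  have "\<sigma> (k - k) = 0" by (simp add: sigma_eq_0_iff)
  then have "g k = \<sigma> k ^ 2 * \<wp> k" by (simp add: g_def)
  then have "g a = \<sigma> k ^ 2 * \<wp> k" using c[OF k] c[OF a] by simp
  then have "\<sigma> (a + k) * \<sigma> (a - k) / \<sigma> a ^ 2 = - (\<sigma> k ^ 2 * (\<wp> a - \<wp> k))"
    by (simp add: g_def algebra_simps add_eq_0_iff2 flip: eq_diff_eq)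
  then show ?thesis using a by (simp add: sigma_eq_0_iff divide_eq_eq mult_ac)
qed

text \<open>With f for \<open>wp_regular\<close>, \<wp>'' - 6 \<wp>^2 = f'' - 12 f / z^2 - 6 f^2,
  because the terms in z^-4 cancel. The right-hand side tends to g2 / 10 - 12 g2 / 20 = - g2 / 2 at
  0, and an elliptic function with a finite limit at its only possible pole is constant.\<close>

theorem wp_differential_equation:
  assumes z: "z \<notin> \<Lambda>"
  shows "deriv (deriv \<wp>) z = 6 * \<wp> z ^ 2 - invariant_g2 \<Lambda> / 2"
proof -
  let ?f = "wp_regular" and ?g2 = "invariant_g2 \<Lambda>"
  define g where "g z = deriv (deriv \<wp>) z - 6 * \<wp> z ^ 2" for z
  have holo: "g holomorphic_on - \<Lambda>"
    unfolding g_def[abs_def]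
    by (intro holomorphic_intros wp_holomorphic open_compl_lattice)
  have holo': "deriv (deriv ?f) holomorphic_on - (\<Lambda> - {0})"
    by (intro holomorphic_intros wp_regular_holomorphic open_compl_lattice_minus_0)
  have "isCont (deriv (deriv ?f)) 0"
    by (rule holomorphic_on_isCont[OF holo' open_compl_lattice_minus_0]) simp
  then have f2: "(deriv (deriv ?f) \<longlongrightarrow> ?g2 / 10) (at 0)"
    by (simp add: isCont_def wp_regular_deriv2_0)
  have fq: "((\<lambda>z. ?f z / z ^ 2) \<longlongrightarrow> ?g2 / 10 / 2) (at 0)"
    using tendsto_quotient_square[OF wp_regular_holomorphic open_compl_lattice_minus_0]
    by (simp add: deriv_wp_regular_0 wp_regular_deriv2_0)
  have "((\<lambda>z. deriv (deriv ?f) z - 12 * (?f z / z ^ 2) - 6 * ?f z ^ 2)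
      \<longlongrightarrow> ?g2 / 10 - 12 * (?g2 / 10 / 2) - 6 * 0 ^ 2) (at 0)"
    by (intro tendsto_intros f2 fq wp_regular_tendsto)
  moreover have "eventually (\<lambda>z. deriv (deriv ?f) z - 12 * (?f z / z ^ 2) - 6 * ?f z ^ 2 = g z) (at 0)"
  proof -
    have "eventually (\<lambda>z. z \<notin> \<Lambda>) (at 0)"
      using islimpt_lattice[of 0] by (simp add: islimpt_iff_eventually)
    then show ?thesis
    proof eventually_elim
      case (elim z)
      then have "z \<noteq> 0" by auto
      then show ?case unfolding g_def deriv2_wp_eq[OF elim] wp_eq
        by (simp add: divide_simps) (simp add: algebra_simps eval_nat_numeral)
    qed
  qed
  ultimately have "(g \<longlongrightarrow> ?g2 / 10 - 12 * (?g2 / 10 / 2) - 6 * 0 ^ 2) (at 0)"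
    by (rule Lim_transform_eventually)
  then have lim: "(g \<longlongrightarrow> - ?g2 / 2) (at 0)" by (simp add: field_simps)
  have "((\<lambda>z. (z - 0) * g z) \<longlongrightarrow> (0 - 0) * (- ?g2 / 2)) (at 0)"
    by (intro tendsto_intros lim)
  then have "\<exists>c. \<forall>z. z \<notin> translates {0} \<longrightarrow> g z = c"
    by (intro elliptic_constant) (simp_all add: holo, simp add: g_def deriv2_wp_periodic wp_periodic)
  then obtain c where c: "\<And>z. z \<notin> \<Lambda> \<Longrightarrow> g z = c" by auto
  have "eventually (\<lambda>z. g z = c) (at 0)"
    using islimpt_lattice[of 0] c by (auto simp: islimpt_iff_eventually elim: eventually_mono)
  then have "(g \<longlongrightarrow> c) (at 0)" by (rule tendsto_eventually)
  then have "c = - ?g2 / 2" using lim by (intro LIM_unique)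
  then show ?thesis using c[OF z] by (simp add: g_def algebra_simps)
qed

end

section \<open>Relations along a translation\<close>

context complex_lattice
begin

lemma deriv_wp_minus:
  assumes "z \<notin> \<Lambda>"
  shows "deriv \<wp> (- z) = - deriv \<wp> z"
proof -
  have "(\<wp> has_field_derivative deriv \<wp> (- z)) (at (- z))" using assms by (intro wp_deriv) simp
  moreover have "(uminus has_field_derivative - 1) (at z)" by (auto intro!: derivative_eq_intros)
  ultimately have "((\<lambda>z. \<wp> (- z)) has_field_derivative deriv \<wp> (- z) * - 1) (at z)"
    by (rule DERIV_chain2)
  then have "(\<wp> has_field_derivative - deriv \<wp> (- z)) (at z)" by (simp add: wp_minus)
  from DERIV_imp_deriv[OF this] show ?thesis by simp
qed

lemma deriv2_wp_minus:
  assumes z: "z \<notin> \<Lambda>"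
  shows "deriv (deriv \<wp>) (- z) = deriv (deriv \<wp>) z"
proof -
  have "(deriv \<wp> has_field_derivative deriv (deriv \<wp>) (- z)) (at (- z))"
    using z by (intro deriv_wp_deriv) simp
  moreover have "(uminus has_field_derivative - 1) (at z)" by (auto intro!: derivative_eq_intros)
  ultimately have "((\<lambda>z. deriv \<wp> (- z)) has_field_derivative deriv (deriv \<wp>) (- z) * - 1) (at z)"
    by (rule DERIV_chain2)
  from DERIV_minus[OF this] have "((\<lambda>z. - deriv \<wp> (- z)) has_field_derivative deriv (deriv \<wp>) (- z)) (at z)"
    by simp
  then have "(deriv \<wp> has_field_derivative deriv (deriv \<wp>) (- z)) (at z)"
    by (rule has_field_derivative_transform_within_open[OF _ open_compl_lattice])
      (use z in \<open>simp_all add: deriv_wp_minus\<close>)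
  from DERIV_imp_deriv[OF this] show ?thesis by simp
qed

lemma wp_isCont: "z \<notin> \<Lambda> \<Longrightarrow> isCont \<wp> z"
  using DERIV_isCont[OF wp_deriv] .

lemma wp_shift_tendsto:
  assumes "a + c \<notin> \<Lambda>"
  shows "((\<lambda>z. \<wp> (z + c)) \<longlongrightarrow> \<wp> (a + c)) (at a)"
  by (rule isCont_tendsto_compose[OF wp_isCont[OF assms]]) (intro tendsto_intros)

lemma wp_shift_deriv:
  assumes "z + c \<notin> \<Lambda>"
  shows "((\<lambda>z. \<wp> (z + c)) has_field_derivative deriv \<wp> (z + c)) (at z)"
  using wp_deriv[OF assms] by (rule DERIV_shift[THEN iffD1])

lemma wp_shift_holomorphic:
  assumes "\<And>z. z \<in> S \<Longrightarrow> z + c \<notin> \<Lambda>"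
  shows "(\<lambda>z. \<wp> (z + c)) holomorphic_on S"
proof -
  have "((\<lambda>z. \<wp> (z + c)) has_field_derivative deriv \<wp> (z + c)) (at z within S)" if "z \<in> S" for z
    using wp_shift_deriv[OF assms[OF that]] by (rule has_field_derivative_at_within)
  then show ?thesis unfolding holomorphic_on_def field_differentiable_def by blast
qed

lemma open_translates_compl: "finite B \<Longrightarrow> open (- translates B)"
  using not_islimpt_translates by (simp add: open_Compl closed_limpt)

lemma eventually_not_translates: "finite B \<Longrightarrow> eventually (\<lambda>z. z \<notin> translates B) (at a)"
  using not_islimpt_translates[of B a] by (simp add: islimpt_iff_eventually)

end

section \<open>Identities linking v(a - \<kappa>), v(a) and v(a + \<kappa>)\<close>

locale lattice_point = complex_lattice +
  fixes \<kappa> :: complex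
  assumes kappa: "\<kappa> \<notin> \<Lambda>" and deriv_wp_kappa: "deriv (weierstrass_wp \<Lambda>) \<kappa> \<noteq> 0"
begin

definition v :: "complex \<Rightarrow> complex" where "v a = \<wp> a - \<wp> \<kappa>"

abbreviation m where "m \<equiv> deriv \<wp> \<kappa>"
abbreviation J where "J \<equiv> deriv (deriv \<wp>) \<kappa>"

definition poles :: "complex set" where "poles = translates {0, \<kappa>, - \<kappa>}"

lemma mem_poles: "a \<in> poles \<longleftrightarrow> a \<in> \<Lambda> \<or> a - \<kappa> \<in> \<Lambda> \<or> a + \<kappa> \<in> \<Lambda>"
  by (simp add: poles_def translates_def)

text \<open>A period 2 \<kappa> would make the odd function \<wp>' take equal values at \<kappa> and
  - \<kappa>. The lemma keeps v(z + \<kappa>) regular at z = \<kappa>, where v(z - \<kappa>) has its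
  pole.\<close>

lemma two_kappa: "\<kappa> + \<kappa> \<notin> \<Lambda>"
proof
  assume "\<kappa> + \<kappa> \<in> \<Lambda>"
  then have "deriv \<wp> (- \<kappa> + (\<kappa> + \<kappa>)) = deriv \<wp> (- \<kappa>)"
    using kappa by (intro deriv_wp_periodic) simp_all
  then show False using deriv_wp_minus[OF kappa] deriv_wp_kappa by simp
qed

lemma v_minus: "v (- a) = v a"
  by (simp add: v_def wp_minus)

lemma v_minus_shift: "v (\<kappa> - a) = v (a - \<kappa>)" "v (- a - \<kappa>) = v (a + \<kappa>)"
  using v_minus[of "a - \<kappa>"] v_minus[of "a + \<kappa>"] by simp_all

lemma v_kappa: "v \<kappa> = 0" "v (- \<kappa>) = 0"
  using v_minus[of \<kappa>] by (simp_all add: v_def)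

lemma v_periodic: "w \<in> \<Lambda> \<Longrightarrow> z \<notin> \<Lambda> \<Longrightarrow> v (z + w) = v z"
  by (simp add: v_def wp_periodic)

lemma v_shift_periodic:
  assumes "w \<in> \<Lambda>" "z \<notin> poles"
  shows "v (z + w) = v z" "v (z + w + \<kappa>) = v (z + \<kappa>)" "v (z + w - \<kappa>) = v (z - \<kappa>)"
  using v_periodic[OF assms(1), of z] v_periodic[OF assms(1), of "z + \<kappa>"]
    v_periodic[OF assms(1), of "z - \<kappa>"] assms(2)
  by (simp_all add: mem_poles algebra_simps)

lemma v_shift_holomorphic:
  assumes "\<And>z. z \<in> S \<Longrightarrow> z + c \<notin> \<Lambda>"
  shows "(\<lambda>z. v (z + c)) holomorphic_on S"
  unfolding v_def by (intro holomorphic_intros wp_shift_holomorphic assms)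

lemma v_holomorphic_poles:
  "v holomorphic_on - poles" "(\<lambda>z. v (z + \<kappa>)) holomorphic_on - poles"
  "(\<lambda>z. v (z - \<kappa>)) holomorphic_on - poles"
  using v_shift_holomorphic[of "- poles" 0] v_shift_holomorphic[of "- poles" \<kappa>]
    v_shift_holomorphic[of "- poles" "- \<kappa>"] by (simp_all add: mem_poles)

lemma v_shift_tendsto: "a + c \<notin> \<Lambda> \<Longrightarrow> ((\<lambda>z. v (z + c)) \<longlongrightarrow> v (a + c)) (at a)"
  unfolding v_def by (intro tendsto_intros wp_shift_tendsto)

lemma v_tendsto_kappa: "(v \<longlongrightarrow> 0) (at \<kappa>)"
  using v_shift_tendsto[of \<kappa> 0] kappa by (simp add: v_kappa)

lemma v_tendsto_0: "((\<lambda>z. z ^ 2 * v z) \<longlongrightarrow> 1) (at 0)"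
proof -
  have "((\<lambda>z. z ^ 2 * \<wp> z - z ^ 2 * \<wp> \<kappa>) \<longlongrightarrow> 1 - 0 ^ 2 * \<wp> \<kappa>) (at 0)"
    by (intro tendsto_intros wp_tendsto)
  then show ?thesis by (simp add: v_def algebra_simps)
qed

text \<open>The double zero of v^2 at \<kappa> meets the double pole of v(z - \<kappa>): the former
  contributes the squared slope m^2, the latter the coefficient 1. The factor m^2 in both relations
  below originates here.\<close>

lemma v_square_tendsto_kappa: "((\<lambda>z. v z ^ 2 * v (z - \<kappa>)) \<longlongrightarrow> m ^ 2) (at \<kappa>)"
proof -
  have "((\<lambda>z. v z / (z - \<kappa>)) \<longlongrightarrow> m) (at \<kappa>)"
    using wp_deriv[OF kappa] by (simp add: v_def has_field_derivative_iff)
  moreover have "((\<lambda>z. (z + - \<kappa>) ^ 2 * v (z + - \<kappa>)) \<longlongrightarrow> 1) (at \<kappa>)"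
    by (rule filterlim_compose[OF v_tendsto_0 filterlim_shift_at]) simp
  ultimately have "((\<lambda>z. (v z / (z - \<kappa>)) ^ 2 * ((z + - \<kappa>) ^ 2 * v (z + - \<kappa>))) \<longlongrightarrow> m ^ 2 * 1) (at \<kappa>)"
    by (intro tendsto_intros)
  moreover have "eventually (\<lambda>z. (v z / (z - \<kappa>)) ^ 2 * ((z + - \<kappa>) ^ 2 * v (z + - \<kappa>)) = v z ^ 2 * v (z - \<kappa>)) (at \<kappa>)"
    unfolding eventually_at_filter by (simp add: power_divide)
  ultimately have "((\<lambda>z. v z ^ 2 * v (z - \<kappa>)) \<longlongrightarrow> m ^ 2 * 1) (at \<kappa>)"
    by (rule Lim_transform_eventually)
  then show ?thesis by simp
qed

lemma even_tendsto_minus_kappa: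
  assumes "\<And>z. g (- z) = g z" "(g \<longlongrightarrow> l) (at \<kappa>)"
  shows "(g \<longlongrightarrow> l) (at (- \<kappa>))"
  using filterlim_compose[OF assms(2) filterlim_uminus_at[of "- \<kappa>", simplified]] assms(1) by simp

lemma vanishing_multiple:
  fixes g :: "complex \<Rightarrow> complex"
  assumes "(g \<longlongrightarrow> l) (at a)"
  shows "((\<lambda>z. (z - a) * g z) \<longlongrightarrow> 0) (at a)"
proof -
  have "((\<lambda>z. (z - a) * g z) \<longlongrightarrow> (a - a) * l) (at a)"
    by (intro tendsto_intros assms)
  then show ?thesis by simp
qed

text \<open>Evenness transfers the behaviour at \<kappa> to - \<kappa>, and the constant is
  identified as the limit at \<kappa>; only 0 and \<kappa> have to be examined.\<close>

lemma constant_off_poles: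
  assumes holo: "g holomorphic_on - poles" and even: "\<And>z. g (- z) = g z"
    and per: "\<And>z w. z \<notin> poles \<Longrightarrow> w \<in> \<Lambda> \<Longrightarrow> g (z + w) = g z"
    and lim: "(g \<longlongrightarrow> l) (at \<kappa>)" and lim0: "((\<lambda>z. z * g z) \<longlongrightarrow> 0) (at 0)"
    and z: "z \<notin> poles"
  shows "g z = l"
proof -
  have "\<exists>c. \<forall>z. z \<notin> translates {0, \<kappa>, - \<kappa>} \<longrightarrow> g z = c"
  proof (rule elliptic_constant)
    show "((\<lambda>z. (z - b) * g z) \<longlongrightarrow> 0) (at b)" if b: "b \<in> {0, \<kappa>, - \<kappa>}" for b
    proof -
      consider "b = 0" | "b = \<kappa>" | "b = - \<kappa>" using b by blast
      then show ?thesis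
      proof cases
        case 1 then show ?thesis using lim0 by simp
      next
        case 2 then show ?thesis using vanishing_multiple[OF lim] by simp
      next
        case 3 then show ?thesis
          using vanishing_multiple[OF even_tendsto_minus_kappa[OF even lim]] by simp
      qed
    qed
  qed (use holo per in \<open>simp_all add: poles_def\<close>)
  then obtain c where c: "\<And>z. z \<notin> poles \<Longrightarrow> g z = c" unfolding poles_def by blast
  have "eventually (\<lambda>z. z \<notin> poles) (at \<kappa>)"
    unfolding poles_def by (rule eventually_not_translates) simp
  then have "eventually (\<lambda>z. g z = c) (at \<kappa>)" by eventually_elim (rule c)
  then have "(g \<longlongrightarrow> c) (at \<kappa>)" by (rule tendsto_eventually)
  then have "c = l" using lim by (rule LIM_unique)
  then show ?thesis using c[OF z] by simp
qed

lemma v_deriv: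
  assumes "a + c \<notin> \<Lambda>"
  shows "((\<lambda>a. v (a + c)) has_field_derivative deriv \<wp> (a + c)) (at a)"
  unfolding v_def using DERIV_diff[OF wp_shift_deriv[OF assms] DERIV_const] by simp

text \<open>Near 0 the even function u = v(z + \<kappa>) + v(z - \<kappa>) vanishes to second order,
  with u / z^2 tending to J = \<wp>''(\<kappa>). Hence v^2 u diverges like J / z^2 after the leading
  powers combine, and subtracting J v removes this; evenness excludes a remaining simple
  pole.\<close>

theorem sum_relation:
  assumes "a \<notin> poles"
  shows "v a ^ 2 * (v (a + \<kappa>) + v (a - \<kappa>)) - J * v a = m ^ 2"
proof -
  define u where "u z = v (z + \<kappa>) + v (z - \<kappa>)" for z
  define g where "g z = v z ^ 2 * u z - J * v z" for z
  define S where "S = - translates {\<kappa>, - \<kappa>}"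
  have S_iff: "z \<in> S \<longleftrightarrow> z + \<kappa> \<notin> \<Lambda> \<and> z - \<kappa> \<notin> \<Lambda>" for z
    by (auto simp: S_def translates_def)
  have S: "open S" "0 \<in> S"
    using kappa by (simp_all add: S_iff) (simp add: S_def open_translates_compl)
  have u_holo: "u holomorphic_on S"
    unfolding u_def[abs_def]
    using v_shift_holomorphic[of S \<kappa>] v_shift_holomorphic[of S "- \<kappa>"]
    by (intro holomorphic_intros) (simp_all add: S_iff)
  have du: "deriv u z = deriv \<wp> (z + \<kappa>) + deriv \<wp> (z - \<kappa>)" if "z \<in> S" for z
  proof (rule DERIV_imp_deriv)
    show "(u has_field_derivative deriv \<wp> (z + \<kappa>) + deriv \<wp> (z - \<kappa>)) (at z)"
      unfolding u_def[abs_def] diff_conv_add_uminus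
      by (intro DERIV_add v_deriv) (use that in \<open>simp_all add: S_iff\<close>)
  qed
  have "deriv (deriv u) 0 = deriv (deriv \<wp>) (0 + \<kappa>) + deriv (deriv \<wp>) (0 + - \<kappa>)"
  proof (rule DERIV_imp_deriv, rule deriv_on_open[OF S du])
    show "((\<lambda>z. deriv \<wp> (z + \<kappa>) + deriv \<wp> (z - \<kappa>)) has_field_derivative
        deriv (deriv \<wp>) (0 + \<kappa>) + deriv (deriv \<wp>) (0 + - \<kappa>)) (at 0)"
      unfolding diff_conv_add_uminus
      by (intro DERIV_add DERIV_shift[THEN iffD1] deriv_wp_deriv) (simp_all add: kappa)
  qed
  then have ddu: "deriv (deriv u) 0 = 2 * J" using deriv2_wp_minus[OF kappa] by simp
  have "u 0 = 0" by (simp add: u_def v_kappa)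
  moreover have "deriv u 0 = 0" using du[OF S(2)] deriv_wp_minus[OF kappa] by simp
  ultimately have u2: "((\<lambda>z. u z / z ^ 2) \<longlongrightarrow> J) (at 0)"
    using tendsto_quotient_square[OF u_holo S] ddu by simp
  have even: "g (- z) = g z" for z
    by (simp add: g_def u_def v_minus v_minus_shift add.commute)
  have "((\<lambda>z. (z ^ 2 * v z) * ((z ^ 2 * v z) * (u z / z ^ 2) - J)) \<longlongrightarrow> 1 * (1 * J - J)) (at 0)"
    by (intro tendsto_intros v_tendsto_0 u2)
  moreover have "eventually (\<lambda>z. (z ^ 2 * v z) * ((z ^ 2 * v z) * (u z / z ^ 2) - J) = z ^ 2 * g z) (at 0)"
    unfolding eventually_at_filter
  proof (intro always_eventually allI impI)
    fix z :: complex assume "z \<noteq> 0"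
    then have "(z ^ 2 * v z) * (u z / z ^ 2) = v z * u z" by simp
    then show "(z ^ 2 * v z) * ((z ^ 2 * v z) * (u z / z ^ 2) - J) = z ^ 2 * g z"
      by (simp only:) (simp add: g_def power2_eq_square right_diff_distrib mult_ac)
  qed
  ultimately have "((\<lambda>z. z ^ 2 * g z) \<longlongrightarrow> 1 * (1 * J - J)) (at 0)"
    by (rule Lim_transform_eventually)
  then have lim: "((\<lambda>z. z ^ 2 * g z) \<longlongrightarrow> 0) (at 0)" by simp
  define S' where "S' = S \<inter> - (\<Lambda> - {0})"
  have S': "open S'" "0 \<in> S'"
    unfolding S'_def using S open_Int[OF S(1) open_compl_lattice_minus_0] by blast+
  have "g holomorphic_on S' - {0}"
    unfolding g_def[abs_def] using v_shift_holomorphic[of "S' - {0}" 0]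
    by (intro holomorphic_intros holomorphic_on_subset[OF u_holo]) (auto simp: S'_def)
  then have lim0: "((\<lambda>z. z * g z) \<longlongrightarrow> 0) (at 0)"
    by (rule even_no_simple_pole[OF _ S' even lim])
  have "((\<lambda>z. v z ^ 2 * v (z + \<kappa>) + v z ^ 2 * v (z - \<kappa>) - J * v z)
      \<longlongrightarrow> 0 ^ 2 * v (\<kappa> + \<kappa>) + m ^ 2 - J * 0) (at \<kappa>)"
    by (intro tendsto_intros v_tendsto_kappa v_square_tendsto_kappa v_shift_tendsto two_kappa)
  then have lim: "(g \<longlongrightarrow> m ^ 2) (at \<kappa>)"
    by (simp add: g_def[abs_def] u_def distrib_left)
  have holo: "g holomorphic_on - poles"
    unfolding g_def[abs_def] u_def[abs_def]
    by (intro holomorphic_intros v_holomorphic_poles)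
  have per: "g (z + w) = g z" if "z \<notin> poles" "w \<in> \<Lambda>" for z w
    using v_shift_periodic[OF that(2,1)] by (simp add: g_def u_def)
  have "g a = m ^ 2" using constant_off_poles[OF holo even per lim lim0 assms] .
  then show ?thesis by (simp add: g_def u_def)
qed

text \<open>By \<open>sum_relation\<close>, the left-hand side is invariant under \<open>a \<mapsto> a + \<kappa>\<close>; its regularity at
  \<open>\<kappa>\<close> therefore carries over to \<open>0\<close> without any Laurent expansion.\<close>

theorem product_relation:
  assumes "a \<notin> poles"
  shows "v a ^ 2 * (v (a + \<kappa>) * v (a - \<kappa>)) + m ^ 2 * v a = m ^ 2 * v (\<kappa> + \<kappa>)"
proof -
  define T where "T z = v z ^ 2 * (v (z + \<kappa>) * v (z - \<kappa>)) + m ^ 2 * v z" for z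
  have even: "T (- z) = T z" for z
    by (simp add: T_def v_minus v_minus_shift mult_ac)
  have "((\<lambda>z. (v z ^ 2 * v (z - \<kappa>)) * v (z + \<kappa>) + m ^ 2 * v z)
      \<longlongrightarrow> m ^ 2 * v (\<kappa> + \<kappa>) + m ^ 2 * 0) (at \<kappa>)"
    by (intro tendsto_intros v_tendsto_kappa v_square_tendsto_kappa v_shift_tendsto two_kappa)
  then have lim: "(T \<longlongrightarrow> m ^ 2 * v (\<kappa> + \<kappa>)) (at \<kappa>)"
    by (simp add: T_def[abs_def] mult_ac)
  have step: "T (z + \<kappa>) = T z" if "z \<notin> poles" "z + \<kappa> \<notin> poles" for z
  proof -
    have 1: "v z ^ 2 * v (z - \<kappa>) = J * v z + m ^ 2 - v z ^ 2 * v (z + \<kappa>)"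
      using sum_relation[OF that(1)] by (simp add: distrib_left) (simp add: algebra_simps)
    have 2: "v (z + \<kappa>) ^ 2 * v (z + \<kappa> + \<kappa>) = J * v (z + \<kappa>) + m ^ 2 - v (z + \<kappa>) ^ 2 * v z"
      using sum_relation[OF that(2)] by (simp add: distrib_left) (simp add: algebra_simps)
    \<comment> \<open>Both sides become J p + m^2 (v z + v (z + \<kappa>)) - p^2 with p = v z * v (z
      + \<kappa>), which is symmetric in the two values.\<close>
    have T1: "T z = (J * v z + m ^ 2 - v z ^ 2 * v (z + \<kappa>)) * v (z + \<kappa>) + m ^ 2 * v z"
      unfolding 1[symmetric] by (simp add: T_def mult_ac)
    have T2: "T (z + \<kappa>) = (J * v (z + \<kappa>) + m ^ 2 - v (z + \<kappa>) ^ 2 * v z) * v z + m ^ 2 * v (z + \<kappa>)"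
      unfolding 2[symmetric] by (simp add: T_def mult_ac)
    show ?thesis unfolding T1 T2 by (simp add: algebra_simps power2_eq_square)
  qed
  have "((\<lambda>z. T (z + \<kappa>)) \<longlongrightarrow> m ^ 2 * v (\<kappa> + \<kappa>)) (at 0)"
    by (rule filterlim_compose[OF lim filterlim_shift_at]) simp
  moreover have "eventually (\<lambda>z. T (z + \<kappa>) = T z) (at 0)"
  proof -
    \<comment> \<open>The extra representative - (\<kappa> + \<kappa>) accounts for the pole set
      shifted by \<kappa>, so that z and z + \<kappa> both avoid \<open>poles\<close>.\<close>
    have "eventually (\<lambda>z. z \<notin> translates {0, \<kappa>, - \<kappa>, - (\<kappa> + \<kappa>)}) (at 0)"
      by (rule eventually_not_translates) simp
    then show ?thesis
    proof eventually_elim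
      case (elim z)
      then show ?case by (intro step) (simp_all add: mem_poles translates_def add.assoc)
    qed
  qed
  ultimately have "(T \<longlongrightarrow> m ^ 2 * v (\<kappa> + \<kappa>)) (at 0)" by (rule Lim_transform_eventually)
  from vanishing_multiple[OF this] have lim0: "((\<lambda>z. z * T z) \<longlongrightarrow> 0) (at 0)" by simp
  have holo: "T holomorphic_on - poles"
    unfolding T_def[abs_def] by (intro holomorphic_intros v_holomorphic_poles)
  have per: "T (z + w) = T z" if "z \<notin> poles" "w \<in> \<Lambda>" for z w
    using v_shift_periodic[OF that(2,1)] by (simp add: T_def)
  have "T a = m ^ 2 * v (\<kappa> + \<kappa>)" using constant_off_poles[OF holo even per lim lim0 assms] .
  then show ?thesis by (simp add: T_def)
qed

lemma derivative_relations:
  assumes a: "a \<notin> poles"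
  defines "v1 \<equiv> v (a - \<kappa>)" and "v2 \<equiv> v a" and "v3 \<equiv> v (a + \<kappa>)"
    and "d1 \<equiv> deriv \<wp> (a - \<kappa>)" and "d2 \<equiv> deriv \<wp> a" and "d3 \<equiv> deriv \<wp> (a + \<kappa>)"
  shows "2 * v2 * d2 * (v3 + v1) + v2 ^ 2 * (d3 + d1) - J * d2 = 0"
    and "2 * v2 * d2 * (v3 * v1) + v2 ^ 2 * (d3 * v1 + v3 * d1) + m ^ 2 * d2 = 0"
proof -
  have op: "open (- poles)" by (simp add: poles_def open_translates_compl)
  have D: "((\<lambda>a. v (a - \<kappa>)) has_field_derivative d1) (at a)" "(v has_field_derivative d2) (at a)"
    "((\<lambda>a. v (a + \<kappa>)) has_field_derivative d3) (at a)"
    using a v_deriv[of a "- \<kappa>"] v_deriv[of a 0] v_deriv[of a \<kappa>]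
    by (simp_all add: mem_poles d1_def d2_def d3_def)
  have const: "d = 0" if "(f has_field_derivative d) (at a)" "\<And>z. z \<notin> poles \<Longrightarrow> f z = c" for f d c
  proof -
    have "((\<lambda>_. c) has_field_derivative d) (at a)"
      by (rule has_field_derivative_transform_within_open[OF that(1) op]) (use a that(2) in auto)
    then show "d = 0" using DERIV_unique[OF _ DERIV_const] by blast
  qed
  have "((\<lambda>a. v a ^ 2 * (v (a + \<kappa>) + v (a - \<kappa>)) - J * v a) has_field_derivative
      2 * v2 * d2 * (v3 + v1) + v2 ^ 2 * (d3 + d1) - J * d2) (at a)"
    by (rule derivative_eq_intros D refl)+ (simp add: v1_def v2_def v3_def algebra_simps)
  then show "2 * v2 * d2 * (v3 + v1) + v2 ^ 2 * (d3 + d1) - J * d2 = 0"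
    by (rule const[OF _ sum_relation])
  have "((\<lambda>a. v a ^ 2 * (v (a + \<kappa>) * v (a - \<kappa>)) + m ^ 2 * v a) has_field_derivative
      2 * v2 * d2 * (v3 * v1) + v2 ^ 2 * (d3 * v1 + v3 * d1) + m ^ 2 * d2) (at a)"
    by (rule derivative_eq_intros D refl)+ (simp add: v1_def v2_def v3_def algebra_simps)
  then show "2 * v2 * d2 * (v3 * v1) + v2 ^ 2 * (d3 * v1 + v3 * d1) + m ^ 2 * d2 = 0"
    by (rule const[OF _ product_relation])
qed

text \<open>The derivative in a of \<sigma>(a + \<kappa>) \<sigma>(a - \<kappa>) = - \<sigma>(a)^2
  \<sigma>(\<kappa>)^2 v(a), divided by the nonzero factor \<sigma>(a)^2 \<sigma>(\<kappa>)^2. It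
  converts differences of \<zeta> into the quantities of
  \<open>derivative_relations\<close>.\<close>

lemma zeta_second_difference:
  assumes a: "a \<notin> poles"
  shows "v a * (\<zeta> (a + \<kappa>) + \<zeta> (a - \<kappa>) - 2 * \<zeta> a) = deriv \<wp> a"
proof -
  have nl: "a \<notin> \<Lambda>" "a + \<kappa> \<notin> \<Lambda>" "a - \<kappa> \<notin> \<Lambda>" using a by (auto simp: mem_poles)
  have D: "((\<lambda>a. \<sigma> (a + c)) has_field_derivative \<zeta> (a + c) * \<sigma> (a + c)) (at a)" if "a + c \<notin> \<Lambda>" for c
    using sigma_deriv[of "a + c"] that
    by (intro DERIV_shift[THEN iffD1]) (simp add: deriv_sigma_eq)
  have "((\<lambda>a. \<sigma> (a + \<kappa>) * \<sigma> (a + - \<kappa>)) has_field_derivative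
      (\<zeta> (a + \<kappa>) + \<zeta> (a + - \<kappa>)) * (\<sigma> (a + \<kappa>) * \<sigma> (a + - \<kappa>))) (at a)"
    using DERIV_mult[OF D[of \<kappa>] D[of "- \<kappa>"]] nl by (simp add: algebra_simps)
  moreover have "((\<lambda>a. - (\<sigma> a ^ 2 * \<sigma> \<kappa> ^ 2 * v a)) has_field_derivative
      - (\<sigma> \<kappa> ^ 2 * \<sigma> a ^ 2 * (2 * \<zeta> a * v a + deriv \<wp> a))) (at a)"
    using D[of 0] v_deriv[of a 0] nl
    by (auto intro!: derivative_eq_intros simp: power2_eq_square algebra_simps)
  then have "((\<lambda>a. \<sigma> (a + \<kappa>) * \<sigma> (a + - \<kappa>)) has_field_derivative
      - (\<sigma> \<kappa> ^ 2 * \<sigma> a ^ 2 * (2 * \<zeta> a * v a + deriv \<wp> a))) (at a)"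
    by (rule has_field_derivative_transform_within_open[OF _ open_compl_lattice])
      (use nl kappa in \<open>simp_all add: sigma_addition v_def\<close>)
  ultimately have "(\<zeta> (a + \<kappa>) + \<zeta> (a - \<kappa>)) * (\<sigma> (a + \<kappa>) * \<sigma> (a - \<kappa>))
      = - (\<sigma> \<kappa> ^ 2 * \<sigma> a ^ 2 * (2 * \<zeta> a * v a + deriv \<wp> a))"
    using DERIV_unique by fastforce
  also have "\<sigma> (a + \<kappa>) * \<sigma> (a - \<kappa>) = - (\<sigma> a ^ 2 * \<sigma> \<kappa> ^ 2 * v a)"
    using sigma_addition[OF kappa nl(1)] by (simp add: v_def)
  finally have "\<sigma> \<kappa> ^ 2 * \<sigma> a ^ 2 * ((\<zeta> (a + \<kappa>) + \<zeta> (a - \<kappa>)) * v a)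
      = \<sigma> \<kappa> ^ 2 * \<sigma> a ^ 2 * (2 * \<zeta> a * v a + deriv \<wp> a)"
    by (simp add: mult_ac)
  moreover have "\<sigma> \<kappa> ^ 2 * \<sigma> a ^ 2 \<noteq> 0" using kappa nl by (simp add: sigma_eq_0_iff)
  ultimately have "(\<zeta> (a + \<kappa>) + \<zeta> (a - \<kappa>)) * v a = 2 * \<zeta> a * v a + deriv \<wp> a"
    by (metis mult_left_cancel)
  then show ?thesis by (simp add: algebra_simps)
qed

end

section \<open>The linearised first integral\<close>

text \<open>The symbol \<open>$\<close> also denotes formal power series coefficients; with both meanings active the number
  of parses of the formula in \<open>det_4\<close> explodes.\<close>

no_notation fps_nth (infixl "$" 75)

definition somos5_defect :: "'a::comm_ring_1 \<Rightarrow> 'a \<Rightarrow> (nat \<Rightarrow> 'a) \<Rightarrow> 'a \<Rightarrow> nat \<Rightarrow> 'a" where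
  "somos5_defect \<alpha> \<beta> X J n =
     X n ^ 2 * X (n+3) ^ 2 * X (n+4) + X n * X (n+1) ^ 2 * X (n+4) ^ 2
     + \<alpha> * (X (n+1) ^ 2 * X (n+2) ^ 2 * X (n+4) + X n * X (n+2) ^ 2 * X (n+3) ^ 2)
     + \<beta> * X (n+1) * X (n+2) ^ 3 * X (n+3)
     - X n * X (n+1) * X (n+2) * X (n+3) * X (n+4) * J"

lemma somos5_integral_at_iff: "somos5_integral_at \<alpha> \<beta> X J n \<longleftrightarrow> somos5_defect \<alpha> \<beta> X J n = 0"
  by (auto simp: somos5_integral_at_def somos5_defect_def)

text \<open>A polynomial identity over any commutative ring, so that it applies to the complex
  sequence x and to the dual sequence X alike.\<close>

lemma somos5_defect_step:
  "X n * somos5_defect \<alpha> \<beta> X J (n+1) - X (n+5) * somos5_defect \<alpha> \<beta> X J n =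
     (X (n+1) * X (n+2) ^ 2 * X (n+5) - X n * X (n+3) ^ 2 * X (n+4)) *
     (X n * X (n+5) - \<alpha> * X (n+1) * X (n+4) - \<beta> * X (n+2) * X (n+3))"
proof -
  have idx: "n + 1 + 1 = n + 2" "n + 1 + 2 = n + 3" "n + 1 + 3 = n + 4" "n + 1 + 4 = n + 5" by simp_all
  show ?thesis unfolding somos5_defect_def idx
    by (simp add: algebra_simps power2_eq_square power3_eq_cube del: add_2_eq_Suc')
qed

text \<open>The zero divisors among the dual numbers are the multiples of \<epsilon>; an element
  with nonzero complex part is a unit and can be cancelled.\<close>

lemma dual_mult_eq_0:
  assumes "a * b = 0" "re_dual a \<noteq> 0"
  shows "b = (0::dual)"
  using assms by (cases a; cases b) (auto simp: times_dual_def zero_dual_def)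

lemma dual_power2: "Dual a b ^ 2 = Dual (a ^ 2) (2 * a * b)"
  by (simp add: power2_eq_square times_dual_def)

lemma dual_power3: "Dual a b ^ 3 = Dual (a ^ 3) (3 * a ^ 2 * b)"
  by (simp add: power3_eq_cube power2_eq_square times_dual_def algebra_simps)

lemma dual_somos5_iff:
  "somos5 (Dual \<alpha>0 \<alpha>1) (Dual \<beta>0 \<beta>1) (\<lambda>m. Dual (x m) (y m)) \<longleftrightarrow>
     somos5 \<alpha>0 \<beta>0 x \<and> linear_somos5 \<alpha>0 \<beta>0 \<alpha>1 \<beta>1 x y"
  unfolding somos5_def linear_somos5_def
  by (auto simp: times_dual_def plus_dual_def algebra_simps)

text \<open>The part of the linearised first integral that is linear in the perturbation.\<close>

definition tangent :: "complex \<Rightarrow> complex \<Rightarrow> complex \<Rightarrow> (nat \<Rightarrow> complex) \<Rightarrow> (nat \<Rightarrow> complex) \<Rightarrow> nat \<Rightarrow> complex" where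
  "tangent \<alpha> \<beta> J x y n =
     y n * (2 * x n * x (n+3) ^ 2 * x (n+4) + x (n+1) ^ 2 * x (n+4) ^ 2 + \<alpha> * x (n+2) ^ 2 * x (n+3) ^ 2
            - J * x (n+1) * x (n+2) * x (n+3) * x (n+4))
   + y (n+1) * (2 * x n * x (n+1) * x (n+4) ^ 2 + 2 * \<alpha> * x (n+1) * x (n+2) ^ 2 * x (n+4)
            + \<beta> * x (n+2) ^ 3 * x (n+3) - J * x n * x (n+2) * x (n+3) * x (n+4))
   + y (n+2) * (2 * \<alpha> * x (n+1) ^ 2 * x (n+2) * x (n+4) + 2 * \<alpha> * x n * x (n+2) * x (n+3) ^ 2
            + 3 * \<beta> * x (n+1) * x (n+2) ^ 2 * x (n+3) - J * x n * x (n+1) * x (n+3) * x (n+4))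
   + y (n+3) * (2 * x n ^ 2 * x (n+3) * x (n+4) + 2 * \<alpha> * x n * x (n+2) ^ 2 * x (n+3)
            + \<beta> * x (n+1) * x (n+2) ^ 3 - J * x n * x (n+1) * x (n+2) * x (n+4))
   + y (n+4) * (x n ^ 2 * x (n+3) ^ 2 + 2 * x n * x (n+1) ^ 2 * x (n+4) + \<alpha> * x (n+1) ^ 2 * x (n+2) ^ 2
            - J * x n * x (n+1) * x (n+2) * x (n+3))"

text \<open>The \<epsilon>-part of the defect splits into the terms linear in y, which form
  \<open>tangent\<close>, and the terms carrying \<alpha>1, \<beta>1 or J1, which form
  \<open>F\<close>. The dual first integral thus becomes a fourth-order linear recurrence for y with
  right-hand side - F.\<close>

lemma dual_integral_iff:
  "somos5_integral_at (Dual \<alpha>0 \<alpha>1) (Dual \<beta>0 \<beta>1) (\<lambda>m. Dual (x m) (y m)) (Dual J0 J1) n \<longleftrightarrow>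
     somos5_defect \<alpha>0 \<beta>0 x J0 n = 0 \<and> tangent \<alpha>0 \<beta>0 J0 x y n = - F \<alpha>1 \<beta>1 J1 x n"
proof -
  have "somos5_defect (Dual \<alpha>0 \<alpha>1) (Dual \<beta>0 \<beta>1) (\<lambda>m. Dual (x m) (y m)) (Dual J0 J1) n
      = Dual (somos5_defect \<alpha>0 \<beta>0 x J0 n) (tangent \<alpha>0 \<beta>0 J0 x y n + F \<alpha>1 \<beta>1 J1 x n)"
    unfolding somos5_defect_def tangent_def F_def D_def dual_power2 dual_power3
    by (simp add: times_dual_def plus_dual_def minus_dual_def)
      (simp add: algebra_simps power2_eq_square power3_eq_cube)
  then show ?thesis by (simp add: somos5_integral_at_iff zero_dual_def eq_neg_iff_add_eq_0)
qed

text \<open>The two combinations of \<open>\<psi>\<close> vanish for \<open>\<psi> k = k\<close> and for \<open>\<psi>\<close> depending only on the parity of \<open>k\<close>.\<close>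

lemma tangent_multiple:
  fixes x :: "nat \<Rightarrow> complex"
  defines "\<Phi> \<equiv> \<lambda>n. x (n+1) * x (n+2) ^ 3 * x (n+3)"
  assumes "somos5_defect \<alpha> \<beta> x J n = 0"
  shows "tangent \<alpha> \<beta> J x (\<lambda>k. \<psi> k * x k) n =
     (\<psi> n - \<psi> (n+1) - \<psi> (n+2) + \<psi> (n+3)) *
       (x n ^ 2 * x (n+3) ^ 2 * x (n+4) - \<alpha> * x (n+1) ^ 2 * x (n+2) ^ 2 * x (n+4) - \<beta> * \<Phi> n)
   + (\<psi> (n+1) - \<psi> (n+2) - \<psi> (n+3) + \<psi> (n+4)) *
       (x n * x (n+1) ^ 2 * x (n+4) ^ 2 - \<alpha> * x n * x (n+2) ^ 2 * x (n+3) ^ 2 - \<beta> * \<Phi> n)"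
    (is "_ = ?R")
proof -
  \<comment> \<open>For the perturbation \<psi> x each monomial is multiplied by the sum of \<psi>
    over its factors. Subtracting the sum over all five indices times the defect cancels the
    J-monomial and leaves the others with weights built from two combinations of \<psi>.\<close>
  have "tangent \<alpha> \<beta> J x (\<lambda>k. \<psi> k * x k) n =
      ?R + (\<psi> n + \<psi> (n+1) + \<psi> (n+2) + \<psi> (n+3) + \<psi> (n+4)) * somos5_defect \<alpha> \<beta> x J n"
    unfolding tangent_def somos5_defect_def \<Phi>_def
    by (simp add: algebra_simps power2_eq_square power3_eq_cube)
  with assms show ?thesis by simp
qed

lemma tangent_top_coefficient:
  assumes "somos5_defect \<alpha> \<beta> x J n = 0"
  shows "x (n+4) * (x n ^ 2 * x (n+3) ^ 2 + 2 * x n * x (n+1) ^ 2 * x (n+4) + \<alpha> * x (n+1) ^ 2 * x (n+2) ^ 2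
            - J * x n * x (n+1) * x (n+2) * x (n+3)) = - C4 \<alpha> \<beta> x n"
proof -
  have "x (n+4) * (x n ^ 2 * x (n+3) ^ 2 + 2 * x n * x (n+1) ^ 2 * x (n+4) + \<alpha> * x (n+1) ^ 2 * x (n+2) ^ 2
            - J * x n * x (n+1) * x (n+2) * x (n+3)) = somos5_defect \<alpha> \<beta> x J n - C4 \<alpha> \<beta> x n"
    unfolding somos5_defect_def C4_def
    by (simp add: algebra_simps power2_eq_square power3_eq_cube)
  with assms show ?thesis by simp
qed

text \<open>Serves both directions: it gives the jump of the formula over a combination with frozen
  coefficients, and it shows that four consecutive values and the value of \<open>tangent\<close>
  determine the next one.\<close>

lemma tangent_update:
  assumes defect: "somos5_defect \<alpha> \<beta> x J n = 0" and C: "C4 \<alpha> \<beta> x n \<noteq> 0" and x: "x (n+4) \<noteq> 0"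
    and "y n = y' n" "y (n+1) = y' (n+1)" "y (n+2) = y' (n+2)" "y (n+3) = y' (n+3)"
  shows "tangent \<alpha> \<beta> J x y n = tangent \<alpha> \<beta> J x y' n - (y (n+4) - y' (n+4)) * (C4 \<alpha> \<beta> x n / x (n+4))"
proof -
  define c where "c = x n ^ 2 * x (n+3) ^ 2 + 2 * x n * x (n+1) ^ 2 * x (n+4) + \<alpha> * x (n+1) ^ 2 * x (n+2) ^ 2
            - J * x n * x (n+1) * x (n+2) * x (n+3)"
  have "x (n+4) * c = - C4 \<alpha> \<beta> x n"
    unfolding c_def by (rule tangent_top_coefficient[OF defect])
  then have c: "c = - (C4 \<alpha> \<beta> x n / x (n+4))" using x by (simp add: field_simps)
  have "tangent \<alpha> \<beta> J x y n = tangent \<alpha> \<beta> J x y' n + (y (n+4) - y' (n+4)) * c"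
    unfolding tangent_def c_def[symmetric] using assms(4-) by (simp add: algebra_simps)
  then show ?thesis by (simp add: c)
qed

lemma somos5_defect_Suc:
  assumes "somos5 \<alpha> \<beta> X" "somos5_defect \<alpha> \<beta> X J n = 0"
  shows "X n * somos5_defect \<alpha> \<beta> X J (Suc n) = 0"
proof -
  have R: "X n * X (n+5) - \<alpha> * X (n+1) * X (n+4) - \<beta> * X (n+2) * X (n+3) = 0"
    using assms(1) by (simp only: somos5_def) simp
  show ?thesis
    using somos5_defect_step[of X n \<alpha> \<beta> J]
    unfolding R assms(2) by (simp only: mult_zero_right diff_zero Suc_eq_plus1)
qed

lemma somos5_defect_all:
  fixes x :: "nat \<Rightarrow> complex"
  assumes "somos5 \<alpha> \<beta> x" "\<And>n. x n \<noteq> 0" "somos5_defect \<alpha> \<beta> x J 0 = 0"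
  shows "somos5_defect \<alpha> \<beta> x J n = 0"
proof (induction n)
  case (Suc n)
  show ?case using somos5_defect_Suc[OF assms(1) Suc] assms(2)[of n] by simp
qed (rule assms)

lemma dual_defect_all:
  fixes X :: "nat \<Rightarrow> dual"
  assumes "somos5 \<alpha> \<beta> X" "\<And>n. re_dual (X n) \<noteq> 0" "somos5_defect \<alpha> \<beta> X J 0 = 0"
  shows "somos5_defect \<alpha> \<beta> X J n = 0"
proof (induction n)
  case (Suc n)
  show ?case using somos5_defect_Suc[OF assms(1) Suc] assms(2) by (rule dual_mult_eq_0)
qed (rule assms)

lemma dual_somos5_if_defect:
  fixes X :: "nat \<Rightarrow> dual"
  assumes "\<And>n. somos5_defect \<alpha> \<beta> X J n = 0"
    and "\<And>n. re_dual (X (n+1) * X (n+2) ^ 2 * X (n+5) - X n * X (n+3) ^ 2 * X (n+4)) \<noteq> 0"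
  shows "somos5 \<alpha> \<beta> X"
  unfolding somos5_def
proof
  fix n
  have "X n * X (n+5) - \<alpha> * X (n+1) * X (n+4) - \<beta> * X (n+2) * X (n+3) = 0"
    by (rule dual_mult_eq_0[OF _ assms(2)[of n]])
      (simp only: somos5_defect_step[of X n \<alpha> \<beta> J, symmetric] assms(1) mult_zero_right diff_zero)
  then show "X n * X (n+5) = \<alpha> * X (n+1) * X (n+4) + \<beta> * X (n+2) * X (n+3)"
    by (simp add: algebra_simps)
qed

lemma C4_Suc:
  assumes "somos5 \<alpha> \<beta> x"
  shows "C4 \<alpha> \<beta> x (n+1) = - x (n+5) * (x (n+1) * x (n+2) ^ 2 * x (n+5) - x n * x (n+3) ^ 2 * x (n+4))"
proof -
  have idx: "n + 1 + 1 = n + 2" "n + 1 + 2 = n + 3" "n + 1 + 3 = n + 4" "n + 1 + 4 = n + 5" by simp_all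
  have "C4 \<alpha> \<beta> x (n+1) = x (n+3) ^ 2 * x (n+4) * (\<alpha> * x (n+1) * x (n+4) + \<beta> * x (n+2) * x (n+3))
      - x (n+1) * x (n+2) ^ 2 * x (n+5) ^ 2"
    unfolding C4_def idx by (simp add: algebra_simps power2_eq_square power3_eq_cube)
  also have "\<alpha> * x (n+1) * x (n+4) + \<beta> * x (n+2) * x (n+3) = x n * x (n+5)"
    using assms by (simp add: somos5_def)
  finally show ?thesis by (simp add: algebra_simps power2_eq_square)
qed

section \<open>Determinants and discrete variation of constants\<close>

lemma vector_4 [simp]:
  "(vector [a, b, c, d] :: 'a::zero ^ 4) $ 1 = a"
  "(vector [a, b, c, d] :: 'a::zero ^ 4) $ 2 = b"
  "(vector [a, b, c, d] :: 'a::zero ^ 4) $ 3 = c"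
  "(vector [a, b, c, d] :: 'a::zero ^ 4) $ 4 = d"
  unfolding vector_def by simp_all

text \<open>Expanded along the fourth row, so that the brackets are the minors in
  \<open>signed_minor\<close>.\<close>

lemma det_4:
  "det (A::'a::comm_ring_1^4^4) =
     - A$4$1 * (A$1$2 * (A$2$3 * A$3$4 - A$2$4 * A$3$3) - A$1$3 * (A$2$2 * A$3$4 - A$2$4 * A$3$2)
                + A$1$4 * (A$2$2 * A$3$3 - A$2$3 * A$3$2))
     + A$4$2 * (A$1$1 * (A$2$3 * A$3$4 - A$2$4 * A$3$3) - A$1$3 * (A$2$1 * A$3$4 - A$2$4 * A$3$1)
                + A$1$4 * (A$2$1 * A$3$3 - A$2$3 * A$3$1))
     - A$4$3 * (A$1$1 * (A$2$2 * A$3$4 - A$2$4 * A$3$2) - A$1$2 * (A$2$1 * A$3$4 - A$2$4 * A$3$1)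
                + A$1$4 * (A$2$1 * A$3$2 - A$2$2 * A$3$1))
     + A$4$4 * (A$1$1 * (A$2$2 * A$3$3 - A$2$3 * A$3$2) - A$1$2 * (A$2$1 * A$3$3 - A$2$3 * A$3$1)
                + A$1$3 * (A$2$1 * A$3$2 - A$2$2 * A$3$1))"
proof -
  have f1234: "finite {2::4, 3, 4}" "1 \<notin> {2::4, 3, 4}" by auto
  have f234: "finite {3::4, 4}" "2 \<notin> {3::4, 4}" by auto
  have f34: "finite {4::4}" "3 \<notin> {4::4}" by auto
  show ?thesis
    unfolding det_def UNIV_4
    unfolding sum_over_permutations_insert[OF f1234]
    unfolding sum_over_permutations_insert[OF f234]
    unfolding sum_over_permutations_insert[OF f34]
    unfolding permutes_sing
    by (simp add: sign_swap_id permutation_swap_id permutation_compose sign_compose sign_id swap_id_eq)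
      (simp add: algebra_simps)
qed

text \<open>Laplace expansion along the last row of the matrix in \<open>det4\<close>; in the first
  three sums that row is replaced by a copy of another row, which makes the determinant
  vanish.\<close>

lemma signed_minor_orthogonal:
  "(\<Sum>j\<in>{S1, S2, S3, S4}. signed_minor Y n j * Y j (n+1)) = 0"
  "(\<Sum>j\<in>{S1, S2, S3, S4}. signed_minor Y n j * Y j (n+2)) = 0"
  "(\<Sum>j\<in>{S1, S2, S3, S4}. signed_minor Y n j * Y j (n+3)) = 0"
  "(\<Sum>j\<in>{S1, S2, S3, S4}. signed_minor Y n j * Y j (n+4)) = det4 Y n"
  by (simp_all add: det3_def det4_def det_3 det_4) (simp_all add: algebra_simps)

lemma delta_sum:
  fixes \<alpha>0 \<beta>0 \<alpha>1 \<beta>1 J1 :: complex and x :: "nat \<Rightarrow> complex"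
  assumes "det4 Y n \<noteq> 0"
  defines "\<delta> \<equiv> delta \<alpha>0 \<beta>0 \<alpha>1 \<beta>1 J1 x Y"
  shows "(\<Sum>j\<in>{S1, S2, S3, S4}. \<delta> j n * Y j (n+1)) = 0"
    "(\<Sum>j\<in>{S1, S2, S3, S4}. \<delta> j n * Y j (n+2)) = 0"
    "(\<Sum>j\<in>{S1, S2, S3, S4}. \<delta> j n * Y j (n+3)) = 0"
    "(\<Sum>j\<in>{S1, S2, S3, S4}. \<delta> j n * Y j (n+4)) = x (n+4) * F \<alpha>1 \<beta>1 J1 x n / C4 \<alpha>0 \<beta>0 x n"
proof -
  define K where "K = x (n+4) * F \<alpha>1 \<beta>1 J1 x n / C4 \<alpha>0 \<beta>0 x n"
  have \<delta>: "\<delta> j n = (K * inverse (det4 Y n)) * signed_minor Y n j" for j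
    by (simp add: \<delta>_def delta_def K_def)
  have *: "(\<Sum>j\<in>{S1, S2, S3, S4}. \<delta> j n * Y j i)
      = (K * inverse (det4 Y n)) * (\<Sum>j\<in>{S1, S2, S3, S4}. signed_minor Y n j * Y j i)" for i
    unfolding \<delta> sum_distrib_left by (simp only: mult.assoc)
  show "(\<Sum>j\<in>{S1, S2, S3, S4}. \<delta> j n * Y j (n+1)) = 0"
    "(\<Sum>j\<in>{S1, S2, S3, S4}. \<delta> j n * Y j (n+2)) = 0"
    "(\<Sum>j\<in>{S1, S2, S3, S4}. \<delta> j n * Y j (n+3)) = 0"
    unfolding * signed_minor_orthogonal by simp_all
  show "(\<Sum>j\<in>{S1, S2, S3, S4}. \<delta> j n * Y j (n+4)) = x (n+4) * F \<alpha>1 \<beta>1 J1 x n / C4 \<alpha>0 \<beta>0 x n"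
    unfolding * signed_minor_orthogonal using assms by (simp add: K_def)
qed

text \<open>Lagrange's condition in discrete form: each increment is orthogonal to the next three
  rows, so on n, ..., n+3 the coefficients may be frozen at n, and the increment at n first shows at
  n+4.\<close>

lemma solution_formula_values:
  fixes \<alpha>0 \<beta>0 \<alpha>1 \<beta>1 J1 :: complex and x :: "nat \<Rightarrow> complex" and f0 :: "shadow_index \<Rightarrow> complex"
  assumes det: "\<And>n. det4 Y n \<noteq> 0"
  defines "y \<equiv> solution_formula \<alpha>0 \<beta>0 \<alpha>1 \<beta>1 J1 x Y f0"
    and "f \<equiv> coefficient \<alpha>0 \<beta>0 \<alpha>1 \<beta>1 J1 x Y f0"
  shows "y n = (\<Sum>j\<in>{S1, S2, S3, S4}. f j n * Y j n)"
    "y (n+1) = (\<Sum>j\<in>{S1, S2, S3, S4}. f j n * Y j (n+1))"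
    "y (n+2) = (\<Sum>j\<in>{S1, S2, S3, S4}. f j n * Y j (n+2))"
    "y (n+3) = (\<Sum>j\<in>{S1, S2, S3, S4}. f j n * Y j (n+3))"
    "y (n+4) = (\<Sum>j\<in>{S1, S2, S3, S4}. f j n * Y j (n+4)) + x (n+4) * F \<alpha>1 \<beta>1 J1 x n / C4 \<alpha>0 \<beta>0 x n"
proof -
  define \<delta> where "\<delta> = delta \<alpha>0 \<beta>0 \<alpha>1 \<beta>1 J1 x Y"
  have y: "y i = (\<Sum>j\<in>{S1, S2, S3, S4}. f j i * Y j i)" for i
    unfolding y_def f_def solution_formula_def ..
  have Suc: "f j (Suc i) = f j i + \<delta> j i" for j i
    by (simp add: f_def coefficient_def \<delta>_def)
  have step: "(\<Sum>j\<in>{S1, S2, S3, S4}. f j (Suc i) * Y j k)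
      = (\<Sum>j\<in>{S1, S2, S3, S4}. f j i * Y j k) + (\<Sum>j\<in>{S1, S2, S3, S4}. \<delta> j i * Y j k)" for i k
    unfolding Suc by (simp only: distrib_right sum.distrib)
  have d: "(\<Sum>j\<in>{S1, S2, S3, S4}. \<delta> j i * Y j (i+1)) = 0"
    "(\<Sum>j\<in>{S1, S2, S3, S4}. \<delta> j i * Y j (i+2)) = 0"
    "(\<Sum>j\<in>{S1, S2, S3, S4}. \<delta> j i * Y j (i+3)) = 0"
    "(\<Sum>j\<in>{S1, S2, S3, S4}. \<delta> j i * Y j (i+4)) = x (i+4) * F \<alpha>1 \<beta>1 J1 x i / C4 \<alpha>0 \<beta>0 x i" for i
    unfolding \<delta>_def by (rule delta_sum[OF det])+
  show "y n = (\<Sum>j\<in>{S1, S2, S3, S4}. f j n * Y j n)" by (rule y)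
  show "y (n+1) = (\<Sum>j\<in>{S1, S2, S3, S4}. f j n * Y j (n+1))"
    using y[of "n+1"] step[of n "n+1"] d(1)[of n] by simp
  show "y (n+2) = (\<Sum>j\<in>{S1, S2, S3, S4}. f j n * Y j (n+2))"
    using y[of "n+2"] step[of "n+1" "n+2"] step[of n "n+2"] d(1)[of "n+1"] d(2)[of n]
    by (simp del: sum.insert)
  show "y (n+3) = (\<Sum>j\<in>{S1, S2, S3, S4}. f j n * Y j (n+3))"
    using y[of "n+3"] step[of "n+2" "n+3"] step[of "n+1" "n+3"] step[of n "n+3"]
      d(1)[of "n+2"] d(2)[of "n+1"] d(3)[of n]
    by (simp del: sum.insert add: numeral_3_eq_3)
  show "y (n+4) = (\<Sum>j\<in>{S1, S2, S3, S4}. f j n * Y j (n+4)) + x (n+4) * F \<alpha>1 \<beta>1 J1 x n / C4 \<alpha>0 \<beta>0 x n"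
    using y[of "n+4"] step[of "n+3" "n+4"] step[of "n+2" "n+4"] step[of "n+1" "n+4"] step[of n "n+4"]
      d(1)[of "n+3"] d(2)[of "n+2"] d(3)[of "n+1"] d(4)[of n]
    by (simp del: sum.insert add: eval_nat_numeral)
qed

lemma det4_solve:
  assumes "det4 Y n \<noteq> 0"
  shows "\<exists>f. \<forall>k\<in>{1, 2, 3, 4}. (\<Sum>j\<in>{S1, S2, S3, S4}. f j * Y j (n+k)) = b k"
proof -
  define M :: "complex ^ 4 ^ 4" where "M = vector
     [vector [Y S1 (n+1), Y S2 (n+1), Y S3 (n+1), Y S4 (n+1)],
      vector [Y S1 (n+2), Y S2 (n+2), Y S3 (n+2), Y S4 (n+2)],
      vector [Y S1 (n+3), Y S2 (n+3), Y S3 (n+3), Y S4 (n+3)],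
      vector [Y S1 (n+4), Y S2 (n+4), Y S3 (n+4), Y S4 (n+4)]]"
  have "invertible M" using assms by (simp add: invertible_det_nz det4_def M_def)
  then obtain N where "M ** N = mat 1" unfolding invertible_def by blast
  then have "M *v (N *v vector [b 1, b 2, b 3, b 4]) = vector [b 1, b 2, b 3, b 4]"
    by (simp add: matrix_vector_mul_assoc)
  then obtain w where "M *v w = vector [b 1, b 2, b 3, b 4]" by blast
  then have w: "(M *v w) $ i = vector [b 1, b 2, b 3, b 4] $ i" for i by simp
  define f where "f j = (case j of S1 \<Rightarrow> w $ 1 | S2 \<Rightarrow> w $ 2 | S3 \<Rightarrow> w $ 3 | S4 \<Rightarrow> w $ 4)" for j
  have "\<forall>k\<in>{1, 2, 3, 4}. (\<Sum>j\<in>{S1, S2, S3, S4}. f j * Y j (n+k)) = b k"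
    using w[of 1] w[of 2] w[of 3] w[of 4]
    by (simp add: M_def matrix_vector_mult_def sum_4 f_def mult_ac add_ac)
  then show ?thesis by blast
qed

lemma tangent_combination:
  "tangent \<alpha> \<beta> J x (\<lambda>k. \<Sum>j\<in>A. f j * Y j k) n = (\<Sum>j\<in>A. f j * tangent \<alpha> \<beta> J x (Y j) n)"
  unfolding tangent_def
  by (simp add: sum_distrib_right sum_distrib_left distrib_left sum.distrib mult_ac)

text \<open>With the d's read as derivatives of the v's, s' and t' are the derivatives of s and t.
  The left-hand side times t is s' t (t + \<alpha>) - (\<alpha> s + \<beta>) t', which is t^2 times
  the derivative of s + (\<alpha> s + \<beta>) / t: the first integral does not change under an
  infinitesimal shift.\<close>

lemma shadow_algebra:
  fixes v1 v2 v3 d1 d2 d3 \<alpha> \<beta> J m :: complex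
  assumes nz: "v1 \<noteq> 0" "v2 \<noteq> 0" "v3 \<noteq> 0"
    and S: "v2 ^ 2 * (v3 + v1) - J * v2 = m ^ 2"
    and S': "2 * v2 * d2 * (v3 + v1) + v2 ^ 2 * (d3 + d1) - J * d2 = 0"
    and P: "v2 ^ 2 * (v3 * v1) + m ^ 2 * v2 = - \<alpha>"
    and P': "2 * v2 * d2 * (v3 * v1) + v2 ^ 2 * (d3 * v1 + v3 * d1) + m ^ 2 * d2 = 0"
    and \<beta>: "m ^ 4 = \<beta> + \<alpha> * J"
  shows "(d1 / v1 + d2 / v2) * (v1 ^ 2 * v2 ^ 3 * v3 - \<alpha> * v2 * v3 - \<beta>)
       + (d2 / v2 + d3 / v3) * (v1 * v2 ^ 3 * v3 ^ 2 - \<alpha> * v1 * v2 - \<beta>) = 0"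
proof -
  define s t s' t' where "s = v1 * v2 + v2 * v3" and "t = v1 * v2 ^ 2 * v3"
    and "s' = d1 * v2 + v1 * d2 + d2 * v3 + v2 * d3"
    and "t' = 2 * v2 * d2 * (v3 * v1) + v2 ^ 2 * (d3 * v1 + v3 * d1)"
  have 1: "s * v2 = J * v2 + m ^ 2" using S by (simp add: s_def algebra_simps power2_eq_square)
  have 2: "s' * v2 = (J - s) * d2" using S' by (simp add: s_def s'_def algebra_simps power2_eq_square)
  have 3: "m ^ 2 * v2 = - (t + \<alpha>)" using P by (simp add: t_def algebra_simps add_eq_0_iff)
  have 4: "t' = - (m ^ 2 * d2)" using P' by (simp add: t'_def add_eq_0_iff)
  \<comment> \<open>Both sides of s' t (t + \<alpha>) = (\<alpha> s + \<beta>) t', multiplied by v2,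
    reduce to m^4 d2 t.\<close>
  have "v2 * (s' * (t * (t + \<alpha>))) = (J - s) * d2 * t * (t + \<alpha>)"
    using 2 by (simp add: mult_ac)
  also have "\<dots> = (J - s) * d2 * t * (- (m ^ 2 * v2))" by (simp add: 3)
  also have "\<dots> = m ^ 2 * d2 * t * (s * v2 - J * v2)" by (simp add: algebra_simps)
  also have "\<dots> = m ^ 4 * d2 * t" by (simp add: 1 power2_eq_square power4_eq_xxxx)
  finally have L: "v2 * (s' * (t * (t + \<alpha>))) = m ^ 4 * d2 * t" .
  have "v2 * ((\<alpha> * s + \<beta>) * t') = - (m ^ 2 * d2 * (\<alpha> * (s * v2) + \<beta> * v2))"
    by (simp add: 4 algebra_simps)
  also have "\<alpha> * (s * v2) + \<beta> * v2 = m ^ 4 * v2 + \<alpha> * m ^ 2" by (simp add: 1 \<beta> algebra_simps)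
  also have "\<dots> = m ^ 2 * (m ^ 2 * v2 + \<alpha>)" by (simp add: algebra_simps power2_eq_square power4_eq_xxxx)
  also have "m ^ 2 * v2 + \<alpha> = - t" by (simp add: 3)
  also have "- (m ^ 2 * d2 * (m ^ 2 * - t)) = m ^ 4 * d2 * t"
    by (simp add: power2_eq_square power4_eq_xxxx)
  finally have "v2 * (s' * (t * (t + \<alpha>))) = v2 * ((\<alpha> * s + \<beta>) * t')" using L by simp
  then have eq: "s' * (t * (t + \<alpha>)) = (\<alpha> * s + \<beta>) * t'" using nz by simp
  have "(d1 / v1 + d2 / v2) * (v1 * v2) = d1 * v2 + v1 * d2"
    "(d2 / v2 + d3 / v3) * (v2 * v3) = d2 * v3 + v2 * d3"
    using nz by (simp_all add: field_simps)
  then have q: "(d1 / v1 + d2 / v2) = (d1 * v2 + v1 * d2) / (v1 * v2)"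
    "(d2 / v2 + d3 / v3) = (d2 * v3 + v2 * d3) / (v2 * v3)"
    using nz by (simp_all add: field_simps)
  have "t * ((d1 / v1 + d2 / v2) * (v1 ^ 2 * v2 ^ 3 * v3 - \<alpha> * v2 * v3 - \<beta>)
       + (d2 / v2 + d3 / v3) * (v1 * v2 ^ 3 * v3 ^ 2 - \<alpha> * v1 * v2 - \<beta>))
      = (d1 * v2 + v1 * d2) * (v2 * v3) * (v1 ^ 2 * v2 ^ 3 * v3 - \<alpha> * v2 * v3 - \<beta>)
       + (d2 * v3 + v2 * d3) * (v1 * v2) * (v1 * v2 ^ 3 * v3 ^ 2 - \<alpha> * v1 * v2 - \<beta>)"
    unfolding q t_def distrib_left using nz by (simp add: power2_eq_square mult_ac)
  also have "\<dots> = s' * (t * (t + \<alpha>)) - (\<alpha> * s + \<beta>) * t'"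
    unfolding s_def t_def s'_def t'_def by (simp add: algebra_simps power2_eq_square power3_eq_cube)
  finally show ?thesis using eq nz by (simp add: t_def)
qed

section \<open>The shadow sequences\<close>

text \<open>In terms of s and t the hypothesis \<open>zero\<close> is (t + \<alpha>) s + \<beta> - J
  t = 0; multiplied by v2 and reduced with the other relations it collapses to m^2 (c + \<alpha>) =
  0. This identifies the constant m^2 v(2 \<kappa>) of \<open>product_relation\<close> with -
  \<alpha>.\<close>

lemma product_constant:
  fixes v1 v2 v3 \<alpha> \<beta> J m c :: complex
  assumes "m \<noteq> 0"
    and S: "v2 ^ 2 * (v3 + v1) - J * v2 = m ^ 2"
    and P: "v2 ^ 2 * (v3 * v1) + m ^ 2 * v2 = c"
    and \<beta>: "m ^ 4 = \<beta> + \<alpha> * J"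
    and zero: "v1 ^ 2 * v2 ^ 3 * v3 + v1 * v2 ^ 3 * v3 ^ 2 + \<alpha> * (v2 * v3 + v1 * v2) + \<beta>
               - J * (v1 * v2 ^ 2 * v3) = 0"
  shows "c = - \<alpha>"
proof -
  define s t where "s = v1 * v2 + v2 * v3" and "t = v1 * v2 ^ 2 * v3"
  have 1: "s * v2 = J * v2 + m ^ 2" using S by (simp add: s_def algebra_simps power2_eq_square)
  have 2: "t = c - m ^ 2 * v2" using P by (simp add: t_def algebra_simps)
  have "(t + \<alpha>) * s + \<beta> - J * t = 0"
    using zero by (simp add: s_def t_def algebra_simps power2_eq_square power3_eq_cube)
  then have "0 = v2 * ((t + \<alpha>) * s + \<beta> - J * t)" by simp
  also have "\<dots> = (t + \<alpha>) * (s * v2) + \<beta> * v2 - J * t * v2" by (simp add: algebra_simps)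
  also have "\<dots> = m ^ 2 * (t + \<alpha>) + (\<beta> + \<alpha> * J) * v2" unfolding 1 by (simp add: algebra_simps)
  also have "\<dots> = m ^ 2 * (c + \<alpha>)"
    unfolding \<beta>[symmetric] 2 by (simp add: algebra_simps power2_eq_square power4_eq_xxxx)
  finally show ?thesis using assms(1) by (simp add: eq_neg_iff_add_eq_0)
qed

text \<open>For even n the identity reduces to \<open>Bp = s ^ 4 * Bm\<close>. For n = 2k+1 the
  exponents satisfy k^2 + (k+2)^2 = 2 (k+1)^2 + 2, and the surplus \<mu>^2 s^8 equals 1. With s =
  \<sigma>(\<kappa>) this absorbs the factor \<sigma>(\<kappa>)^4 of
  \<open>sigma_step\<close>.\<close>

lemma prefactor_relation:
  fixes Ap Am Bp Bm \<mu> s :: complex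
  assumes s: "s \<noteq> 0" and \<mu>: "\<mu> = - (1 / s ^ 4)" and B: "Bp = s ^ 4 * Bm"
  defines "c \<equiv> \<lambda>n::nat. (if even n then Ap else Am) * (if even n then Bp else Bm) ^ (n div 2)
                        * \<mu> ^ ((n div 2) ^ 2)"
  shows "c n * c (n+3) * s ^ 4 = c (n+1) * c (n+2)"
proof (cases "even n")
  case True
  then obtain k where n: "n = 2 * k" by blast
  have "(2 * k + 3) div 2 = Suc k" "(2 * k + 2) div 2 = Suc k" "(2 * k + 1) div 2 = k" by auto
  then show ?thesis by (simp add: c_def n B mult_ac)
next
  case False
  then obtain k where n: "n = 2 * k + 1" by (blast elim: oddE)
  have div: "(2 * k + 1 + 3) div 2 = k + 2" "(2 * k + 1 + 2) div 2 = k + 1" "(2 * k + 1 + 1) div 2 = k + 1"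
    "(2 * k + 1) div 2 = k" by auto
  have \<mu>_power: "\<mu> ^ (k ^ 2) * \<mu> ^ ((k + 2) ^ 2) = \<mu> ^ ((k + 1) ^ 2) * \<mu> ^ ((k + 1) ^ 2) * \<mu> ^ 2"
    unfolding power_add[symmetric] by (rule arg_cong[where f = "power \<mu>"]) (simp add: power2_eq_square)
  have \<mu>_s: "\<mu> ^ 2 * (s ^ 4 * s ^ 4) = 1" using s by (simp add: \<mu> power2_eq_square)
  have Bp_power: "Bp ^ (k + 2) = Bp ^ (k + 1) * (s ^ 4 * Bm)" by (simp add: B)
  have "c n * c (n+3) * s ^ 4
      = Am * Ap * Bm ^ k * Bp ^ (k + 2) * (\<mu> ^ (k ^ 2) * \<mu> ^ ((k + 2) ^ 2)) * s ^ 4"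
    unfolding c_def n div by (simp add: mult_ac)
  also have "\<dots> = Am * Ap * Bm ^ k * (Bp ^ (k + 1) * Bm)
      * (\<mu> ^ ((k + 1) ^ 2) * \<mu> ^ ((k + 1) ^ 2)) * (\<mu> ^ 2 * (s ^ 4 * s ^ 4))"
    unfolding \<mu>_power Bp_power by (simp only: mult_ac)
  finally show ?thesis unfolding \<mu>_s c_def n div by (simp add: mult_ac)
qed

context lattice_point
begin

lemma v_nonzero:
  assumes "a \<notin> poles"
  shows "v a \<noteq> 0"
  using sigma_addition[OF kappa, of a] assms by (auto simp: v_def mem_poles sigma_eq_0_iff)

text \<open>Relative to the \<beta>-monomial \<open>W\<close>, every term of the linearised integral
  is a monomial in three consecutive values of v, so the claim becomes
  \<open>shadow_algebra\<close>. Here \<open>J\<close> is \<wp>''(\<kappa>); its agreement with the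
  value of the first integral is the content of the hypothesis \<open>defect\<close>.\<close>

lemma zeta_shadow_tangent:
  fixes x :: "nat \<Rightarrow> complex" and z0 :: complex
  defines "pt \<equiv> \<lambda>n. z0 + of_nat n * \<kappa>"
  assumes off: "\<And>n. pt n \<notin> \<Lambda>" and x0: "\<And>n. x n \<noteq> 0"
    and x: "\<And>n. x n * x (n+3) = x (n+1) * x (n+2) * (v (pt (n+1)) * v (pt (n+2)))"
    and defect: "\<And>n. somos5_defect \<alpha> \<beta> x J n = 0" and \<beta>: "m ^ 4 = \<beta> + \<alpha> * J"
  shows "tangent \<alpha> \<beta> J x (\<lambda>k. \<zeta> (pt k) * x k) n = 0"
proof -
  have pt: "pt (Suc i) + \<kappa> = pt (Suc (Suc i))" "pt (Suc i) - \<kappa> = pt i" for i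
    by (simp_all add: pt_def algebra_simps)
  have poles: "pt (Suc i) \<notin> poles" for i
    using off by (simp add: mem_poles pt)
  define v1 v2 v3 where "v1 = v (pt (n+1))" and "v2 = v (pt (n+2))" and "v3 = v (pt (n+3))"
  define d1 d2 d3 where "d1 = deriv \<wp> (pt (n+1))" and "d2 = deriv \<wp> (pt (n+2))"
    and "d3 = deriv \<wp> (pt (n+3))"
  have idx: "n + 1 = Suc n" "n + 2 = Suc (Suc n)" "n + 3 = Suc (Suc (Suc n))"
    "n + 4 = Suc (Suc (Suc (Suc n)))" by simp_all
  have nz: "v1 \<noteq> 0" "v2 \<noteq> 0" "v3 \<noteq> 0"
    unfolding v1_def v2_def v3_def idx by (intro v_nonzero poles)+
  have x03: "x n * x (n+3) = x (n+1) * x (n+2) * (v1 * v2)"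
    using x[of n] by (simp add: v1_def v2_def)
  have x14: "x (n+1) * x (n+4) = x (n+2) * x (n+3) * (v2 * v3)"
    using x[of "n+1"] by (simp add: v2_def v3_def idx)
  define W where "W = x (n+1) * x (n+2) ^ 3 * x (n+3)"
  have W: "W \<noteq> 0" using x0 by (simp add: W_def)
  have m1: "x n ^ 2 * x (n+3) ^ 2 * x (n+4) = W * (v1 ^ 2 * v2 ^ 3 * v3)"
  proof -
    have "x n ^ 2 * x (n+3) ^ 2 * x (n+4) = (x n * x (n+3)) ^ 2 * x (n+4)"
      by (simp add: power_mult_distrib)
    also have "\<dots> = (x (n+1) * x (n+4)) * x (n+1) * x (n+2) ^ 2 * (v1 * v2) ^ 2"
      unfolding x03 by (simp add: power2_eq_square mult_ac)
    also have "\<dots> = W * (v1 ^ 2 * v2 ^ 3 * v3)"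
      unfolding x14 W_def by (simp add: power2_eq_square power3_eq_cube mult_ac)
    finally show ?thesis .
  qed
  have m2: "x n * x (n+1) ^ 2 * x (n+4) ^ 2 = W * (v1 * v2 ^ 3 * v3 ^ 2)"
  proof -
    have "x n * x (n+1) ^ 2 * x (n+4) ^ 2 = (x (n+1) * x (n+4)) ^ 2 * x n"
      by (simp add: power_mult_distrib)
    also have "\<dots> = (x n * x (n+3)) * x (n+3) * x (n+2) ^ 2 * (v2 * v3) ^ 2"
      unfolding x14 by (simp add: power2_eq_square mult_ac)
    also have "\<dots> = W * (v1 * v2 ^ 3 * v3 ^ 2)"
      unfolding x03 W_def by (simp add: power2_eq_square power3_eq_cube mult_ac)
    finally show ?thesis .
  qed
  have m3: "x (n+1) ^ 2 * x (n+2) ^ 2 * x (n+4) = W * (v2 * v3)"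
  proof -
    have "x (n+1) ^ 2 * x (n+2) ^ 2 * x (n+4) = (x (n+1) * x (n+4)) * x (n+1) * x (n+2) ^ 2"
      by (simp add: power2_eq_square mult_ac)
    then show ?thesis unfolding x14 W_def by (simp add: power2_eq_square power3_eq_cube mult_ac)
  qed
  have m4: "x n * x (n+2) ^ 2 * x (n+3) ^ 2 = W * (v1 * v2)"
  proof -
    have "x n * x (n+2) ^ 2 * x (n+3) ^ 2 = (x n * x (n+3)) * x (n+3) * x (n+2) ^ 2"
      by (simp add: power2_eq_square mult_ac)
    then show ?thesis unfolding x03 W_def by (simp add: power2_eq_square power3_eq_cube mult_ac)
  qed
  have m5: "x n * x (n+1) * x (n+2) * x (n+3) * x (n+4) = W * (v1 * v2 ^ 2 * v3)"
  proof -
    have "x n * x (n+1) * x (n+2) * x (n+3) * x (n+4) = (x n * x (n+3)) * (x (n+1) * x (n+4)) * x (n+2)"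
      by (simp add: mult_ac)
    then show ?thesis unfolding x03 x14 W_def by (simp add: power2_eq_square power3_eq_cube mult_ac)
  qed
  have S: "v2 ^ 2 * (v3 + v1) - J * v2 = m ^ 2"
    using sum_relation[OF poles[of "Suc n"]] by (simp add: v1_def v2_def v3_def pt idx)
  have P: "v2 ^ 2 * (v3 * v1) + m ^ 2 * v2 = m ^ 2 * v (\<kappa> + \<kappa>)"
    using product_relation[OF poles[of "Suc n"]] by (simp add: v1_def v2_def v3_def pt idx)
  have "0 = W * (v1 ^ 2 * v2 ^ 3 * v3 + v1 * v2 ^ 3 * v3 ^ 2 + \<alpha> * (v2 * v3 + v1 * v2) + \<beta>
      - J * (v1 * v2 ^ 2 * v3))"
    using defect[of n] unfolding somos5_defect_def m1 m2 m3 m4 m5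
    by (simp add: W_def algebra_simps)
  with W have "v1 ^ 2 * v2 ^ 3 * v3 + v1 * v2 ^ 3 * v3 ^ 2 + \<alpha> * (v2 * v3 + v1 * v2) + \<beta>
      - J * (v1 * v2 ^ 2 * v3) = 0" by simp
  then have c: "m ^ 2 * v (\<kappa> + \<kappa>) = - \<alpha>"
    by (rule product_constant[OF deriv_wp_kappa S P \<beta>])
  have "2 * v2 * d2 * (v3 + v1) + v2 ^ 2 * (d3 + d1) - J * d2 = 0"
    "2 * v2 * d2 * (v3 * v1) + v2 ^ 2 * (d3 * v1 + v3 * d1) + m ^ 2 * d2 = 0"
    using derivative_relations[OF poles[of "Suc n"]]
    by (simp_all add: v1_def v2_def v3_def d1_def d2_def d3_def pt idx)
  from shadow_algebra[OF nz S this(1) P[unfolded c] this(2) \<beta>]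
  have alg: "(d1 / v1 + d2 / v2) * (v1 ^ 2 * v2 ^ 3 * v3 - \<alpha> * v2 * v3 - \<beta>)
       + (d2 / v2 + d3 / v3) * (v1 * v2 ^ 3 * v3 ^ 2 - \<alpha> * v1 * v2 - \<beta>) = 0" .
  have \<zeta>: "\<zeta> (pt (Suc (Suc i))) + \<zeta> (pt i) - 2 * \<zeta> (pt (Suc i)) = deriv \<wp> (pt (Suc i)) / v (pt (Suc i))" for i
    using zeta_second_difference[OF poles[of i]] v_nonzero[OF poles[of i]]
    unfolding pt by (simp add: nonzero_eq_divide_eq mult.commute)
  \<comment> \<open>Each weight from \<open>tangent_multiple\<close> is a sum of two adjacent second
    differences of \<zeta>.\<close>
  have q: "\<zeta> (pt n) - \<zeta> (pt (n+1)) - \<zeta> (pt (n+2)) + \<zeta> (pt (n+3)) = d1 / v1 + d2 / v2"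
    "\<zeta> (pt (n+1)) - \<zeta> (pt (n+2)) - \<zeta> (pt (n+3)) + \<zeta> (pt (n+4)) = d2 / v2 + d3 / v3"
    unfolding d1_def d2_def d3_def v1_def v2_def v3_def idx \<zeta>[symmetric] by simp_all
  have "tangent \<alpha> \<beta> J x (\<lambda>k. \<zeta> (pt k) * x k) n =
      (d1 / v1 + d2 / v2) * (W * (v1 ^ 2 * v2 ^ 3 * v3) - \<alpha> * (W * (v2 * v3)) - \<beta> * W)
       + (d2 / v2 + d3 / v3) * (W * (v1 * v2 ^ 3 * v3 ^ 2) - \<alpha> * (W * (v1 * v2)) - \<beta> * W)"
    unfolding tangent_multiple[OF defect[of n]] q m1 m2 m3[symmetric] m4[symmetric] W_def[symmetric]
    by (simp only: mult.assoc)
  also have "\<dots> = W * ((d1 / v1 + d2 / v2) * (v1 ^ 2 * v2 ^ 3 * v3 - \<alpha> * v2 * v3 - \<beta>)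
       + (d2 / v2 + d3 / v3) * (v1 * v2 ^ 3 * v3 ^ 2 - \<alpha> * v1 * v2 - \<beta>))"
    by (simp only: distrib_left right_diff_distrib mult_ac)
  finally show ?thesis unfolding alg by simp
qed

text \<open>The addition formula at a times the one at a + \<kappa>, with the common nonzero factor
  \<sigma>(a) \<sigma>(a + \<kappa>) cancelled.\<close>

lemma sigma_step:
  assumes "a \<notin> \<Lambda>" "a + \<kappa> \<notin> \<Lambda>"
  shows "\<sigma> (a - \<kappa>) * \<sigma> (a + 2 * \<kappa>) = \<sigma> a * \<sigma> (a + \<kappa>) * (\<sigma> \<kappa> ^ 4 * (v a * v (a + \<kappa>)))"
proof -
  have "\<sigma> (a + \<kappa>) * \<sigma> (a - \<kappa>) = - (\<sigma> a ^ 2 * \<sigma> \<kappa> ^ 2 * v a)"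
    using sigma_addition[OF kappa assms(1)] by (simp add: v_def)
  moreover have "\<sigma> (a + 2 * \<kappa>) * \<sigma> a = - (\<sigma> (a + \<kappa>) ^ 2 * \<sigma> \<kappa> ^ 2 * v (a + \<kappa>))"
    using sigma_addition[OF kappa assms(2)] by (simp add: v_def algebra_simps)
  ultimately have "(\<sigma> (a + \<kappa>) * \<sigma> (a - \<kappa>)) * (\<sigma> (a + 2 * \<kappa>) * \<sigma> a)
      = (\<sigma> a ^ 2 * \<sigma> \<kappa> ^ 2 * v a) * (\<sigma> (a + \<kappa>) ^ 2 * \<sigma> \<kappa> ^ 2 * v (a + \<kappa>))"
    by (simp only: minus_mult_minus)
  then have "(\<sigma> a * \<sigma> (a + \<kappa>)) * (\<sigma> (a - \<kappa>) * \<sigma> (a + 2 * \<kappa>))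
      = (\<sigma> a * \<sigma> (a + \<kappa>)) * (\<sigma> a * \<sigma> (a + \<kappa>) * (\<sigma> \<kappa> ^ 4 * (v a * v (a + \<kappa>))))"
    by (simp only: power2_eq_square power4_eq_xxxx mult_ac)
  then show ?thesis using assms by (simp add: sigma_eq_0_iff)
qed

end

theorem theorem4p5:
  fixes \<alpha>0 \<beta>0 \<alpha>1 \<beta>1 J0 :: complex
    and x :: "nat \<Rightarrow> complex"
    and \<omega>1 \<omega>2 lam mut \<kappa> z0 \<mu> Ap Am Bp Bm :: complex
    and \<Lambda> :: "complex set"
    and Y :: "shadow_index \<Rightarrow> nat \<Rightarrow> complex"
  assumes somos: "somos5 \<alpha>0 \<beta>0 x"
    and x_nonzero: "\<And>n. x n \<noteq> 0"
    and J0: "somos5_integral_at \<alpha>0 \<beta>0 x J0 0"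
    and mut: "mut ^ 4 = \<beta>0 + \<alpha>0 * J0" "mut \<noteq> 0"
    and lam: "lam = 1 / (3 * mut ^ 2) * (J0 ^ 2 / 4 + \<alpha>0)"
    and lattice: "\<Lambda> = period_lattice \<omega>1 \<omega>2" "Im (\<omega>2 / \<omega>1) \<noteq> 0"
    and g2: "invariant_g2 \<Lambda> = 12 * lam ^ 2 - 2 * J0"
    and g3: "invariant_g3 \<Lambda> = 4 * lam ^ 3 - invariant_g2 \<Lambda> * lam - mut ^ 2"
    and \<kappa>: "\<kappa> \<notin> \<Lambda>" "weierstrass_wp \<Lambda> \<kappa> = lam" "deriv (weierstrass_wp \<Lambda>) \<kappa> = mut"
    and \<mu>: "\<mu> = - (1 / weierstrass_sigma \<Lambda> \<kappa> ^ 4)"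
    and B: "Bp = weierstrass_sigma \<Lambda> \<kappa> ^ 4 * Bm"
    and x_form: "\<And>n. x n = (if even n then Ap else Am) * (if even n then Bp else Bm) ^ (n div 2)
                        * \<mu> ^ ((n div 2) ^ 2) * weierstrass_sigma \<Lambda> (of_nat n * \<kappa> + z0)"
    and Y: "Y = shadow \<Lambda> \<kappa> z0 x"
    and C4_nonzero: "\<And>n. C4 \<alpha>0 \<beta>0 x n \<noteq> 0"
    and det4_nonzero: "\<And>n. det4 Y n \<noteq> 0"
  shows "(\<forall>J1 f0. let y = solution_formula \<alpha>0 \<beta>0 \<alpha>1 \<beta>1 J1 x Y f0 in
            linear_somos5 \<alpha>0 \<beta>0 \<alpha>1 \<beta>1 x y \<and>
            (\<forall>n. somos5_integral_at (Dual \<alpha>0 \<alpha>1) (Dual \<beta>0 \<beta>1)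
                   (\<lambda>m. Dual (x m) (y m)) (Dual J0 J1) n))
       \<and> (\<forall>y. linear_somos5 \<alpha>0 \<beta>0 \<alpha>1 \<beta>1 x y \<longrightarrow>
            (\<exists>J1 f0. y = solution_formula \<alpha>0 \<beta>0 \<alpha>1 \<beta>1 J1 x Y f0))"
proof -
  interpret lattice_point \<omega>1 \<omega>2 \<Lambda> \<kappa>
    by unfold_locales (use lattice \<kappa> mut(2) in simp_all)
  \<comment> \<open>At \<kappa> the differential equation gives 6 lam^2 - (6 lam^2 - J0): the value
    of g2 is what makes \<wp>''(\<kappa>) the first integral.\<close>
  have J: "deriv (deriv (weierstrass_wp \<Lambda>)) \<kappa> = J0"
    using wp_differential_equation[OF \<kappa>(1)] unfolding \<kappa>(2) g2 by (simp add: field_simps)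
  have defect: "somos5_defect \<alpha>0 \<beta>0 x J0 n = 0" for n
    using somos x_nonzero J0 unfolding somos5_integral_at_iff by (rule somos5_defect_all)
  define pt where "pt = (\<lambda>n. z0 + of_nat n * \<kappa>)"
  \<comment> \<open>A zero of \<sigma> would make x n vanish, so no sampled point is a pole of
    \<zeta> or \<wp>.\<close>
  have off: "pt n \<notin> \<Lambda>" for n
  proof
    assume "pt n \<in> \<Lambda>"
    then have "weierstrass_sigma \<Lambda> (of_nat n * \<kappa> + z0) = 0"
      by (simp add: sigma_eq_0_iff pt_def add.commute)
    then show False using x_form[of n] x_nonzero[of n] by simp
  qed
  define c where "c = (\<lambda>n::nat. (if even n then Ap else Am) * (if even n then Bp else Bm) ^ (n div 2)
                        * \<mu> ^ ((n div 2) ^ 2))"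
  have xc: "x n = c n * weierstrass_sigma \<Lambda> (pt n)" for n
    using x_form[of n] by (simp add: c_def pt_def add.commute)
  have x_ratio: "x n * x (n+3) = x (n+1) * x (n+2) * (v (pt (n+1)) * v (pt (n+2)))" for n
  proof -
    have pt: "pt (n+1) - \<kappa> = pt n" "pt (n+1) + \<kappa> = pt (n+2)" "pt (n+1) + 2 * \<kappa> = pt (n+3)"
      by (simp_all add: pt_def algebra_simps)
    have "weierstrass_sigma \<Lambda> \<kappa> \<noteq> 0" using \<kappa>(1) by (simp add: sigma_eq_0_iff)
    then have c: "c n * c (n+3) * weierstrass_sigma \<Lambda> \<kappa> ^ 4 = c (n+1) * c (n+2)"
      unfolding c_def using \<mu> B by (rule prefactor_relation)
    have "x n * x (n+3) = c n * c (n+3) * (weierstrass_sigma \<Lambda> (pt n) * weierstrass_sigma \<Lambda> (pt (n+3)))"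
      by (simp add: xc mult_ac)
    also have "weierstrass_sigma \<Lambda> (pt n) * weierstrass_sigma \<Lambda> (pt (n+3))
        = weierstrass_sigma \<Lambda> (pt (n+1)) * weierstrass_sigma \<Lambda> (pt (n+2))
          * (weierstrass_sigma \<Lambda> \<kappa> ^ 4 * (v (pt (n+1)) * v (pt (n+2))))"
      by (rule sigma_step[of "pt (n+1)", unfolded pt, OF off off])
    also have "c n * c (n+3) * \<dots> = (c n * c (n+3) * weierstrass_sigma \<Lambda> \<kappa> ^ 4)
        * (weierstrass_sigma \<Lambda> (pt (n+1)) * weierstrass_sigma \<Lambda> (pt (n+2)) * (v (pt (n+1)) * v (pt (n+2))))"
      by (simp only: mult_ac)
    finally show ?thesis unfolding c xc[of "n+1"] xc[of "n+2"] by (simp only: mult_ac)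
  qed
  have shadow: "tangent \<alpha>0 \<beta>0 J0 x (Y j) n = 0" for j n
  proof -
    have "Y S1 = (\<lambda>k. (if even k then 1 else 0) * x k)" "Y S2 = (\<lambda>k. (if odd k then 1 else 0) * x k)"
      "Y S3 = (\<lambda>k. of_nat k * x k)" "Y S4 = (\<lambda>k. weierstrass_zeta \<Lambda> (pt k) * x k)"
      by (auto simp: Y pt_def)
    moreover have "tangent \<alpha>0 \<beta>0 J0 x (\<lambda>k. weierstrass_zeta \<Lambda> (pt k) * x k) n = 0"
      unfolding pt_def
      by (rule zeta_shadow_tangent[of z0 x \<alpha>0 \<beta>0 n, unfolded J \<kappa>(3),
            OF off[unfolded pt_def] x_nonzero x_ratio[unfolded pt_def] defect mut(1)])
    ultimately show ?thesis
      by (cases j) (simp_all only: tangent_multiple[OF defect], simp_all)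
  qed
  have G: "x (n+1) * x (n+2) ^ 2 * x (n+5) - x n * x (n+3) ^ 2 * x (n+4) \<noteq> 0" for n
    using C4_Suc[OF somos, of n] C4_nonzero[of "n+1"] by auto
  have formula_tangent: "tangent \<alpha>0 \<beta>0 J0 x (solution_formula \<alpha>0 \<beta>0 \<alpha>1 \<beta>1 J1 x Y f0) n = - F \<alpha>1 \<beta>1 J1 x n"
    for J1 f0 n
  proof -
    define f where "f = coefficient \<alpha>0 \<beta>0 \<alpha>1 \<beta>1 J1 x Y f0"
    \<comment> \<open>Coefficients frozen at n: \<open>y'\<close> is a combination of shadows, on
      which \<open>tangent\<close> vanishes, and it agrees with the formula from n to n+3.\<close>
    define y' where "y' k = (\<Sum>j\<in>{S1, S2, S3, S4}. f j n * Y j k)" for k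
    note vals = solution_formula_values[OF det4_nonzero, of \<alpha>0 \<beta>0 \<alpha>1 \<beta>1 J1 x f0 n, folded f_def y'_def]
    have "tangent \<alpha>0 \<beta>0 J0 x y' n = 0"
      unfolding y'_def[abs_def] tangent_combination shadow by simp
    moreover have "x (n+4) * F \<alpha>1 \<beta>1 J1 x n / C4 \<alpha>0 \<beta>0 x n * (C4 \<alpha>0 \<beta>0 x n / x (n+4)) = F \<alpha>1 \<beta>1 J1 x n"
      using C4_nonzero x_nonzero by simp
    ultimately show ?thesis
      using tangent_update[OF defect C4_nonzero x_nonzero vals(1-4)] vals(5) by simp
  qed
  have formula: "linear_somos5 \<alpha>0 \<beta>0 \<alpha>1 \<beta>1 x y
      \<and> (\<forall>n. somos5_integral_at (Dual \<alpha>0 \<alpha>1) (Dual \<beta>0 \<beta>1) (\<lambda>m. Dual (x m) (y m)) (Dual J0 J1) n)"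
    if y: "y = solution_formula \<alpha>0 \<beta>0 \<alpha>1 \<beta>1 J1 x Y f0" for y J1 f0
  proof -
    have integral: "somos5_integral_at (Dual \<alpha>0 \<alpha>1) (Dual \<beta>0 \<beta>1) (\<lambda>m. Dual (x m) (y m)) (Dual J0 J1) n" for n
      by (simp add: dual_integral_iff defect y formula_tangent)
    have "somos5 (Dual \<alpha>0 \<alpha>1) (Dual \<beta>0 \<beta>1) (\<lambda>m. Dual (x m) (y m))"
    proof (rule dual_somos5_if_defect[where J = "Dual J0 J1"])
      show "somos5_defect (Dual \<alpha>0 \<alpha>1) (Dual \<beta>0 \<beta>1) (\<lambda>m. Dual (x m) (y m)) (Dual J0 J1) n = 0" for n
        using integral by (simp add: somos5_integral_at_iff)
      show "re_dual (Dual (x (n+1)) (y (n+1)) * Dual (x (n+2)) (y (n+2)) ^ 2 * Dual (x (n+5)) (y (n+5))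
          - Dual (x n) (y n) * Dual (x (n+3)) (y (n+3)) ^ 2 * Dual (x (n+4)) (y (n+4))) \<noteq> 0" for n
        using G[of n] unfolding dual_power2 by (simp add: times_dual_def minus_dual_def)
    qed
    then show ?thesis using integral by (simp add: dual_somos5_iff)
  qed
  have "\<exists>J1 f0. y = solution_formula \<alpha>0 \<beta>0 \<alpha>1 \<beta>1 J1 x Y f0" if lin: "linear_somos5 \<alpha>0 \<beta>0 \<alpha>1 \<beta>1 x y" for y
  proof -
    \<comment> \<open>\<open>F\<close> at 0 is affine in J1 with nonzero slope - x 0 x 1 x 2 x 3 x
      4, so this value makes the dual first integral hold at n = 0; the recurrence then propagates
      it.\<close>
    define J1 where "J1 = (tangent \<alpha>0 \<beta>0 J0 x y 0 + D \<alpha>1 \<beta>1 x 0) / (x 0 * x 1 * x 2 * x 3 * x 4)"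
    have "J1 * (x 0 * x 1 * x 2 * x 3 * x 4) = tangent \<alpha>0 \<beta>0 J0 x y 0 + D \<alpha>1 \<beta>1 x 0"
      using x_nonzero by (simp add: J1_def)
    moreover have "F \<alpha>1 \<beta>1 J1 x 0 = D \<alpha>1 \<beta>1 x 0 - J1 * (x 0 * x 1 * x 2 * x 3 * x 4)"
      by (simp only: F_def mult.assoc add_0)
    ultimately have "tangent \<alpha>0 \<beta>0 J0 x y 0 = - F \<alpha>1 \<beta>1 J1 x 0"
      by simp
    then have "somos5_integral_at (Dual \<alpha>0 \<alpha>1) (Dual \<beta>0 \<beta>1) (\<lambda>m. Dual (x m) (y m)) (Dual J0 J1) 0"
      unfolding dual_integral_iff using defect by blast
    then have init: "somos5_defect (Dual \<alpha>0 \<alpha>1) (Dual \<beta>0 \<beta>1) (\<lambda>m. Dual (x m) (y m)) (Dual J0 J1) 0 = 0"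
      unfolding somos5_integral_at_iff .
    have dual: "somos5 (Dual \<alpha>0 \<alpha>1) (Dual \<beta>0 \<beta>1) (\<lambda>m. Dual (x m) (y m))"
      unfolding dual_somos5_iff using somos lin by blast
    have "somos5_integral_at (Dual \<alpha>0 \<alpha>1) (Dual \<beta>0 \<beta>1) (\<lambda>m. Dual (x m) (y m)) (Dual J0 J1) n" for n
      unfolding somos5_integral_at_iff
      by (rule dual_defect_all[where X = "\<lambda>m. Dual (x m) (y m)", OF dual _ init]) (simp add: x_nonzero)
    then have y_tangent: "tangent \<alpha>0 \<beta>0 J0 x y n = - F \<alpha>1 \<beta>1 J1 x n" for n
      unfolding dual_integral_iff by blast
    \<comment> \<open>The formula at index 4 already contains the increment of step 0, which amounts
      to \<open>K\<close>; the target for \<open>f0\<close> is lowered by it.\<close>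
    define K where "K = x (0+4) * F \<alpha>1 \<beta>1 J1 x 0 / C4 \<alpha>0 \<beta>0 x 0"
    obtain f0 where f0: "\<forall>k\<in>{1, 2, 3, 4}. (\<Sum>j\<in>{S1, S2, S3, S4}. f0 j * Y j (0+k)) = y k - (if k = 4 then K else 0)"
      using det4_solve[OF det4_nonzero, of 0 "\<lambda>k. y k - (if k = 4 then K else 0)"] by blast
    define z where "z = solution_formula \<alpha>0 \<beta>0 \<alpha>1 \<beta>1 J1 x Y f0"
    have z_lin: "linear_somos5 \<alpha>0 \<beta>0 \<alpha>1 \<beta>1 x z" using formula[OF z_def] by blast
    have coeff: "coefficient \<alpha>0 \<beta>0 \<alpha>1 \<beta>1 J1 x Y f0 j 0 = f0 j" for j
      by (simp add: coefficient_def)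
    note vals = solution_formula_values[OF det4_nonzero, of \<alpha>0 \<beta>0 \<alpha>1 \<beta>1 J1 x f0 0, folded z_def K_def, unfolded coeff add_0]
    have init: "z 1 = y 1" "z 2 = y 2" "z 3 = y 3" "z 4 = y 4"
      using vals(2-5) f0 by (simp_all del: sum.insert)
    \<comment> \<open>Both sequences have \<open>tangent\<close> equal to - F at n+1 with the same
      J1, so the nonzero leading coefficient forces equal next values.\<close>
    have step: "z (n+5) = y (n+5)"
      if "z (n+1) = y (n+1)" "z (n+2) = y (n+2)" "z (n+3) = y (n+3)" "z (n+4) = y (n+4)" for n
    proof -
      have idx: "n + 1 + 1 = n + 2" "n + 1 + 2 = n + 3" "n + 1 + 3 = n + 4" "n + 1 + 4 = n + 5" by simp_all
      have "(z (n+5) - y (n+5)) * (C4 \<alpha>0 \<beta>0 x (n+1) / x (n+5)) = 0"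
        using tangent_update[OF defect[of "n+1"] C4_nonzero x_nonzero, of z y] that
          y_tangent[of "n+1"] formula_tangent[of J1 f0 "n+1"]
        unfolding idx z_def[symmetric] by simp
      then show ?thesis using C4_nonzero x_nonzero by simp
    qed
    have later: "z (n+1) = y (n+1) \<and> z (n+2) = y (n+2) \<and> z (n+3) = y (n+3) \<and> z (n+4) = y (n+4)" for n
    proof (induction n)
      case 0
      show ?case using init unfolding add_0 by blast
    next
      case (Suc n)
      have idx: "Suc n + 1 = n + 2" "Suc n + 2 = n + 3" "Suc n + 3 = n + 4" "Suc n + 4 = n + 5" by simp_all
      show ?case using Suc step[of n] unfolding idx by blast
    qed
    \<comment> \<open>\<open>f0\<close> was fitted at the indices 1 to 4, the rows of
      \<open>det4\<close> at 0, so index 0 remains. The fifth-order recurrence at n = 0 recovers it,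
      because y 0 has the nonzero coefficient x 5 there.\<close>
    have eq5: "z 5 = y 5" using later[of 4] by simp
    have "x 0 * y 5 + y 0 * x 5 - \<alpha>0 * (x 1 * y 4 + y 1 * x 4) - \<beta>0 * (x 2 * y 3 + y 2 * x 3)
        = x 0 * z 5 + z 0 * x 5 - \<alpha>0 * (x 1 * z 4 + z 1 * x 4) - \<beta>0 * (x 2 * z 3 + z 2 * x 3)"
      by (rule trans[OF lin[unfolded linear_somos5_def, rule_format, of 0, unfolded add_0]
            sym[OF z_lin[unfolded linear_somos5_def, rule_format, of 0, unfolded add_0]]])
    then have "y 0 * x 5 = z 0 * x 5" unfolding init eq5 by simp
    then have "y 0 = z 0" using x_nonzero by simp
    then have "y n = z n" for n
      using later[of "n - 1"] by (cases n) simp_all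
    then show ?thesis unfolding z_def by blast
  qed
  then show ?thesis using formula unfolding Let_def by blast
qed

end
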